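(* Let $u_j=u(x,t;\omega_j)$, $j=1,\dots,J$, be an ensemble of weak solutions of the ensemble eddy viscosity model with the shear boundary conditions, each satisfying the energy inequality (model, boundary conditions and energy inequality as specified in the context), with $\mu>0$ constant and $\nu_{turb}=\mu\tau|u'|_e^2$. Then $$\limsup_{T\to\infty}\frac1T\int_0^T\varepsilon_{\text{model}}\,dt\ \le\ \left(\frac52+16\frac{\nu}{\nu_{eff}}+32\,\limsup_{T\to\infty}\frac1T\int_0^T\frac{1}{|\mathcal S_\beta|}\int_{\mathcal S_\beta}\frac{\nu_{turb}}{\nu_{eff}}\,dx\,dt\right)\frac{U^3}{L}.$$
   Context: Setting. $L,U,\nu,\tau>0$, $J\ge1$ an integer, $\Omega=(0,L)^3$, with points written $(x,y,z)$ (abbreviated $x$). The large scale turnover time is $T^*=L/U$; $\tau$ is a selected time scale with $\tau\le T^*$. $\nu$ is the kinematic viscosity. Model. For $j=1,\dots,J$, $u=u(x,t;\omega_j)\in\mathbb R^3$, $p=p(x,t;\omega_j)$ satisfy (weakly, in the standard sense) $$u_t+u\cdot\nabla u-\nu\Delta u-\nabla\cdot(\nu_{turb}\nabla u)+\nabla p=0,\quad \nabla\cdot u=0\ \text{ in }\Omega,\qquad u(x,0;\omega_j)=u^0_j(x),$$ with $u_j^0\in L^2(\Omega)$ divergence free. Shear boundary conditions: $u$ is $L$-periodic in $x$ and in $y$, $u=(0,0,0)$ at $z=0$, and $u=(U,0,0)$ at $z=L$. Ensemble quantities: $\langle\psi\rangle_e=\frac1J\sum_{j=1}^J\psi(\omega_j)$;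 $u'(x,t;\omega_j)=u(x,t;\omega_j)-\langle u\rangle_e(x,t)$; $|u'|_e^2(x,t)=\frac1J\sum_{j=1}^J|u'(x,t;\omega_j)|^2$. The eddy viscosity is $\nu_{turb}(x,t)=\mu\tau|u'(x,t)|_e^2$. Energy inequality: for each $j$ and every divergence free $\phi(x,y,z)$ with $\phi,\nabla\phi\in L^2(\Omega)$ satisfying the shear boundary conditions, $$\frac12\frac{d}{dt}\|u\|^2+\int_\Omega[\nu+\nu_{turb}]|\nabla u|^2dx\le(u_t,\phi)+\int_\Omega[\nu+\nu_{turb}]\nabla u:\nabla\phi\,dx+(u\cdot\nabla u,\phi),$$ understood in time-integrated form over $[0,T]$, where $\|\cdot\|$ and $(\cdot,\cdot)$ are the $L^2(\Omega)$ norm and inner product. Averages and dissipation: $\langle\psi\rangle_\infty=\limsup_{T\to\infty}\frac1T\int_0^T\psi(t)\,dt$, and $$\varepsilon_{\text{model}}(t)=\left\langle\frac1{|\Omega|}\int_\Omega\nu|\nabla u(x,t;\omega_j)|^2+\nu_{turb}|\nabla u(x,t;\omega_j)|^2dx\right\rangle_e.$$ Effective viscosity: $$\nu_{eff}=\frac{\big\langle\langle\frac1{|\Omega|}\int_\Omega[\nu+\nu_{turb}]|\nabla u|^2dx\rangle_e\big\rangle_\infty}{\big\langle\langle\frac1{|\Omega|}\int_\Omega|\nabla u|^2dx\rangle_e\big\rangle_\infty},$$ where the infinite time averages appearing here are finite. $\mathcal Re=UL/\nu$, $\mathcal Re_{eff}=UL/\nu_{eff}$, $\beta=\frac18\mathcal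 Re_{eff}^{-1}$. Near wall region: $\mathcal S_\beta=\{(x,y,z):0\le x\le L,\ 0\le y\le L,\ (1-\beta)L<z<L\}$.
   Formalization: The formal theorem additionally assumes that the near wall region S_β lies in the closure of Ω (β ≤ 1); for β > 1 the average of ν_turb over S_β is undefined, and Couette flow with Re < 2/37 violates the bound. *)

theory Defs
  imports "HOL-Analysis.Analysis"
begin

section \<open>Function spaces on the periodic box\<close>

definition Omega :: "real \<Rightarrow> (real^3) set" where
  "Omega L = box 0 (vec L)"

definition L2_on :: "'a::euclidean_space set \<Rightarrow> ('a \<Rightarrow> 'b::euclidean_space) \<Rightarrow> bool" where
  "L2_on S f \<longleftrightarrow> f \<in> borel_measurable (lebesgue_on S) \<and>
     set_integrable lebesgue S (\<lambda>x. (norm (f x))\<^sup>2)"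

definition C1_with_gradient :: "(real^3 \<Rightarrow> real) \<Rightarrow> (real^3 \<Rightarrow> real^3) \<Rightarrow> bool" where
  "C1_with_gradient \<psi> D\<psi> \<longleftrightarrow> (\<forall>x. GDERIV \<psi> x :> D\<psi> x) \<and> continuous_on UNIV D\<psi>"

definition compactly_supported_in :: "(real^3) set \<Rightarrow> (real^3 \<Rightarrow> real) \<Rightarrow> bool" where
  "compactly_supported_in S \<psi> \<longleftrightarrow> (\<exists>K. compact K \<and> K \<subseteq> S \<and> (\<forall>x. x \<notin> K \<longrightarrow> \<psi> x = 0))"

text \<open>Throughout, the gradient of a vector field \<open>v\<close> is the matrix field with entry
  \<open>G x $ i $ k\<close> equal to the \<open>k\<close>-th partial derivative of \<open>v $ i\<close>.  Then \<open>G x *v v x\<close> is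
  the convective term, and \<open>\<bullet>\<close> and \<open>norm\<close> on \<open>real^3^3\<close> are the Frobenius product
  and the Frobenius norm.  Test functions are of class \<open>C1\<close>, as only first derivatives of
  them occur.\<close>

definition weak_gradient ::
  "(real^3) set \<Rightarrow> (real^3 \<Rightarrow> real^3) \<Rightarrow> (real^3 \<Rightarrow> real^3^3) \<Rightarrow> bool" where
  "weak_gradient S v G \<longleftrightarrow>
     (\<forall>\<psi> D\<psi>. C1_with_gradient \<psi> D\<psi> \<and> compactly_supported_in S \<psi> \<longrightarrow>
       (\<forall>i k. (LINT x:S|lebesgue. v x $ i * D\<psi> x $ k) = - (LINT x:S|lebesgue. G x $ i $ k * \<psi> x)))"

definition weakly_divergence_free :: "(real^3) set \<Rightarrow> (real^3 \<Rightarrow> real^3) \<Rightarrow> bool" where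
  "weakly_divergence_free S v \<longleftrightarrow>
     (\<forall>\<psi> D\<psi>. C1_with_gradient \<psi> D\<psi> \<and> compactly_supported_in S \<psi> \<longrightarrow>
       (LINT x:S|lebesgue. v x \<bullet> D\<psi> x) = 0)"

definition on_face :: "3 \<Rightarrow> real \<Rightarrow> real^3 \<Rightarrow> real^3" where
  "on_face k c x = (\<chi> i. if i = k then c else x $ i)"

text \<open>Surface integral of \<open>f\<close> over the face of \<open>Omega L\<close> in the plane \<open>x $ k = c\<close>
  (\<open>c = 0\<close> or \<open>c = L\<close>).  The integrand below does not depend on \<open>x $ k\<close>, which
  ranges over an interval of length \<open>L\<close>; hence the factor \<open>1 / L\<close>.\<close>

definition face_integral :: "real \<Rightarrow> 3 \<Rightarrow> real \<Rightarrow> (real^3 \<Rightarrow> real) \<Rightarrow> real" where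
  "face_integral L k c f = (1 / L) * (LINT x:Omega L|lebesgue. f (on_face k c x))"

text \<open>The trace of a Sobolev function \<open>v\<close> with gradient \<open>G\<close> on the boundary of the box: the
  integrable boundary function \<open>b\<close> (unique almost everywhere on each face) for which Green's formula
  holds against every test function, with no condition on the boundary values of the test function.
  Only the values of \<open>b\<close> on the six faces matter.\<close>

definition boundary_trace ::
  "real \<Rightarrow> (real^3 \<Rightarrow> real^3) \<Rightarrow> (real^3 \<Rightarrow> real^3^3) \<Rightarrow> (real^3 \<Rightarrow> real^3) \<Rightarrow> bool" where
  "boundary_trace L v G b \<longleftrightarrow>
     (\<forall>k. \<forall>c\<in>{0, L}. set_integrable lebesgue (Omega L) (\<lambda>x. b (on_face k c x))) \<and>
     (\<forall>\<psi> D\<psi>. C1_with_gradient \<psi> D\<psi> \<longrightarrow>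
       (\<forall>i k. (LINT x:Omega L|lebesgue. v x $ i * D\<psi> x $ k)
               + (LINT x:Omega L|lebesgue. G x $ i $ k * \<psi> x)
             = face_integral L k L (\<lambda>x. b x $ i * \<psi> x) - face_integral L k 0 (\<lambda>x. b x $ i * \<psi> x)))"

definition shear_boundary_values :: "real \<Rightarrow> real \<Rightarrow> (real^3 \<Rightarrow> real^3) \<Rightarrow> bool" where
  "shear_boundary_values L U b \<longleftrightarrow>
     (\<forall>x \<in> cbox 0 (vec L).
        b (on_face 1 L x) = b (on_face 1 0 x) \<and>
        b (on_face 2 L x) = b (on_face 2 0 x) \<and>
        b (on_face 3 0 x) = 0 \<and>
        b (on_face 3 L x) = vector [U, 0, 0])"

definition H1_shear :: "real \<Rightarrow> real \<Rightarrow> (real^3 \<Rightarrow> real^3) \<Rightarrow> (real^3 \<Rightarrow> real^3^3) \<Rightarrow> bool" where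
  "H1_shear L U v G \<longleftrightarrow>
     L2_on (Omega L) v \<and> L2_on (Omega L) G \<and> weak_gradient (Omega L) v G \<and>
     (\<exists>b. boundary_trace L v G b \<and> shear_boundary_values L U b)"

definition divergence_free :: "real \<Rightarrow> (real^3 \<Rightarrow> real^3^3) \<Rightarrow> bool" where
  "divergence_free L G \<longleftrightarrow> (AE x in lebesgue_on (Omega L). trace (G x) = 0)"


section \<open>The ensemble eddy viscosity model\<close>

definition ensemble_avg :: "nat \<Rightarrow> (nat \<Rightarrow> 'a::real_vector) \<Rightarrow> 'a" where
  "ensemble_avg J \<psi> = (1 / real J) *\<^sub>R (\<Sum>j=1..J. \<psi> j)"

definition fluctuation ::
  "nat \<Rightarrow> (nat \<Rightarrow> real \<Rightarrow> real^3 \<Rightarrow> real^3) \<Rightarrow> nat \<Rightarrow> real \<Rightarrow> real^3 \<Rightarrow> real^3" where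
  "fluctuation J u j t x = u j t x - ensemble_avg J (\<lambda>i. u i t x)"

definition nu_turb ::
  "real \<Rightarrow> real \<Rightarrow> nat \<Rightarrow> (nat \<Rightarrow> real \<Rightarrow> real^3 \<Rightarrow> real^3) \<Rightarrow> real \<Rightarrow> real^3 \<Rightarrow> real" where
  "nu_turb \<mu> \<tau> J u t x = \<mu> * \<tau> * ensemble_avg J (\<lambda>j. (norm (fluctuation J u j t x))\<^sup>2)"

text \<open>Space-time test fields \<open>w\<close> with time derivative \<open>wt\<close> and spatial gradient \<open>Dw\<close>:
  divergence free, periodic in the first two coordinates, zero on both walls, and vanishing for
  large times (but not at time \<open>0\<close>).\<close>

definition test_field ::
  "real \<Rightarrow> (real \<Rightarrow> real^3 \<Rightarrow> real^3) \<Rightarrow> (real \<Rightarrow> real^3 \<Rightarrow> real^3) \<Rightarrow> (real \<Rightarrow> real^3 \<Rightarrow> real^3^3) \<Rightarrow> bool" where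
  "test_field L w wt Dw \<longleftrightarrow>
     (\<forall>t x. ((\<lambda>(t, x). w t x) has_derivative (\<lambda>(s, h). s *\<^sub>R wt t x + Dw t x *v h)) (at (t, x))) \<and>
     continuous_on UNIV (\<lambda>(t, x). wt t x) \<and> continuous_on UNIV (\<lambda>(t, x). Dw t x) \<and>
     (\<forall>t. \<forall>x\<in>Omega L. trace (Dw t x) = 0) \<and>
     (\<forall>t x. w t (x + axis 1 L) = w t x \<and> w t (x + axis 2 L) = w t x) \<and>
     (\<forall>t x. x $ 3 = 0 \<or> x $ 3 = L \<longrightarrow> w t x = 0) \<and>
     (\<exists>T. \<forall>t\<ge>T. \<forall>x. w t x = 0)"

text \<open>Weak solutions, with spatial gradient \<open>Du\<close>, of the momentum equation with total viscosity
  \<open>\<nu> + \<nu>t\<close>.  The pressure is eliminated by the divergence free test fields, and the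
  initial condition is part of the integral identity.  The integrability of
  \<open>\<nu>t |Du|\<^sup>2\<close> gives a meaning to the eddy viscosity term.\<close>

definition weak_solution ::
  "real \<Rightarrow> real \<Rightarrow> real \<Rightarrow> (real \<Rightarrow> real^3 \<Rightarrow> real) \<Rightarrow> (real^3 \<Rightarrow> real^3)
    \<Rightarrow> (real \<Rightarrow> real^3 \<Rightarrow> real^3) \<Rightarrow> (real \<Rightarrow> real^3 \<Rightarrow> real^3^3) \<Rightarrow> bool" where
  "weak_solution L U \<nu> \<nu>t u0 u Du \<longleftrightarrow>
     (\<lambda>(t, x). u t x) \<in> borel_measurable (lebesgue_on ({0<..} \<times> Omega L)) \<and>
     (\<forall>T>0. \<exists>C. AE t in lebesgue_on {0<..<T}.
         L2_on (Omega L) (u t) \<and> (LINT x:Omega L|lebesgue. (norm (u t x))\<^sup>2) \<le> C) \<and>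
     (\<forall>T>0. L2_on ({0<..<T} \<times> Omega L) (\<lambda>(t, x). Du t x)) \<and>
     (\<forall>T>0. set_integrable lebesgue ({0<..<T} \<times> Omega L) (\<lambda>(t, x). \<nu>t t x * (norm (Du t x))\<^sup>2)) \<and>
     (AE t in lebesgue_on {0<..}. H1_shear L U (u t) (Du t) \<and> divergence_free L (Du t)) \<and>
     (\<forall>w wt Dw. test_field L w wt Dw \<longrightarrow>
        - (LINT (t, x):{0<..} \<times> Omega L|lebesgue. u t x \<bullet> wt t x)
        + (LINT (t, x):{0<..} \<times> Omega L|lebesgue. (Du t x *v u t x) \<bullet> w t x)
        + (LINT (t, x):{0<..} \<times> Omega L|lebesgue. (\<nu> + \<nu>t t x) * (Du t x \<bullet> Dw t x))
        = (LINT x:Omega L|lebesgue. u0 x \<bullet> w 0 x))"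

text \<open>The energy inequality integrated over \<open>[0, T]\<close>; as \<open>\<phi>\<close> does not depend on time, the
  term with the time derivative becomes \<open>(u(T) - u0, \<phi>)\<close>.  For a field \<open>\<phi>\<close> whose
  gradient is merely square integrable, the viscous integral on the right need not exist, so the
  inequality is only required when its right-hand side is meaningful.  It is required for almost
  every \<open>T\<close>, since a weak solution is determined at almost every time only.\<close>

definition energy_inequality ::
  "real \<Rightarrow> real \<Rightarrow> real \<Rightarrow> (real \<Rightarrow> real^3 \<Rightarrow> real) \<Rightarrow> (real^3 \<Rightarrow> real^3)
    \<Rightarrow> (real \<Rightarrow> real^3 \<Rightarrow> real^3) \<Rightarrow> (real \<Rightarrow> real^3 \<Rightarrow> real^3^3) \<Rightarrow> bool" where
  "energy_inequality L U \<nu> \<nu>t u0 u Du \<longleftrightarrow>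
     (\<forall>\<phi> D\<phi>. H1_shear L U \<phi> D\<phi> \<and> divergence_free L D\<phi> \<longrightarrow>
       (AE T in lebesgue_on {0<..}.
         set_integrable lebesgue ({0<..<T} \<times> Omega L) (\<lambda>(t, x). (\<nu> + \<nu>t t x) * (Du t x \<bullet> D\<phi> x)) \<and>
         set_integrable lebesgue ({0<..<T} \<times> Omega L) (\<lambda>(t, x). (Du t x *v u t x) \<bullet> \<phi> x) \<longrightarrow>
         1/2 * (LINT x:Omega L|lebesgue. (norm (u T x))\<^sup>2)
         - 1/2 * (LINT x:Omega L|lebesgue. (norm (u0 x))\<^sup>2)
         + (LINT (t, x):{0<..<T} \<times> Omega L|lebesgue. (\<nu> + \<nu>t t x) * (norm (Du t x))\<^sup>2)
         \<le> (LINT x:Omega L|lebesgue. (u T x - u0 x) \<bullet> \<phi> x)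
         + (LINT (t, x):{0<..<T} \<times> Omega L|lebesgue. (\<nu> + \<nu>t t x) * (Du t x \<bullet> D\<phi> x))
         + (LINT (t, x):{0<..<T} \<times> Omega L|lebesgue. (Du t x *v u t x) \<bullet> \<phi> x)))"


section \<open>Averages, effective viscosity and the near wall region\<close>

definition time_avg :: "(real \<Rightarrow> real) \<Rightarrow> ereal" where
  "time_avg \<psi> = Limsup at_top (\<lambda>T. ereal (1 / T * (LINT t:{0..T}|lebesgue. \<psi> t)))"

definition space_avg :: "(real^3) set \<Rightarrow> (real^3 \<Rightarrow> real) \<Rightarrow> real" where
  "space_avg S f = 1 / measure lebesgue S * (LINT x:S|lebesgue. f x)"

definition eps_model ::
  "real \<Rightarrow> real \<Rightarrow> (real \<Rightarrow> real^3 \<Rightarrow> real) \<Rightarrow> nat \<Rightarrow> (nat \<Rightarrow> real \<Rightarrow> real^3 \<Rightarrow> real^3^3) \<Rightarrow> real \<Rightarrow> real" where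
  "eps_model L \<nu> \<nu>t J Du t = ensemble_avg J (\<lambda>j. space_avg (Omega L)
     (\<lambda>x. \<nu> * (norm (Du j t x))\<^sup>2 + \<nu>t t x * (norm (Du j t x))\<^sup>2))"

definition viscous_avg ::
  "real \<Rightarrow> real \<Rightarrow> (real \<Rightarrow> real^3 \<Rightarrow> real) \<Rightarrow> nat \<Rightarrow> (nat \<Rightarrow> real \<Rightarrow> real^3 \<Rightarrow> real^3^3) \<Rightarrow> ereal" where
  "viscous_avg L \<nu> \<nu>t J Du = time_avg (\<lambda>t. ensemble_avg J (\<lambda>j. space_avg (Omega L)
     (\<lambda>x. (\<nu> + \<nu>t t x) * (norm (Du j t x))\<^sup>2)))"

definition gradient_avg :: "real \<Rightarrow> nat \<Rightarrow> (nat \<Rightarrow> real \<Rightarrow> real^3 \<Rightarrow> real^3^3) \<Rightarrow> ereal" where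
  "gradient_avg L J Du = time_avg (\<lambda>t. ensemble_avg J (\<lambda>j. space_avg (Omega L)
     (\<lambda>x. (norm (Du j t x))\<^sup>2)))"

definition nu_eff ::
  "real \<Rightarrow> real \<Rightarrow> (real \<Rightarrow> real^3 \<Rightarrow> real) \<Rightarrow> nat \<Rightarrow> (nat \<Rightarrow> real \<Rightarrow> real^3 \<Rightarrow> real^3^3) \<Rightarrow> real" where
  "nu_eff L \<nu> \<nu>t J Du = real_of_ereal (viscous_avg L \<nu> \<nu>t J Du) / real_of_ereal (gradient_avg L J Du)"

text \<open>A part of the flow domain only for \<open>\<beta> \<le> 1\<close>; for larger \<open>\<beta>\<close> the set below
  leaves the box, where the velocity is not defined.\<close>

definition near_wall_region :: "real \<Rightarrow> real \<Rightarrow> (real^3) set" where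
  "near_wall_region L \<beta> =
     {x. 0 \<le> x $ 1 \<and> x $ 1 \<le> L \<and> 0 \<le> x $ 2 \<and> x $ 2 \<le> L \<and> (1 - \<beta>) * L < x $ 3 \<and> x $ 3 < L}"

end

theory Submission
  imports Defs "HOL-Real_Asymp.Real_Asymp"
begin

text \<open>
  Test the energy inequality with the background flow \<open>\<phi> = (f z, 0, 0)\<close>, where \<open>f\<close> vanishes below the
  wall layer of thickness \<open>d = \<beta> L\<close> and rises linearly to \<open>U\<close> inside it.  The kinetic energy at the
  final time is absorbed by Young's inequality, and the viscous term costs half of the dissipation plus
  \<open>U\<^sup>2 / (2 d\<^sup>2)\<close> times the integral of \<open>\<nu> + \<nu>t\<close> over the layer.  In the convective term,
  \<open>u\<close> may be replaced by its difference from the wall velocity, since the horizontal mean of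
  \<open>\<partial>\<^sub>1 u\<^sub>1\<close> vanishes by periodicity; this difference vanishes at the wall, so a Poincare
  inequality in the layer bounds the term by \<open>U d \<parallel>\<nabla>u\<parallel>\<^sup>2\<close>.  The choice of \<open>\<beta>\<close> gives
  \<open>U d = \<nu>e / 8\<close>, and by the definition of \<open>\<nu>e\<close> the time average of this bound is one eighth of the
  dissipation.  Hence three eighths of the mean dissipation are at most \<open>4 U\<^sup>3 / L\<close> times the sum of
  \<open>\<nu> / \<nu>e\<close> and the mean of \<open>\<nu>t / \<nu>e\<close> over the layer.

  The trace condition is only a Green formula against \<open>C\<^sup>1\<close> functions.  Inserting smooth approximations of
  indicators of octants shows that \<open>u\<close> minus the wall velocity is, almost everywhere, minus the integral
  of its third partial derivative up to the wall, which yields the Poincare inequality.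
\<close>

section \<open>Fubini for Lebesgue measure\<close>

text \<open>The convective bound cannot be absorbed time by time: \<open>\<nu>e\<close> is a ratio
  of long-time averages, and nothing bounds it by the local viscosity \<open>\<nu> + \<nu>t\<close>.
  Absorption is possible only between the limits superior, where \<open>\<nu>e\<close> times the
  mean squared gradient is exactly the mean dissipation. This has three consequences. The averages
  must be finite, so that a multiple of the dissipation can be moved to the left. The gradient
  average must be positive for \<open>\<nu>e\<close> to be a genuine quotient; the velocity
  difference of the walls forces it to be at least \<open>U\<^sup>2 / L\<^sup>2\<close>. The
  estimate is wanted at every \<open>T > 0\<close>, while the energy inequality is given for almost
  every \<open>T\<close>; continuity of the time integrals closes the gap. The factor 3/8 is 1/2 -
  1/8: Young's inequality leaves half of the dissipation, and the convective term takes one eighth.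
  The thickness \<open>d\<close> is thus dictated by \<open>\<nu>e\<close>, and the layer fits into
  the box exactly when \<open>\<beta> \<le> 1\<close>; this is what the assumption on the near wall
  region supplies. A velocity field has no pointwise values at the wall, so every boundary statement
  has to be extracted from integral identities.\<close>

lemma AE_lebesgue_pair:
  fixes P :: "'a::euclidean_space \<times> 'b::euclidean_space \<Rightarrow> bool"
  assumes "AE z in lebesgue. P z"
  shows "AE x in lebesgue. AE y in lebesgue. P (x, y)"
proof -
  have "AE z in lborel \<Otimes>\<^sub>M lborel. P z"
    unfolding lborel_prod using assms by (simp add: AE_completion_iff)
  then show ?thesis
    by (simp add: AE_completion_iff lborel_pair.AE_pair)
qed

lemma lebesgue_ex_borel_representative:
  fixes f :: "'a::euclidean_space \<Rightarrow> real"
  assumes "f \<in> borel_measurable lebesgue"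
  obtains g where "g \<in> borel_measurable borel" "AE x in lebesgue. f x = g x"
  using completion_ex_borel_measurable_real[OF assms] by (auto simp: AE_completion_iff)

lemma integrable_lebesgue_iff_borel_representative:
  fixes f g :: "'a::euclidean_space \<Rightarrow> real"
  assumes g: "g \<in> borel_measurable borel" and eq: "AE x in lebesgue. f x = g x"
  shows "integrable lebesgue f \<longleftrightarrow> integrable lborel g"
    and "integral\<^sup>L lebesgue f = integral\<^sup>L lborel g"
proof -
  have gl: "g \<in> borel_measurable lebesgue" and gb: "g \<in> borel_measurable lborel"
    using g by (auto intro: measurable_completion)
  have fl: "f \<in> borel_measurable lebesgue"
    using eq by (intro borel_measurable_AE[OF gl]) (auto elim: eventually_mono)
  show "integrable lebesgue f \<longleftrightarrow> integrable lborel g"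
    using integrable_cong_AE[OF fl gl eq] integrable_completion[OF gb] by simp
  show "integral\<^sup>L lebesgue f = integral\<^sup>L lborel g"
    using integral_cong_AE[OF fl gl eq] integral_completion[OF gb] by simp
qed

text \<open>\<open>lebesgue\<close> on a product is the completion of the Borel product measure, not
  a product of two completions. Fubini is therefore applied to a Borel representative
  \<open>g\<close>; a null set has null sections over almost every \<open>x\<close>, so
  \<open>f\<close> and \<open>g\<close> may be exchanged in the inner integral.\<close>

lemma lebesgue_Fubini:
  fixes f :: "'a::euclidean_space \<times> 'b::euclidean_space \<Rightarrow> real"
  assumes f: "integrable lebesgue f"
  shows "AE x in lebesgue. integrable lebesgue (\<lambda>y. f (x, y))"
    and "integrable lebesgue (\<lambda>x. LINT y|lebesgue. f (x, y))"
    and "(LINT x|lebesgue. LINT y|lebesgue. f (x, y)) = integral\<^sup>L lebesgue f"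
proof -
  obtain g where g[measurable]: "g \<in> borel_measurable borel" and eq: "AE x in lebesgue. f x = g x"
    using lebesgue_ex_borel_representative f by (metis borel_measurable_integrable)
  note rep = integrable_lebesgue_iff_borel_representative
  have gi: "integrable (lborel \<Otimes>\<^sub>M lborel) g"
    using rep(1)[OF g eq] f by (simp add: lborel_prod)
  have gx[measurable]: "(\<lambda>y. g (x, y)) \<in> borel_measurable borel" for x
    by (rule measurable_compose[OF _ g]) (simp add: borel_prod[symmetric])
  have eqx: "AE x in lebesgue. AE y in lebesgue. f (x, y) = g (x, y)"
    by (rule AE_lebesgue_pair[OF eq])
  have "AE x in lebesgue. integrable lborel (\<lambda>y. g (x, y))"
    using lborel_pair.AE_integrable_fst'[OF gi] by (rule AE_completion)
  with eqx show "AE x in lebesgue. integrable lebesgue (\<lambda>y. f (x, y))"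
    by eventually_elim (simp add: rep(1)[OF gx])
  have gm: "(\<lambda>x. LINT y|lborel. g (x, y)) \<in> borel_measurable borel"
    using borel_measurable_integrable[OF lborel_pair.integrable_fst'[OF gi]] by simp
  have eqI: "AE x in lebesgue. (LINT y|lebesgue. f (x, y)) = (LINT y|lborel. g (x, y))"
    using eqx by eventually_elim (simp add: rep(2)[OF gx])
  show "integrable lebesgue (\<lambda>x. LINT y|lebesgue. f (x, y))"
    using rep(1)[OF gm eqI] lborel_pair.integrable_fst'[OF gi] by simp
  show "(LINT x|lebesgue. LINT y|lebesgue. f (x, y)) = integral\<^sup>L lebesgue f"
    using rep(2)[OF gm eqI] rep(2)[OF g eq] lborel_pair.integral_fst'[OF gi] by (simp add: lborel_prod)
qed

text \<open>Used to turn a bound on the spatial integral that holds at almost every time into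
  integrability over a space-time cylinder.\<close>

lemma lebesgue_Tonelli_integrable:
  fixes f :: "'a::euclidean_space \<times> 'b::euclidean_space \<Rightarrow> real"
  assumes f: "f \<in> borel_measurable lebesgue" and nonneg: "\<And>z. 0 \<le> f z"
    and fx: "AE x in lebesgue. integrable lebesgue (\<lambda>y. f (x, y)) \<and> (LINT y|lebesgue. f (x, y)) \<le> h x"
    and h: "integrable lebesgue h"
  shows "integrable lebesgue f"
proof -
  obtain g where g[measurable]: "g \<in> borel_measurable borel" and eq: "AE x in lebesgue. f x = g x"
    using lebesgue_ex_borel_representative f by metis
  \<comment> \<open>Clipping at zero keeps the representative equal to \<open>f\<close> almost
    everywhere, as \<open>f\<close> is nonnegative, and lets nonnegative integrals be compared with
    ordinary ones.\<close>
  define g' where "g' z = max 0 (g z)" for z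
  have g'[measurable]: "g' \<in> borel_measurable borel"
    unfolding g'_def by measurable
  have eq': "AE x in lebesgue. f x = g' x"
    using eq by eventually_elim (metis g'_def max_def nonneg)
  have gx[measurable]: "(\<lambda>y. g' (x, y)) \<in> borel_measurable borel" for x
    by (rule measurable_compose[OF _ g']) (simp add: borel_prod[symmetric])
  note rep = integrable_lebesgue_iff_borel_representative
  have g'm: "g' \<in> borel_measurable (lborel \<Otimes>\<^sub>M lborel)"
    by (simp add: lborel_prod)
  have bnd: "AE x in lebesgue. (\<integral>\<^sup>+y. ennreal (g' (x, y)) \<partial>lborel) \<le> ennreal (h x)"
    using fx AE_lebesgue_pair[OF eq']
  proof eventually_elim
    case (elim x)
    then have "integrable lborel (\<lambda>y. g' (x, y))" "(LINT y|lborel. g' (x, y)) \<le> h x"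
      using rep[OF gx, of "\<lambda>y. f (x, y)"] by auto
    then show ?case
      by (subst nn_integral_eq_integral) (auto simp: g'_def intro: ennreal_leI)
  qed
  have "(\<integral>\<^sup>+z. ennreal (norm (g' z)) \<partial>(lborel \<Otimes>\<^sub>M lborel)) = (\<integral>\<^sup>+z. ennreal (g' z) \<partial>(lborel \<Otimes>\<^sub>M lborel))"
    by (simp add: g'_def)
  also have "\<dots> = (\<integral>\<^sup>+x. \<integral>\<^sup>+y. ennreal (g' (x, y)) \<partial>lborel \<partial>lborel)"
    using g'm by (subst lborel.nn_integral_fst) auto
  \<comment> \<open>The outer measure is completed here because the bound \<open>h\<close> is only
    Lebesgue measurable.\<close>
  also have "\<dots> \<le> (\<integral>\<^sup>+x. \<integral>\<^sup>+y. ennreal (g' (x, y)) \<partial>lborel \<partial>lebesgue)"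
    by (simp add: nn_integral_completion)
  also have "\<dots> \<le> (\<integral>\<^sup>+x. ennreal (h x) \<partial>lebesgue)"
    using bnd by (rule nn_integral_mono_AE)
  also have "\<dots> \<le> (\<integral>\<^sup>+x. ennreal (norm (h x)) \<partial>lebesgue)"
    by (intro nn_integral_mono ennreal_leI) simp
  also have "\<dots> < \<infinity>"
    using h by (simp add: integrable_iff_bounded)
  finally have "integrable (lborel \<Otimes>\<^sub>M lborel) g'"
    using g'm by (simp add: integrable_iff_bounded)
  then show ?thesis
    using rep(1)[OF g' eq'] by (simp add: lborel_prod)
qed

lemma set_integrable_lebesgue_Fubini:
  fixes f :: "'a::euclidean_space \<times> 'b::euclidean_space \<Rightarrow> real"
  assumes f: "set_integrable lebesgue (A \<times> B) f"
  shows "AE x in lebesgue. x \<in> A \<longrightarrow> set_integrable lebesgue B (\<lambda>y. f (x, y))"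
    and "set_integrable lebesgue A (\<lambda>x. LINT y:B|lebesgue. f (x, y))"
    and "(LINT x:A|lebesgue. LINT y:B|lebesgue. f (x, y)) = (LINT z:A \<times> B|lebesgue. f z)"
proof -
  have ind: "indicat_real (A \<times> B) (x, y) = indicat_real A x * indicat_real B y" for x y
    by (auto simp: indicator_def)
  note F = lebesgue_Fubini[OF f[unfolded set_integrable_def]]
  show "AE x in lebesgue. x \<in> A \<longrightarrow> set_integrable lebesgue B (\<lambda>y. f (x, y))"
    using F(1) by eventually_elim (auto simp: set_integrable_def ind)
  have *: "(LINT y|lebesgue. indicat_real (A \<times> B) (x, y) *\<^sub>R f (x, y))
      = indicat_real A x *\<^sub>R (LINT y:B|lebesgue. f (x, y))" for x
    by (simp add: ind set_lebesgue_integral_def mult.assoc)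
  show "set_integrable lebesgue A (\<lambda>x. LINT y:B|lebesgue. f (x, y))"
    using F(2) by (simp only: * set_integrable_def)
  show "(LINT x:A|lebesgue. LINT y:B|lebesgue. f (x, y)) = (LINT z:A \<times> B|lebesgue. f z)"
    using F(3) by (simp only: * set_lebesgue_integral_def[of _ A] set_lebesgue_integral_def[of _ "A \<times> B"])
qed

text \<open>Exchanging an extra scalar with the \<open>k\<close>-th coordinate preserves Lebesgue measure; this turns
  Fubini in the \<open>k\<close>-th coordinate of \<open>real^3\<close> into Fubini on \<open>real \<times> real^3\<close>.\<close>

definition swap_coord :: "3 \<Rightarrow> real \<times> (real^3) \<Rightarrow> real \<times> (real^3)" where
  "swap_coord k p = (snd p $ k, on_face k (fst p) (snd p))"

lemma swap_coord_swap_coord [simp]: "swap_coord k (swap_coord k p) = p"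
  by (cases p) (simp add: swap_coord_def on_face_def vec_eq_iff)

lemma linear_on_face_pair: "linear (\<lambda>p. on_face k (fst p) (snd p))"
  by (rule linearI) (auto simp: on_face_def vec_eq_iff)

lemma swap_coord_measurable [measurable]: "swap_coord k \<in> borel_measurable borel"
  unfolding swap_coord_def
  by (intro borel_measurable_continuous_onI continuous_intros linear_continuous_on
      linear_on_face_pair[unfolded linear_conv_bounded_linear])

lemma swap_coord_Basis:
  assumes "b \<in> Basis"
  shows "swap_coord k b \<in> Basis"
proof -
  have swap: "swap_coord k (1, 0) = (0, axis k 1)"
    "swap_coord k (0, axis i 1) = (if i = k then (1, 0) else (0, axis i 1))" for i
    by (auto simp: swap_coord_def on_face_def axis_def vec_eq_iff)
  from assms consider "b = (1, 0)" | i where "b = (0, axis i 1)"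
    by (auto simp: Basis_prod_def Basis_vec_def)
  then show ?thesis
    by cases (auto simp: swap Basis_prod_def Basis_vec_def)
qed

lemma inner_swap_coord: "swap_coord k p \<bullet> swap_coord k q = p \<bullet> q"
proof -
  have "(\<Sum>i\<in>UNIV. v $ i * w $ i) = v $ k * w $ k + (\<Sum>i\<in>UNIV - {k}. v $ i * w $ i)" for v w :: "real^3"
    by (subst sum.remove[of UNIV k]) auto
  from this[of "on_face k (fst p) (snd p)" "on_face k (fst q) (snd q)"] this[of "snd p" "snd q"]
  show ?thesis
    by (cases p; cases q) (simp add: swap_coord_def inner_vec_def on_face_def)
qed

text \<open>\<open>swap_coord k\<close> is a self-adjoint involution that permutes the standard
  basis. Preimages of boxes are boxes with permuted side lengths, and the volumes of boxes determine
  Lebesgue measure.\<close>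

lemma distr_swap_coord: "distr lborel borel (swap_coord k) = lborel"
proof (rule lborel_eqI[symmetric])
  fix l u :: "real \<times> (real^3)"
  assume lu: "\<And>b. b \<in> Basis \<Longrightarrow> l \<bullet> b \<le> u \<bullet> b"
  have move: "swap_coord k p \<bullet> b = p \<bullet> swap_coord k b" for p b
    by (metis inner_swap_coord swap_coord_swap_coord)
  have box: "swap_coord k -` box l u = box (swap_coord k l) (swap_coord k u)"
  proof -
    have "(\<forall>b\<in>Basis. P (swap_coord k b)) \<longleftrightarrow> (\<forall>b\<in>Basis. P b)" for P
      by (metis swap_coord_Basis swap_coord_swap_coord)
    from this[of "\<lambda>b. l \<bullet> b < p \<bullet> swap_coord k b \<and> p \<bullet> swap_coord k b < u \<bullet> b" for p]
    show ?thesis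
      by (auto simp add: box_def move)
  qed
  have "emeasure (distr lborel borel (swap_coord k)) (box l u)
      = emeasure lborel (box (swap_coord k l) (swap_coord k u))"
    by (subst emeasure_distr) (auto simp: box)
  also have "\<dots> = (\<Prod>b\<in>Basis. (swap_coord k u - swap_coord k l) \<bullet> b)"
    using lu swap_coord_Basis by (subst emeasure_lborel_box) (auto simp: move)
  also have "(\<Prod>b\<in>Basis. (swap_coord k u - swap_coord k l) \<bullet> b) = (\<Prod>b\<in>Basis. (u - l) \<bullet> b)"
    by (rule prod.reindex_bij_witness[of _ "swap_coord k" "swap_coord k"])
       (auto simp: swap_coord_Basis inner_diff_left move)
  finally show "emeasure (distr lborel borel (swap_coord k)) (box l u) = (\<Prod>b\<in>Basis. (u - l) \<bullet> b)" .
qed simp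

lemma
  fixes f :: "real \<times> (real^3) \<Rightarrow> real"
  assumes [measurable]: "f \<in> borel_measurable borel"
  shows integrable_swap_coord: "integrable lborel (\<lambda>p. f (swap_coord k p)) \<longleftrightarrow> integrable lborel f"
    and integral_swap_coord: "(LINT p|lborel. f (swap_coord k p)) = (LINT p|lborel. f p)"
  using integrable_distr_eq[of "swap_coord k" lborel borel f] integral_distr[of "swap_coord k" lborel borel f]
  by (simp_all add: distr_swap_coord)

section \<open>Green's formula on the box\<close>

lemma mem_Omega: "x \<in> Omega L \<longleftrightarrow> (\<forall>i. 0 < x $ i \<and> x $ i < L)"
  by (simp add: Omega_def mem_box_cart)

lemma Omega_subset_cbox: "Omega L \<subseteq> cbox 0 (vec L)"
  by (simp add: Omega_def box_subset_cbox)

lemma Omega_borel [measurable]: "Omega L \<in> sets borel"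
  by (simp add: Omega_def)

lemma Omega_lebesgue [measurable]: "Omega L \<in> sets lebesgue"
  by (simp add: Omega_def)

lemma emeasure_Omega_finite: "emeasure lborel (Omega L) < \<infinity>"
  unfolding Omega_def by (rule emeasure_lborel_box_finite)

lemma measure_Omega:
  assumes "L > 0"
  shows "measure lebesgue (Omega L) = L ^ 3"
proof -
  have "measure lborel (Omega L) = (\<Prod>b\<in>Basis. (vec L - (0::real^3)) \<bullet> b)"
    unfolding Omega_def using assms
    by (subst measure_lborel_box_eq) (auto simp: Basis_vec_def inner_axis)
  also have "\<dots> = (\<Prod>b\<in>(Basis::(real^3) set). L)"
    by (rule prod.cong) (auto simp: Basis_vec_def inner_axis)
  finally show ?thesis
    by simp
qed

lemma on_face_nth [simp]: "on_face k c x $ i = (if i = k then c else x $ i)"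
  by (simp add: on_face_def)

lemma on_face_eq: "on_face k s x = x + (s - x $ k) *\<^sub>R axis k 1"
  by (auto simp: on_face_def vec_eq_iff axis_def)

lemma continuous_on_on_face: "continuous_on S (on_face k c)"
  unfolding on_face_eq[abs_def] by (intro continuous_intros)

lemma on_face_measurable [measurable]: "on_face k c \<in> borel_measurable borel"
  by (intro borel_measurable_continuous_onI continuous_on_on_face)

lemma on_face_line_measurable [measurable]: "(\<lambda>s. on_face k s x) \<in> borel_measurable borel"
  unfolding on_face_eq by (intro borel_measurable_continuous_onI continuous_intros)

lemma on_face_in_Omega: "x \<in> Omega L \<Longrightarrow> 0 < s \<Longrightarrow> s < L \<Longrightarrow> on_face k s x \<in> Omega L"
  by (auto simp: mem_Omega)

lemma set_integrable_lborel_imp_lebesgue: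
  fixes f :: "'a::euclidean_space \<Rightarrow> real"
  assumes "set_integrable lborel A f"
  shows "set_integrable lebesgue A f"
  using assms integrable_completion[of "\<lambda>x. indicator A x *\<^sub>R f x" lborel]
  by (auto simp: set_integrable_def dest: borel_measurable_integrable)

lemma set_integral_lebesgue_eq_lborel:
  fixes f :: "'a::euclidean_space \<Rightarrow> real"
  assumes [measurable]: "A \<in> sets borel" "f \<in> borel_measurable borel"
  shows "(LINT x:A|lebesgue. f x) = (LINT x:A|lborel. f x)"
  unfolding set_lebesgue_integral_def by (rule integral_completion) simp

lemma set_integrable_bounded:
  fixes f :: "'a::euclidean_space \<Rightarrow> real"
  assumes [measurable]: "A \<in> sets borel" "f \<in> borel_measurable borel"
    and A: "emeasure lborel A < \<infinity>" and f: "\<And>x. x \<in> A \<Longrightarrow> \<bar>f x\<bar> \<le> M"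
  shows "set_integrable lborel A f"
  unfolding set_integrable_def
proof (rule Bochner_Integration.integrable_bound[where f = "\<lambda>x. indicator A x * M"])
  show "integrable lborel (\<lambda>x. indicator A x * M)"
    using A by (intro integrable_mult_left) (auto intro: integrable_real_indicator)
  show "AE x in lborel. norm (indicat_real A x *\<^sub>R f x) \<le> norm (indicat_real A x * M)"
    using f by (auto simp: indicator_def intro!: AE_I2 intro: order_trans abs_ge_self)
qed simp

lemma continuous_bounded_on_box:
  fixes f :: "real^3 \<Rightarrow> real"
  assumes "continuous_on UNIV f"
  obtains M where "\<And>x. x \<in> cbox 0 (vec L) \<Longrightarrow> \<bar>f x\<bar> \<le> M"
proof -
  have "bounded (f ` cbox 0 (vec L))"
    by (meson assms compact_cbox compact_continuous_image compact_imp_bounded continuous_on_subset subset_UNIV)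
  then show thesis
    using that unfolding bounded_iff by (metis imageI real_norm_def)
qed

lemma continuous_set_integrable_Omega:
  fixes f :: "real^3 \<Rightarrow> real"
  assumes "continuous_on UNIV f"
  shows "set_integrable lborel (Omega L) f"
proof -
  obtain M where "\<And>x. x \<in> cbox 0 (vec L) \<Longrightarrow> \<bar>f x\<bar> \<le> M"
    using continuous_bounded_on_box[OF assms] by blast
  then show ?thesis
    using Omega_subset_cbox emeasure_Omega_finite assms
    by (intro set_integrable_bounded[of _ _ M] borel_measurable_continuous_onI) auto
qed

lemma integral_over_slab:
  fixes f :: "real \<times> (real^3) \<Rightarrow> real"
  assumes "set_integrable lborel ({0<..<L} \<times> Omega L) f"
  shows "(LINT x:Omega L|lborel. LINT s:{0<..<L}|lborel. f (s, x)) = (LINT p:{0<..<L} \<times> Omega L|lborel. f p)"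
    and "(LINT s:{0<..<L}|lborel. LINT x:Omega L|lborel. f (s, x)) = (LINT p:{0<..<L} \<times> Omega L|lborel. f p)"
    and "set_integrable lborel (Omega L) (\<lambda>x. LINT s:{0<..<L}|lborel. f (s, x))"
    and "AE x in lborel. x \<in> Omega L \<longrightarrow> set_integrable lborel {0<..<L} (\<lambda>s. f (s, x))"
proof -
  let ?h = "\<lambda>p. indicator ({0<..<L} \<times> Omega L) p *\<^sub>R f p"
  have ind: "indicator ({0<..<L} \<times> Omega L) (s, x) = (indicator {0<..<L} s * indicator (Omega L) x :: real)" for s x
    by (auto simp: indicator_def)
  have h: "integrable (lborel \<Otimes>\<^sub>M lborel) ?h"
    using assms by (simp add: set_integrable_def lborel_prod)
  have h2: "integrable (lborel \<Otimes>\<^sub>M lborel) (\<lambda>(s, x). ?h (s, x))"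
    using h by (simp add: case_prod_beta')
  have 1: "(LINT s|lborel. ?h (s, x)) = indicator (Omega L) x *\<^sub>R (LINT s:{0<..<L}|lborel. f (s, x))" for x
    unfolding set_lebesgue_integral_def ind
    by (auto simp: mult.assoc mult.left_commute simp flip: integral_mult_right_zero)
  have 2: "(LINT x|lborel. ?h (s, x)) = indicator {0<..<L} s *\<^sub>R (LINT x:Omega L|lborel. f (s, x))" for s
    unfolding set_lebesgue_integral_def ind
    by (auto simp: mult.assoc simp flip: integral_mult_right_zero)
  have "(LINT x|lborel. LINT s|lborel. ?h (s, x)) = integral\<^sup>L (lborel \<Otimes>\<^sub>M lborel) (\<lambda>(s, x). ?h (s, x))"
    by (rule lborel_pair.integral_snd[OF h2])
  then show "(LINT x:Omega L|lborel. LINT s:{0<..<L}|lborel. f (s, x)) = (LINT p:{0<..<L} \<times> Omega L|lborel. f p)"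
    by (simp only: 1 lborel_prod case_prod_eta) (simp add: set_lebesgue_integral_def case_prod_beta')
  show "(LINT s:{0<..<L}|lborel. LINT x:Omega L|lborel. f (s, x)) = (LINT p:{0<..<L} \<times> Omega L|lborel. f p)"
    using lborel_pair.integral_fst'[OF h]
    by (simp only: 2 lborel_prod) (simp add: set_lebesgue_integral_def)
  show "set_integrable lborel (Omega L) (\<lambda>x. LINT s:{0<..<L}|lborel. f (s, x))"
    using lborel_pair.integrable_snd[OF h2] by (simp only: 1 set_integrable_def)
  show "AE x in lborel. x \<in> Omega L \<longrightarrow> set_integrable lborel {0<..<L} (\<lambda>s. f (s, x))"
    using lborel_pair.AE_integrable_snd[OF h2]
    by eventually_elim (auto simp: ind set_integrable_def indicator_def)
qed

text \<open>The slab is invariant because the extra interval has the same length and position as the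
  \<open>k\<close>-th edge of the box.\<close>

lemma indicator_slab_swap_coord:
  "indicator ({0<..<L} \<times> Omega L) (swap_coord k p) = (indicator ({0<..<L} \<times> Omega L) p :: real)"
  by (cases p) (auto simp: swap_coord_def indicator_def mem_Omega split: if_splits)

lemma
  fixes f :: "real \<times> (real^3) \<Rightarrow> real"
  assumes [measurable]: "f \<in> borel_measurable borel"
  shows set_integrable_slab_swap:
      "set_integrable lborel ({0<..<L} \<times> Omega L) (\<lambda>p. f (swap_coord k p))
        \<longleftrightarrow> set_integrable lborel ({0<..<L} \<times> Omega L) f"
    and integral_slab_swap:
      "(LINT p:{0<..<L} \<times> Omega L|lborel. f (swap_coord k p)) = (LINT p:{0<..<L} \<times> Omega L|lborel. f p)"
proof -
  have [measurable]: "{0<..<L} \<times> Omega L \<in> sets borel"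
    by (intro borel_open open_Times) (auto simp: Omega_def)
  have m: "(\<lambda>p. indicator ({0<..<L} \<times> Omega L) p *\<^sub>R f p) \<in> borel_measurable borel"
    by measurable
  show "set_integrable lborel ({0<..<L} \<times> Omega L) (\<lambda>p. f (swap_coord k p))
        \<longleftrightarrow> set_integrable lborel ({0<..<L} \<times> Omega L) f"
    using integrable_swap_coord[OF m] by (simp add: set_integrable_def indicator_slab_swap_coord)
  show "(LINT p:{0<..<L} \<times> Omega L|lborel. f (swap_coord k p)) = (LINT p:{0<..<L} \<times> Omega L|lborel. f p)"
    using integral_swap_coord[OF m] by (simp add: set_lebesgue_integral_def indicator_slab_swap_coord)
qed

lemma set_integrable_slab_snd:
  fixes f :: "real^3 \<Rightarrow> real"
  assumes L: "L > 0" and f: "set_integrable lborel (Omega L) f"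
  shows "set_integrable lborel ({0<..<L} \<times> Omega L) (\<lambda>p. f (snd p))"
    and "(LINT p:{0<..<L} \<times> Omega L|lborel. f (snd p)) = L * (LINT x:Omega L|lborel. f x)"
proof -
  let ?g = "\<lambda>x. indicat_real (Omega L) x * f x"
  have g: "integrable lborel ?g"
    using f by (simp add: set_integrable_def)
  note [measurable] = borel_measurable_integrable[OF g]
  have "integrable (lborel \<Otimes>\<^sub>M lborel) (\<lambda>(s, x). indicat_real {0<..<L} s * ?g x)"
  proof (rule lborel_pair.Fubini_integrable)
    have "integrable lborel (\<lambda>s. indicat_real {0<..<L} s * (LINT x|lborel. \<bar>?g x\<bar>))"
      using L by (intro integrable_mult_left integrable_real_indicator) auto
    then show "integrable lborel (\<lambda>s. LINT x|lborel. norm (case (s, x) of (s, x) \<Rightarrow> indicat_real {0<..<L} s * ?g x))"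
      by (simp add: abs_mult mult.assoc)
    show "AE s in lborel. integrable lborel (\<lambda>x. case (s, x) of (s, x) \<Rightarrow> indicat_real {0<..<L} s * ?g x)"
      using g by (auto intro!: AE_I2)
  qed (unfold case_prod_beta, measurable)
  moreover have "(\<lambda>(s, x). indicat_real {0<..<L} s * (indicat_real (Omega L) x * f x))
    = (\<lambda>p. indicat_real ({0<..<L} \<times> Omega L) p *\<^sub>R f (snd p))"
    by (auto simp: indicator_def fun_eq_iff)
  ultimately show *: "set_integrable lborel ({0<..<L} \<times> Omega L) (\<lambda>p. f (snd p))"
    by (simp add: set_integrable_def lborel_prod)
  show "(LINT p:{0<..<L} \<times> Omega L|lborel. f (snd p)) = L * (LINT x:Omega L|lborel. f x)"
    using integral_over_slab(2)[OF *] L by (simp add: set_integral_const)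
qed

text \<open>The divergence theorem in one coordinate: the fundamental theorem of calculus on each
  line, assumed here as \<open>FTC\<close>, is integrated over the box. Stating it for a bounded
  \<open>D\<close> rather than a continuous one admits functions with a kink.\<close>

lemma Green_box:
  fixes F D :: "real^3 \<Rightarrow> real"
  assumes L: "L > 0" and [measurable]: "D \<in> borel_measurable borel"
    and D: "\<And>x. x \<in> Omega L \<Longrightarrow> \<bar>D x\<bar> \<le> M" and F: "continuous_on UNIV F"
    and FTC: "\<And>x. x \<in> Omega L \<Longrightarrow>
      F (on_face k L x) - F (on_face k 0 x) = (LINT s:{0<..<L}|lborel. D (on_face k s x))"
  shows "(LINT x:Omega L|lebesgue. D x) = face_integral L k L F - face_integral L k 0 F"
proof -
  have [measurable]: "F \<in> borel_measurable borel"
    using F by (rule borel_measurable_continuous_onI)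
  have intD: "set_integrable lborel (Omega L) D"
    using D emeasure_Omega_finite by (intro set_integrable_bounded) auto
  note slab = set_integrable_slab_snd[OF L intD]
  have Dsnd: "(\<lambda>p. D (snd p)) \<in> borel_measurable (borel :: (real \<times> (real^3)) measure)"
    unfolding borel_prod[symmetric] by measurable
  have intF: "set_integrable lborel (Omega L) (\<lambda>x. F (on_face k c x))" for c
    by (intro continuous_set_integrable_Omega continuous_on_compose2[OF F] continuous_on_on_face) auto
  have "set_integrable lborel ({0<..<L} \<times> Omega L) (\<lambda>p. D (snd (swap_coord k p)))"
    using slab(1) set_integrable_slab_swap[OF Dsnd] by blast
  from integral_over_slab(1)[OF this] 
  have "(LINT x:Omega L|lborel. LINT s:{0<..<L}|lborel. D (on_face k s x))
      = (LINT p:{0<..<L} \<times> Omega L|lborel. D (snd (swap_coord k p)))"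
    by (simp add: swap_coord_def)
  \<comment> \<open>After the exchange of coordinates the extra scalar is idle and contributes only
    its length \<open>L\<close>, which cancels the \<open>1 / L\<close> in
    \<open>face_integral\<close>.\<close>
  also have "\<dots> = L * (LINT x:Omega L|lborel. D x)"
    using slab(2) integral_slab_swap[OF Dsnd] by simp
  also have "(LINT x:Omega L|lborel. LINT s:{0<..<L}|lborel. D (on_face k s x))
      = (LINT x:Omega L|lborel. F (on_face k L x) - F (on_face k 0 x))"
    by (intro set_lebesgue_integral_cong) (auto simp: FTC)
  also have "\<dots> = (LINT x:Omega L|lborel. F (on_face k L x)) - (LINT x:Omega L|lborel. F (on_face k 0 x))"
    by (intro set_integral_diff intF)
  finally show ?thesis
    using L by (simp add: face_integral_def set_integral_lebesgue_eq_lborel field_simps)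
qed

section \<open>Integrability criteria on the box\<close>

lemma set_integrable_dominated:
  fixes g h :: "'a::euclidean_space \<Rightarrow> real"
  assumes S: "S \<in> sets lebesgue" and g: "g \<in> borel_measurable (lebesgue_on S)"
    and h: "set_integrable lebesgue S h" and bound: "AE x in lebesgue. x \<in> S \<longrightarrow> \<bar>g x\<bar> \<le> h x"
  shows "set_integrable lebesgue S g"
proof -
  have "integrable (lebesgue_on S) h"
    using h S by (simp add: set_integrable_eq)
  moreover have "AE x in lebesgue_on S. norm (g x) \<le> norm (h x)"
    using bound by (subst AE_restrict_space_iff) (use S in \<open>auto elim!: eventually_mono\<close>)
  ultimately have "integrable (lebesgue_on S) g"
    using g by (intro Bochner_Integration.integrable_bound[of _ h g])
  then show ?thesis
    using S by (simp add: set_integrable_eq)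
qed

lemma set_integrable_finite_const:
  assumes "S \<in> sets lebesgue" "emeasure lebesgue S < \<infinity>"
  shows "set_integrable lebesgue S (\<lambda>x. c :: real)"
  unfolding set_integrable_def using assms by (intro integrable_scaleR_left integrable_real_indicator) auto

lemma set_integrable_Omega_const: "set_integrable lebesgue (Omega L) (\<lambda>x. c :: real)"
  using emeasure_Omega_finite[of L] by (intro set_integrable_finite_const) auto

lemma borel_measurable_vec_nth:
  assumes "f \<in> borel_measurable M"
  shows "(\<lambda>x. f x $ i) \<in> borel_measurable M"
  using assms by (rule measurable_compose) (intro borel_measurable_continuous_onI continuous_intros)

lemma abs_mult_le_square:
  fixes a b :: real
  assumes "\<bar>b\<bar> \<le> M"
  shows "\<bar>a * b\<bar> \<le> a\<^sup>2 + M\<^sup>2"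
proof -
  have "2 * (\<bar>a\<bar> * \<bar>b\<bar>) \<le> a\<^sup>2 + b\<^sup>2"
    using sum_squares_bound[of "\<bar>a\<bar>" "\<bar>b\<bar>"] by (simp add: mult.assoc)
  moreover have "b\<^sup>2 \<le> M\<^sup>2"
    using assms by (metis abs_ge_zero order_trans abs_le_square_iff abs_of_nonneg)
  moreover have "0 \<le> \<bar>a\<bar> * \<bar>b\<bar>"
    by simp
  ultimately have "\<bar>a\<bar> * \<bar>b\<bar> \<le> a\<^sup>2 + M\<^sup>2"
    by linarith
  then show ?thesis
    by (simp add: abs_mult)
qed

lemma L2_times_bounded_integrable:
  fixes f :: "real^3 \<Rightarrow> 'b::euclidean_space" and a b :: "real^3 \<Rightarrow> real"
  assumes f: "L2_on (Omega L) f" and a: "a \<in> borel_measurable (lebesgue_on (Omega L))"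
    and b: "b \<in> borel_measurable (lebesgue_on (Omega L))"
    and le: "\<And>x. x \<in> Omega L \<Longrightarrow> \<bar>a x\<bar> \<le> norm (f x)" and M: "\<And>x. x \<in> Omega L \<Longrightarrow> \<bar>b x\<bar> \<le> M"
  shows "set_integrable lebesgue (Omega L) (\<lambda>x. a x * b x)"
proof (rule set_integrable_dominated[where h = "\<lambda>x. (norm (f x))\<^sup>2 + M\<^sup>2"])
  show "set_integrable lebesgue (Omega L) (\<lambda>x. (norm (f x))\<^sup>2 + M\<^sup>2)"
    using f by (intro set_integral_add set_integrable_Omega_const) (auto simp: L2_on_def)
  have "\<bar>a x * b x\<bar> \<le> (norm (f x))\<^sup>2 + M\<^sup>2" if "x \<in> Omega L" for x
    using abs_mult_le_square[OF M[OF that], of "a x"] power_mono[OF le[OF that], of 2] by simp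
  then show "AE x in lebesgue. x \<in> Omega L \<longrightarrow> \<bar>a x * b x\<bar> \<le> (norm (f x))\<^sup>2 + M\<^sup>2"
    by simp
qed (use a b in \<open>auto\<close>)

lemma borel_imp_lebesgue_on:
  fixes f :: "'a::euclidean_space \<Rightarrow> 'b::euclidean_space"
  assumes "f \<in> borel_measurable borel"
  shows "f \<in> borel_measurable (lebesgue_on S)"
  using assms by (intro measurable_restrict_space1 measurable_completion) simp

section \<open>The background shear flow\<close>

definition ramp :: "real \<Rightarrow> real \<Rightarrow> real" where
  "ramp r z = max 0 (z - r)"

lemma continuous_ramp [continuous_intros]: "continuous_on S f \<Longrightarrow> continuous_on S (\<lambda>x. ramp r (f x))"
  unfolding ramp_def by (intro continuous_intros)

lemma ramp_has_real_derivative: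
  assumes "z \<noteq> r"
  shows "(ramp r has_real_derivative (if r < z then 1 else 0)) (at z)"
proof (cases "r < z")
  case True
  have "((\<lambda>z. z - r) has_real_derivative 1) (at z)"
    by (auto intro!: derivative_eq_intros)
  then have "(ramp r has_real_derivative 1) (at z)"
    by (rule has_field_derivative_transform_within_open[where S = "{r<..}"]) (use True in \<open>auto simp: ramp_def\<close>)
  with True show ?thesis by simp
next
  case False
  have "((\<lambda>z. 0) has_real_derivative 0) (at z)"
    by simp
  then have "(ramp r has_real_derivative 0) (at z)"
    by (rule has_field_derivative_transform_within_open[where S = "{..<r}"]) (use False assms in \<open>auto simp: ramp_def\<close>)
  with False show ?thesis by simp
qed

lemma C1_with_gradient_continuous:
  assumes "C1_with_gradient \<psi> D\<psi>"
  shows "continuous_on UNIV \<psi>" "continuous_on UNIV (\<lambda>x. D\<psi> x $ k)"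
  using assms unfolding C1_with_gradient_def gderiv_def
  by (auto intro!: continuous_intros simp: continuous_on_eq_continuous_at intro: has_derivative_continuous)

lemma C1_line_derivative:
  assumes "C1_with_gradient \<psi> D\<psi>"
  shows "((\<lambda>s. \<psi> (on_face k s x)) has_real_derivative D\<psi> (on_face k s x) $ k) (at s)"
proof -
  have "((\<lambda>s. on_face k s x) has_derivative (\<lambda>h. h *\<^sub>R axis k 1)) (at s)"
    unfolding on_face_eq by (auto intro!: derivative_eq_intros)
  moreover have "(\<psi> has_derivative (\<lambda>h. h \<bullet> D\<psi> (on_face k s x))) (at (on_face k s x))"
    using assms by (simp add: C1_with_gradient_def gderiv_def)
  ultimately have "((\<lambda>s. \<psi> (on_face k s x)) has_derivative (\<lambda>h. (h *\<^sub>R axis k 1) \<bullet> D\<psi> (on_face k s x))) (at s)"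
    by (rule has_derivative_compose)
  then show ?thesis
    by (simp add: has_field_derivative_def inner_axis' mult_commute_abs)
qed

text \<open>Two uses: with \<open>m = 0\<close> it is Green's formula for a constant, needed to
  subtract the wall velocity; with \<open>a = 0\<close> it shows that the background flow has the
  expected gradient and trace in spite of its kink.\<close>

lemma Green_ramp:
  assumes L: "L > 0" and \<psi>: "C1_with_gradient \<psi> D\<psi>"
  shows "(LINT x:Omega L|lebesgue. (a + m * ramp r (x $ 3)) * D\<psi> x $ k)
      + (LINT x:Omega L|lebesgue. (if k = 3 \<and> r < x $ 3 then m else 0) * \<psi> x)
    = face_integral L k L (\<lambda>x. (a + m * ramp r (x $ 3)) * \<psi> x)
      - face_integral L k 0 (\<lambda>x. (a + m * ramp r (x $ 3)) * \<psi> x)"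
proof -
  note cont = C1_with_gradient_continuous[OF \<psi>]
  define F where "F x = (a + m * ramp r (x $ 3)) * \<psi> x" for x :: "real^3"
  define D1 where "D1 x = (a + m * ramp r (x $ 3)) * D\<psi> x $ k" for x :: "real^3"
  define D2 where "D2 x = (if k = 3 \<and> r < x $ 3 then m else 0) * \<psi> x" for x :: "real^3"
  have contF: "continuous_on UNIV F" and contD1: "continuous_on UNIV D1"
    unfolding F_def D1_def by (intro continuous_intros cont)+
  have [measurable]: "\<psi> \<in> borel_measurable borel" "D1 \<in> borel_measurable borel"
    using cont contD1 by (auto intro: borel_measurable_continuous_onI)
  have [measurable]: "(\<lambda>x::real^3. x $ 3) \<in> borel_measurable borel"
    by (intro borel_measurable_continuous_onI continuous_intros)
  have [measurable]: "D2 \<in> borel_measurable borel"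
    unfolding D2_def by measurable
  obtain M1 where M1: "\<And>x. x \<in> cbox 0 (vec L) \<Longrightarrow> \<bar>D1 x\<bar> \<le> M1"
    using continuous_bounded_on_box[OF contD1] by blast
  obtain M2 where M2: "\<And>x. x \<in> cbox 0 (vec L) \<Longrightarrow> \<bar>\<psi> x\<bar> \<le> M2"
    using continuous_bounded_on_box[OF cont(1)] by blast
  have bD1: "\<bar>D1 x\<bar> \<le> M1" if "x \<in> Omega L" for x
    using that Omega_subset_cbox M1 by blast
  have bD2: "\<bar>D2 x\<bar> \<le> \<bar>m\<bar> * M2" if "x \<in> Omega L" for x
  proof -
    have "\<bar>\<psi> x\<bar> \<le> M2"
      using that Omega_subset_cbox M2 by blast
    then show ?thesis
      unfolding D2_def abs_mult by (intro mult_mono) auto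
  qed
  have bD: "\<bar>D1 x + D2 x\<bar> \<le> M1 + \<bar>m\<bar> * M2" if "x \<in> Omega L" for x
    using bD1[OF that] bD2[OF that] by linarith
  have FTC: "F (on_face k L x) - F (on_face k 0 x)
      = (LINT s:{0<..<L}|lborel. D1 (on_face k s x) + D2 (on_face k s x))" if x: "x \<in> Omega L" for x
  proof -
    have deriv: "((\<lambda>s. F (on_face k s x)) has_vector_derivative (D1 (on_face k s x) + D2 (on_face k s x))) (at s)"
      if "s \<noteq> r" for s
    proof -
      have "((\<lambda>s. ramp r (on_face k s x $ 3)) has_real_derivative (if k = 3 \<and> r < on_face k s x $ 3 then 1 else 0)) (at s)"
        using ramp_has_real_derivative[OF that] by (cases "k = 3") auto
      from DERIV_mult[OF DERIV_add[OF DERIV_const[of a] DERIV_cmult[OF this, of m]] C1_line_derivative[OF \<psi>, of k x s]]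
      show ?thesis
        unfolding F_def D1_def D2_def has_real_derivative_iff_has_vector_derivative[symmetric]
        by (rule DERIV_cong) (auto simp: algebra_simps)
    qed
    have cF: "continuous_on {0..L} (\<lambda>s. F (on_face k s x))"
      unfolding on_face_eq by (intro continuous_on_compose2[OF contF] continuous_intros) auto
    \<comment> \<open>The integrand along the line may jump at \<open>s = r\<close>, where the ramp
      has its kink. Since \<open>F\<close> is continuous, the fundamental theorem tolerates this one
      exceptional point.\<close>
    have "((\<lambda>s. D1 (on_face k s x) + D2 (on_face k s x)) has_integral F (on_face k L x) - F (on_face k 0 x)) {0..L}"
      using L deriv cF by (intro fundamental_theorem_of_calculus_interior_strong[of "{r}"]) auto
    then have hi: "integral {0<..<L} (\<lambda>s. D1 (on_face k s x) + D2 (on_face k s x)) = F (on_face k L x) - F (on_face k 0 x)"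
      by (simp add: integral_open_interval_real[symmetric] integral_unique)
    have "set_integrable lborel {0<..<L} (\<lambda>s. D1 (on_face k s x) + D2 (on_face k s x))"
      using bD on_face_in_Omega[OF x] L by (intro set_integrable_bounded[where M = "M1 + \<bar>m\<bar> * M2"]) auto
    from set_borel_integral_eq_integral(2)[OF this] hi show ?thesis
      by simp
  qed
  have "(LINT x:Omega L|lebesgue. D1 x + D2 x) = face_integral L k L F - face_integral L k 0 F"
    by (rule Green_box[OF L _ bD contF FTC]) auto
  moreover have "set_integrable lebesgue (Omega L) D1" "set_integrable lebesgue (Omega L) D2"
    using bD1 bD2 emeasure_Omega_finite
    by (auto intro!: set_integrable_lborel_imp_lebesgue set_integrable_bounded)
  ultimately show ?thesis
    unfolding F_def D1_def D2_def by simp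
qed

text \<open>For \<open>U = c * (L - r)\<close> the profile rises linearly from \<open>0\<close> at height \<open>r\<close> to \<open>U\<close> at the upper wall.\<close>

definition shear_profile :: "real \<Rightarrow> real \<Rightarrow> real^3 \<Rightarrow> real^3" where
  "shear_profile c r x = axis 1 (c * ramp r (x $ 3))"

definition shear_profile_grad :: "real \<Rightarrow> real \<Rightarrow> real^3 \<Rightarrow> real^3^3" where
  "shear_profile_grad c r x = (\<chi> i k. if i = 1 \<and> k = 3 \<and> r < x $ 3 then c else 0)"

lemma shear_profile_measurable [measurable]:
  "shear_profile c r \<in> borel_measurable borel" "shear_profile_grad c r \<in> borel_measurable borel"
proof -
  have "shear_profile c r = (\<lambda>x. (c * ramp r (x $ 3)) *\<^sub>R axis 1 1)"
    by (auto simp: shear_profile_def axis_def vec_eq_iff)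
  then show "shear_profile c r \<in> borel_measurable borel"
    by (auto intro!: borel_measurable_continuous_onI continuous_intros)
  have [measurable]: "(\<lambda>x::real^3. x $ 3) \<in> borel_measurable borel"
    by (intro borel_measurable_continuous_onI continuous_intros)
  have "shear_profile_grad c r = (\<lambda>x. if r < x $ 3 then \<chi> i k. if i = 1 \<and> k = 3 then c else 0 else 0)"
    by (auto simp: shear_profile_grad_def vec_eq_iff fun_eq_iff)
  then show "shear_profile_grad c r \<in> borel_measurable borel"
    by simp
qed

lemma norm_axis_eq: "norm (axis k a) = norm (a :: 'a::real_inner)"
  by (simp add: norm_eq_sqrt_inner inner_axis_axis)

lemma norm_shear_profile_grad:
  "norm (shear_profile_grad c r x) = (if r < x $ 3 then \<bar>c\<bar> else 0)"
proof -
  have "shear_profile_grad c r x = axis 1 (axis 3 (if r < x $ 3 then c else 0))"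
    by (auto simp: shear_profile_grad_def axis_def vec_eq_iff)
  then show ?thesis
    by (simp add: norm_axis_eq)
qed

lemma L2_on_bounded:
  fixes f :: "real^3 \<Rightarrow> 'b::euclidean_space"
  assumes f: "f \<in> borel_measurable borel" and M: "\<And>x. x \<in> Omega L \<Longrightarrow> norm (f x) \<le> M"
  shows "L2_on (Omega L) f"
  unfolding L2_on_def
proof
  show "set_integrable lebesgue (Omega L) (\<lambda>x. (norm (f x))\<^sup>2)"
    using f emeasure_Omega_finite M
    by (intro set_integrable_lborel_imp_lebesgue set_integrable_bounded[where M = "M\<^sup>2"])
       (auto intro: power_mono)
qed (use f in \<open>rule borel_imp_lebesgue_on\<close>)

text \<open>Admissibility of the background flow in the energy inequality. The divergence vanishes
  because the only nonzero gradient entry is off the diagonal.\<close>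

lemma H1_shear_profile:
  assumes L: "L > 0" and r: "0 \<le> r" "r < L" and U: "U = c * (L - r)"
  shows "H1_shear L U (shear_profile c r) (shear_profile_grad c r)"
    and "divergence_free L (shear_profile_grad c r)"
proof -
  let ?\<phi> = "shear_profile c r" and ?G = "shear_profile_grad c r"
  have contc: "continuous_on UNIV (\<lambda>x. ?\<phi> x $ i)" for i
    unfolding shear_profile_def axis_def by (cases "i = 1") (auto intro!: continuous_intros)
  have "continuous_on UNIV (\<lambda>x. \<chi> i. ?\<phi> x $ i)"
    by (intro continuous_on_vec_lambda contc)
  then have cont: "continuous_on UNIV ?\<phi>"
    by simp
  have Green: "(LINT x:Omega L|lebesgue. ?\<phi> x $ i * D\<psi> x $ k) + (LINT x:Omega L|lebesgue. ?G x $ i $ k * \<psi> x)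
      = face_integral L k L (\<lambda>x. ?\<phi> x $ i * \<psi> x) - face_integral L k 0 (\<lambda>x. ?\<phi> x $ i * \<psi> x)"
    if "C1_with_gradient \<psi> D\<psi>" for \<psi> D\<psi> i k
  proof -
    define m where "m = (if i = 1 then c else 0)"
    have "?\<phi> x $ i = 0 + m * ramp r (x $ 3)" "?G x $ i $ k = (if k = 3 \<and> r < x $ 3 then m else 0)" for x
      by (auto simp: shear_profile_def shear_profile_grad_def axis_def m_def)
    then show ?thesis
      using Green_ramp[OF L that, of 0 m r k] by presburger
  qed
  \<comment> \<open>The profile is continuous on all of space, so it serves as its own boundary
    trace.\<close>
  have "boundary_trace L ?\<phi> ?G ?\<phi>"
    unfolding boundary_trace_def
  proof (intro conjI allI impI ballI)
    fix k :: 3 and d :: real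
    have "continuous_on UNIV (\<lambda>x. ?\<phi> (on_face k d x))"
      by (intro continuous_on_compose2[OF cont] continuous_on_on_face) auto
    then have *: "(\<lambda>x. ?\<phi> (on_face k d x)) \<in> borel_measurable borel"
      by (rule borel_measurable_continuous_onI)
    have "continuous_on UNIV (\<lambda>x. norm (?\<phi> (on_face k d x)))"
      by (intro continuous_intros) fact
    from continuous_set_integrable_Omega[OF this]
    have "set_integrable lebesgue (Omega L) (\<lambda>x. norm (?\<phi> (on_face k d x)))"
      by (rule set_integrable_lborel_imp_lebesgue)
    then have "integrable (lebesgue_on (Omega L)) (\<lambda>x. norm (?\<phi> (on_face k d x)))"
      by (simp add: set_integrable_eq)
    then show "set_integrable lebesgue (Omega L) (\<lambda>x. ?\<phi> (on_face k d x))"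
      using borel_imp_lebesgue_on[OF *] by (simp add: set_integrable_eq integrable_norm_iff)
  qed (rule Green)
  moreover have "shear_boundary_values L U ?\<phi>"
    unfolding shear_boundary_values_def using r U
    by (auto simp: shear_profile_def ramp_def vec_eq_iff axis_def forall_3)
  moreover have "weak_gradient (Omega L) ?\<phi> ?G"
    unfolding weak_gradient_def
  proof (intro allI impI)
    fix \<psi> D\<psi> and i k :: 3
    assume \<psi>: "C1_with_gradient \<psi> D\<psi> \<and> compactly_supported_in (Omega L) \<psi>"
    \<comment> \<open>The faces do not meet the open box, so a test function supported inside it
      vanishes there and Green's formula reduces to the weak gradient identity.\<close>
    have "on_face k 0 x \<notin> Omega L" "on_face k L x \<notin> Omega L" for x
      by (auto simp: mem_Omega intro!: exI[of _ k])
    then have "\<psi> (on_face k 0 x) = 0" "\<psi> (on_face k L x) = 0" for x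
      using \<psi> unfolding compactly_supported_in_def by blast+
    then show "(LINT x:Omega L|lebesgue. ?\<phi> x $ i * D\<psi> x $ k) = - (LINT x:Omega L|lebesgue. ?G x $ i $ k * \<psi> x)"
      using Green[of \<psi> D\<psi> i k] \<psi> by (simp add: face_integral_def)
  qed
  moreover have "L2_on (Omega L) ?\<phi>"
  proof -
    have "continuous_on UNIV (\<lambda>x. norm (?\<phi> x))"
      by (intro continuous_intros cont)
    then obtain M where "\<And>x. x \<in> cbox 0 (vec L) \<Longrightarrow> \<bar>norm (?\<phi> x)\<bar> \<le> M"
      by (rule continuous_bounded_on_box) blast
    then show ?thesis
      using Omega_subset_cbox by (intro L2_on_bounded[where M = M]) auto
  qed
  moreover have "L2_on (Omega L) ?G"
    by (intro L2_on_bounded[where M = "\<bar>c\<bar>"]) (auto simp: norm_shear_profile_grad)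
  ultimately show "H1_shear L U ?\<phi> ?G"
    unfolding H1_shear_def by blast
  show "divergence_free L ?G"
    unfolding divergence_free_def trace_def shear_profile_grad_def by (simp add: sum_3)
qed

section \<open>Smooth approximations of steps and ramps\<close>

text \<open>The approximations of octant indicators and of their primitives in the third coordinate
  are products of this form.\<close>

lemma C1_with_gradient_product:
  assumes a: "\<And>t. (a has_real_derivative a' t) (at t)" "continuous_on UNIV a'"
    and b: "\<And>t. (b has_real_derivative b' t) (at t)" "continuous_on UNIV b'"
    and c: "\<And>t. (c has_real_derivative c' t) (at t)" "continuous_on UNIV c'"
  shows "C1_with_gradient (\<lambda>x. a (x $ 1) * b (x $ 2) * c (x $ 3))
    (\<lambda>x. vector [a' (x $ 1) * b (x $ 2) * c (x $ 3), a (x $ 1) * b' (x $ 2) * c (x $ 3),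
      a (x $ 1) * b (x $ 2) * c' (x $ 3)])"
  unfolding C1_with_gradient_def
proof (intro conjI allI)
  fix x :: "real^3"
  have *: "((\<lambda>x. f (x $ i)) has_derivative (\<lambda>h. f' (x $ i) * h $ i)) (at x)"
    if "\<And>t. (f has_real_derivative f' t) (at t)" for f f' i
    using has_derivative_compose[OF bounded_linear_imp_has_derivative[OF bounded_linear_vec_nth] 
        that[of "x $ i", unfolded has_field_derivative_def]] by simp
  show "GDERIV (\<lambda>x. a (x $ 1) * b (x $ 2) * c (x $ 3)) x :>
    vector [a' (x $ 1) * b (x $ 2) * c (x $ 3), a (x $ 1) * b' (x $ 2) * c (x $ 3),
      a (x $ 1) * b (x $ 2) * c' (x $ 3)]"
    unfolding gderiv_def
    by (rule has_derivative_eq_rhs, (rule has_derivative_mult *[OF a(1)] *[OF b(1)] *[OF c(1)])+)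
       (auto simp: fun_eq_iff inner_vec_def sum_3 algebra_simps)
next
  have "continuous_on UNIV a" "continuous_on UNIV b" "continuous_on UNIV c"
    using a(1) b(1) c(1) by (auto intro!: DERIV_continuous_on intro: DERIV_subset)
  note cont = continuous_on_compose2[OF this(1)] continuous_on_compose2[OF this(2)] continuous_on_compose2[OF this(3)]
    continuous_on_compose2[OF a(2)] continuous_on_compose2[OF b(2)] continuous_on_compose2[OF c(2)]
  have vec: "continuous_on UNIV (\<lambda>x. vector [f x, g x, h x] :: real^3)"
    if "continuous_on UNIV f" "continuous_on UNIV g" "continuous_on UNIV h" for f g h :: "real^3 \<Rightarrow> real"
  proof -
    have "continuous_on UNIV (\<lambda>x. \<chi> i. (vector [f x, g x, h x] :: real^3) $ i)"
    proof (rule continuous_on_vec_lambda)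
      fix i :: 3
      show "continuous_on UNIV (\<lambda>x. (vector [f x, g x, h x] :: real^3) $ i)"
        using exhaust_3[of i] that by auto
    qed
    then show ?thesis by simp
  qed
  show "continuous_on UNIV (\<lambda>x::real^3. vector [a' (x $ 1) * b (x $ 2) * c (x $ 3), a (x $ 1) * b' (x $ 2) * c (x $ 3),
      a (x $ 1) * b (x $ 2) * c' (x $ 3)] :: real^3)"
    by (intro vec continuous_intros cont subset_UNIV)
qed

text \<open>The shift by the square root makes the step functions tend to the indicator of \<open>t > 0\<close>
  also at \<open>t = 0\<close>.\<close>

definition smooth_step :: "nat \<Rightarrow> real \<Rightarrow> real" where
  "smooth_step n t = (let s = real (Suc n) * t - sqrt (real (Suc n)) in (1 + s / sqrt (1 + s\<^sup>2)) / 2)"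

text \<open>The primitive of \<open>smooth_step\<close>: up to rescaling, half of
  \<open>s + sqrt (1 + s\<^sup>2)\<close>, which mimics the positive part of
  \<open>s\<close>.\<close>

definition smooth_ramp :: "nat \<Rightarrow> real \<Rightarrow> real" where
  "smooth_ramp n t = (let s = real (Suc n) * t - sqrt (real (Suc n)) in (s + sqrt (1 + s\<^sup>2)) / 2 / real (Suc n))"

text \<open>The derivative of \<open>smooth_step\<close>, left in the form produced by the quotient
  rule; it equals \<open>real (Suc n) / 2\<close> times the power -3/2 of
  \<open>1 + s\<^sup>2\<close>.\<close>

definition smooth_bump :: "nat \<Rightarrow> real \<Rightarrow> real" where
  "smooth_bump n t = (let s = real (Suc n) * t - sqrt (real (Suc n)) in
     (sqrt (1 + s\<^sup>2) - s * (s / sqrt (1 + s\<^sup>2))) / (1 + s\<^sup>2) / 2 * real (Suc n))"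

lemma smooth_step_bounds: "0 \<le> smooth_step n t" "smooth_step n t \<le> 1"
proof -
  have "\<bar>s / sqrt (1 + s\<^sup>2)\<bar> \<le> 1" for s :: real
  proof -
    have "\<bar>s\<bar> \<le> sqrt (1 + s\<^sup>2)"
      by (rule real_le_rsqrt) simp
    then show ?thesis
      by (simp add: add_pos_nonneg)
  qed
  moreover have "0 \<le> (1 + y) / 2 \<and> (1 + y) / 2 \<le> 1" if "\<bar>y\<bar> \<le> 1" for y :: real
    using that by (simp add: abs_le_iff)
  ultimately have "0 \<le> smooth_step n t \<and> smooth_step n t \<le> 1"
    unfolding smooth_step_def Let_def by blast
  then show "0 \<le> smooth_step n t" "smooth_step n t \<le> 1"
    by auto
qed

lemma one_plus_square_pos: "0 < 1 + (s::real)\<^sup>2"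
  by (simp add: add_pos_nonneg)

lemma sqrt_one_plus_square_has_derivative:
  "((\<lambda>s. sqrt (1 + s\<^sup>2)) has_real_derivative s / sqrt (1 + s\<^sup>2)) (at s)"
proof -
  have *: "((\<lambda>s. 1 + s\<^sup>2) has_real_derivative 2 * s) (at s)"
    by (auto intro!: derivative_eq_intros)
  have "inverse (sqrt (1 + s\<^sup>2)) / 2 * (2 * s) = s / sqrt (1 + s\<^sup>2)"
    by (simp only: divide_inverse) simp
  with DERIV_chain2[where f = sqrt and g = "\<lambda>s. 1 + s\<^sup>2", OF DERIV_real_sqrt[OF one_plus_square_pos] *]
  show ?thesis
    by (simp only:)
qed

lemma shift_has_derivative:
  "((\<lambda>t. real (Suc n) * t - sqrt (real (Suc n))) has_real_derivative real (Suc n)) (at t)"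
  by (auto intro!: derivative_eq_intros)

lemma smooth_ramp_has_derivative: "(smooth_ramp n has_real_derivative smooth_step n t) (at t)"
proof -
  have *: "((\<lambda>s. (s + sqrt (1 + s\<^sup>2)) / 2 / real (Suc n)) has_real_derivative (1 + s / sqrt (1 + s\<^sup>2)) / 2 / real (Suc n)) (at s)" for s
    by (intro DERIV_cdivide DERIV_add DERIV_ident sqrt_one_plus_square_has_derivative)
  show ?thesis
    unfolding smooth_ramp_def[abs_def] smooth_step_def Let_def
    by (rule DERIV_cong[OF DERIV_chain2[OF * shift_has_derivative]]) (simp del: of_nat_Suc)
qed

lemma smooth_step_has_derivative: "(smooth_step n has_real_derivative smooth_bump n t) (at t)"
proof -
  have nz: "sqrt (1 + s\<^sup>2) \<noteq> 0" for s
    using one_plus_square_pos[of s] by simp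
  have "((\<lambda>s. s / sqrt (1 + s\<^sup>2)) has_real_derivative
      (1 * sqrt (1 + s\<^sup>2) - s * (s / sqrt (1 + s\<^sup>2))) / (sqrt (1 + s\<^sup>2) * sqrt (1 + s\<^sup>2))) (at s)" for s
    by (rule DERIV_divide[OF DERIV_ident sqrt_one_plus_square_has_derivative nz])
  moreover have "sqrt (1 + s\<^sup>2) * sqrt (1 + s\<^sup>2) = 1 + s\<^sup>2" for s
    using one_plus_square_pos[of s] by simp
  ultimately have "((\<lambda>s. (1 + s / sqrt (1 + s\<^sup>2)) / 2) has_real_derivative
      (0 + (sqrt (1 + s\<^sup>2) - s * (s / sqrt (1 + s\<^sup>2))) / (1 + s\<^sup>2)) / 2) (at s)" for s
    by (intro DERIV_cdivide DERIV_add DERIV_const) (simp only: mult_1)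
  from DERIV_chain2[OF this shift_has_derivative] show ?thesis
    unfolding smooth_step_def[abs_def] smooth_bump_def Let_def by simp
qed

lemma continuous_smooth_bump: "continuous_on UNIV (smooth_bump n)"
proof -
  have nz: "1 + s\<^sup>2 \<noteq> 0" for s :: real
    using one_plus_square_pos[of s] by simp
  show ?thesis
    unfolding smooth_bump_def[abs_def] Let_def
    by (intro continuous_intros ballI) (simp_all only: nz real_sqrt_eq_zero_cancel_iff not_False_eq_True)
qed

lemma continuous_smooth_step: "continuous_on UNIV (smooth_step n)"
  by (meson DERIV_continuous_on DERIV_subset smooth_step_has_derivative subset_UNIV)

lemma smooth_step_tendsto: "(\<lambda>n. smooth_step n t) \<longlonglongrightarrow> (if t > 0 then 1 else 0)"
proof -
  consider (pos) "t > 0" | (zero) "t = 0" | (neg) "t < 0" by linarith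
  then show ?thesis
  proof cases
    case pos
    then have "(\<lambda>n. smooth_step n t) \<longlonglongrightarrow> 1"
      unfolding smooth_step_def Let_def by real_asymp
    with pos show ?thesis by simp
  next
    case zero
    have "(\<lambda>n. smooth_step n 0) \<longlonglongrightarrow> 0"
      unfolding smooth_step_def Let_def by real_asymp
    with zero show ?thesis by simp
  next
    case neg
    then have "(\<lambda>n. smooth_step n t) \<longlonglongrightarrow> 0"
      unfolding smooth_step_def Let_def by real_asymp
    with neg show ?thesis by simp
  qed
qed

lemma smooth_ramp_tendsto: "(\<lambda>n. smooth_ramp n t) \<longlonglongrightarrow> max 0 t"
proof -
  consider (pos) "t > 0" | (zero) "t = 0" | (neg) "t < 0" by linarith
  then show ?thesis
  proof cases
    case pos
    then have "(\<lambda>n. smooth_ramp n t) \<longlonglongrightarrow> t"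
      unfolding smooth_ramp_def Let_def by real_asymp
    with pos show ?thesis by simp
  next
    case zero
    have "(\<lambda>n. smooth_ramp n 0) \<longlonglongrightarrow> 0"
      unfolding smooth_ramp_def Let_def by real_asymp
    with zero show ?thesis by simp
  next
    case neg
    then have "(\<lambda>n. smooth_ramp n t) \<longlonglongrightarrow> 0"
      unfolding smooth_ramp_def Let_def by real_asymp
    with neg show ?thesis by simp
  qed
qed

text \<open>The slope \<open>smooth_step\<close> lies between 0 and 1. This gives the bound uniform
  in \<open>n\<close> that dominated convergence requires.\<close>

lemma smooth_ramp_diff:
  assumes "a \<le> b"
  shows "\<bar>smooth_ramp n b - smooth_ramp n a\<bar> \<le> b - a"
proof (cases "a = b")
  case False
  then have "a < b"
    using assms by simp
  from MVT2[OF this smooth_ramp_has_derivative]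
  obtain z where "smooth_ramp n b - smooth_ramp n a = (b - a) * smooth_step n z"
    by blast
  then show ?thesis
    using smooth_step_bounds[of n z] \<open>a < b\<close> by (simp add: abs_mult mult_left_le)
qed simp

section \<open>Consequences of the trace condition\<close>

lemma Omega_ex_borel_representative:
  assumes "f \<in> borel_measurable (lebesgue_on (Omega L))"
  obtains g :: "real^3 \<Rightarrow> real" where "g \<in> borel_measurable borel"
    "AE x in lebesgue. x \<in> Omega L \<longrightarrow> f x = g x"
proof -
  have "(\<lambda>x. indicator (Omega L) x *\<^sub>R f x) \<in> borel_measurable lebesgue"
    using assms by (subst (asm) borel_measurable_restrict_space_iff) auto
  then obtain g where "g \<in> borel_measurable borel" and g: "AE x in lebesgue. indicator (Omega L) x *\<^sub>R f x = g x"
    using lebesgue_ex_borel_representative by blast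
  moreover have "AE x in lebesgue. x \<in> Omega L \<longrightarrow> f x = g x"
    using g by eventually_elim (auto simp: indicator_def)
  ultimately show thesis
    using that by blast
qed

text \<open>Green's formula for the constant wall velocity is subtracted from the one for
  \<open>v\<close>. At the upper wall the boundary terms agree, at the lower wall they vanish with
  \<open>\<psi>\<close>, so integration by parts in the third coordinate leaves no boundary
  term.\<close>

lemma shear_trace_test:
  assumes L: "L > 0" and v: "H1_shear L U v G" and \<psi>: "C1_with_gradient \<psi> D\<psi>"
    and \<psi>0: "\<And>x. x $ 3 = 0 \<Longrightarrow> \<psi> x = 0"
  shows "(LINT x:Omega L|lebesgue. (v x $ i - vector [U, 0, 0] $ i) * D\<psi> x $ 3)
    = - (LINT x:Omega L|lebesgue. G x $ i $ 3 * \<psi> x)"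
proof -
  define c where "c = (vector [U, 0, 0] :: real^3) $ i"
  obtain b where b: "boundary_trace L v G b" "shear_boundary_values L U b"
    using v by (auto simp: H1_shear_def)
  have bL: "b (on_face 3 L x) $ i = c" if "x \<in> Omega L" for x
    using b(2) that subsetD[OF Omega_subset_cbox that] unfolding shear_boundary_values_def c_def by simp
  have "(LINT x:Omega L|lebesgue. b (on_face 3 L x) $ i * \<psi> (on_face 3 L x))
      = (LINT x:Omega L|lebesgue. c * \<psi> (on_face 3 L x))"
    using bL by (intro set_lebesgue_integral_cong) auto
  then have faces: "face_integral L 3 L (\<lambda>x. b x $ i * \<psi> x) = face_integral L 3 L (\<lambda>x. c * \<psi> x)"
    "face_integral L 3 0 (\<lambda>x. b x $ i * \<psi> x) = 0" "face_integral L 3 0 (\<lambda>x. c * \<psi> x) = 0"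
    unfolding face_integral_def using \<psi>0 by simp_all
  have "(LINT x:Omega L|lebesgue. v x $ i * D\<psi> x $ 3) + (LINT x:Omega L|lebesgue. G x $ i $ 3 * \<psi> x)
      = (LINT x:Omega L|lebesgue. c * D\<psi> x $ 3)"
    using b(1) \<psi> Green_ramp[OF L \<psi>, of c 0 0 3] faces
    unfolding boundary_trace_def by simp
  moreover have "set_integrable lebesgue (Omega L) (\<lambda>x. v x $ i * D\<psi> x $ 3)"
  proof -
    obtain M where M: "\<And>x. x \<in> cbox 0 (vec L) \<Longrightarrow> \<bar>D\<psi> x $ 3\<bar> \<le> M"
      using continuous_bounded_on_box[OF C1_with_gradient_continuous(2)[OF \<psi>]] by blast
    have "(\<lambda>x. D\<psi> x $ 3) \<in> borel_measurable (lebesgue_on (Omega L))"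
      using C1_with_gradient_continuous(2)[OF \<psi>] by (intro borel_imp_lebesgue_on borel_measurable_continuous_onI)
    moreover have "L2_on (Omega L) v"
      using v by (simp add: H1_shear_def)
    ultimately show ?thesis
      using M Omega_subset_cbox
      by (intro L2_times_bounded_integrable[of _ v _ _ M] borel_measurable_vec_nth[of v])
         (auto simp: L2_on_def component_le_norm_cart)
  qed
  moreover have "set_integrable lebesgue (Omega L) (\<lambda>x. c * D\<psi> x $ 3)"
    by (intro set_integrable_lborel_imp_lebesgue continuous_set_integrable_Omega continuous_intros
        C1_with_gradient_continuous(2)[OF \<psi>])
  ultimately show ?thesis
    unfolding c_def[symmetric] by (simp add: left_diff_distrib)
qed

text \<open>For such a \<open>\<psi>\<close> the boundary terms on the two opposite faces cancel by
  periodicity, and the term with the derivative of \<open>\<psi>\<close> is zero.\<close>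

lemma shear_trace_periodic:
  assumes v: "H1_shear L U v G" and \<psi>: "C1_with_gradient \<psi> D\<psi>"
    and D0: "\<And>x. D\<psi> x $ 1 = 0" and per: "\<And>x. \<psi> (on_face 1 L x) = \<psi> (on_face 1 0 x)"
  shows "(LINT x:Omega L|lebesgue. G x $ i $ 1 * \<psi> x) = 0"
proof -
  obtain b where b: "boundary_trace L v G b" "shear_boundary_values L U b"
    using v by (auto simp: H1_shear_def)
  have "face_integral L 1 L (\<lambda>x. b x $ i * \<psi> x) = face_integral L 1 0 (\<lambda>x. b x $ i * \<psi> x)"
    unfolding face_integral_def using b(2) per Omega_subset_cbox[of L]
    by (auto intro!: arg_cong[where f = "\<lambda>y. y / L"] set_lebesgue_integral_cong simp: shear_boundary_values_def)
  moreover have "(LINT x:Omega L|lebesgue. v x $ i * D\<psi> x $ 1) + (LINT x:Omega L|lebesgue. G x $ i $ 1 * \<psi> x)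
      = face_integral L 1 L (\<lambda>x. b x $ i * \<psi> x) - face_integral L 1 0 (\<lambda>x. b x $ i * \<psi> x)"
    using b(1) \<psi> unfolding boundary_trace_def by blast
  ultimately show ?thesis
    by (simp add: D0)
qed

lemma vec_nth_measurable [measurable]: "(\<lambda>x::real^3. x $ k) \<in> borel_measurable borel"
  by (intro borel_measurable_continuous_onI continuous_intros)

lemma ramp_measurable [measurable]: "ramp r \<in> borel_measurable borel"
  unfolding ramp_def[abs_def] by measurable

lemma smooth_measurable [measurable]:
  "smooth_step n \<in> borel_measurable borel" "smooth_ramp n \<in> borel_measurable borel"
  using continuous_smooth_step DERIV_continuous_on[OF DERIV_subset[OF smooth_ramp_has_derivative]]
  by (auto intro!: borel_measurable_continuous_onI)

lemma abs_gradient_entry_le: "\<bar>G $ i $ k\<bar> \<le> norm (G :: real^3^3)"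
  by (rule order_trans[OF component_le_norm_cart Finite_Cartesian_Product.norm_nth_le])

lemma H1_shear_components:
  assumes "H1_shear L U v G"
  shows "(\<lambda>x. v x $ i) \<in> borel_measurable (lebesgue_on (Omega L))"
    and "(\<lambda>x. G x $ i $ k) \<in> borel_measurable (lebesgue_on (Omega L))"
    and "set_integrable lebesgue (Omega L) (\<lambda>x. v x $ i)"
    and "set_integrable lebesgue (Omega L) (\<lambda>x. G x $ i $ k)"
proof -
  have v2: "L2_on (Omega L) v" and G2: "L2_on (Omega L) G"
    using assms by (auto simp: H1_shear_def)
  show vm: "(\<lambda>x. v x $ i) \<in> borel_measurable (lebesgue_on (Omega L))"
    and Gm: "(\<lambda>x. G x $ i $ k) \<in> borel_measurable (lebesgue_on (Omega L))"
    using v2 G2 by (auto simp: L2_on_def intro!: borel_measurable_vec_nth)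
  show "set_integrable lebesgue (Omega L) (\<lambda>x. v x $ i)"
    using L2_times_bounded_integrable[OF v2 vm, of "\<lambda>_. 1" 1] by (auto simp: component_le_norm_cart)
  show "set_integrable lebesgue (Omega L) (\<lambda>x. G x $ i $ k)"
    using L2_times_bounded_integrable[OF G2 Gm, of "\<lambda>_. 1" 1] by (auto simp: abs_gradient_entry_le)
qed

lemma Omega_dominated_convergence:
  fixes a g :: "real^3 \<Rightarrow> real"
  assumes ai: "set_integrable lebesgue (Omega L) a"
    and f: "\<And>n. f n \<in> borel_measurable borel" and g: "g \<in> borel_measurable borel"
    and lim: "\<And>x. x \<in> Omega L \<Longrightarrow> (\<lambda>n. f n x) \<longlonglongrightarrow> g x"
    and bound: "\<And>x n. x \<in> Omega L \<Longrightarrow> \<bar>f n x\<bar> \<le> M"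
  shows "(\<lambda>n. LINT x:Omega L|lebesgue. a x * f n x) \<longlonglongrightarrow> (LINT x:Omega L|lebesgue. a x * g x)"
  unfolding set_lebesgue_integral_def
proof (rule integral_dominated_convergence[where w = "\<lambda>x. M * norm (indicator (Omega L) x *\<^sub>R a x)"])
  have [measurable]: "(\<lambda>x. indicator (Omega L) x * a x) \<in> borel_measurable lebesgue"
    using ai by (auto simp: set_integrable_def dest: borel_measurable_integrable)
  have [measurable]: "f n \<in> borel_measurable lebesgue" "g \<in> borel_measurable lebesgue" for n
    using f g by (auto intro: measurable_completion)
  show "(\<lambda>x. indicat_real (Omega L) x *\<^sub>R (a x * g x)) \<in> borel_measurable lebesgue"
    "(\<lambda>x. indicat_real (Omega L) x *\<^sub>R (a x * f n x)) \<in> borel_measurable lebesgue" for n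
    by (simp_all flip: mult.assoc)
  show "integrable lebesgue (\<lambda>x. M * norm (indicator (Omega L) x *\<^sub>R a x))"
    using ai by (intro integrable_mult_right integrable_norm) (simp add: set_integrable_def)
  show "AE x in lebesgue. (\<lambda>n. indicator (Omega L) x *\<^sub>R (a x * f n x)) \<longlonglongrightarrow> indicator (Omega L) x *\<^sub>R (a x * g x)"
    using lim by (auto simp: indicator_def intro!: AE_I2 tendsto_intros)
  show "AE x in lebesgue. norm (indicator (Omega L) x *\<^sub>R (a x * f n x)) \<le> M * norm (indicator (Omega L) x *\<^sub>R a x)" for n
    by (auto simp: indicator_def abs_mult mult.commute[of M] intro!: AE_I2 mult_left_mono bound)
qed

lemma has_real_derivative_shift:
  fixes f f' :: "real \<Rightarrow> real"
  assumes "\<And>t. (f has_real_derivative f' t) (at t)"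
  shows "((\<lambda>t. f (t - s)) has_real_derivative f' (t - s)) (at t)"
  using DERIV_shift[of f "f' (t - s)" t "- s"] assms[of "t - s"] by simp

text \<open>Formally this is integration by parts in the third coordinate, with the indicator of an
  octant on the left and its primitive on the right. It is the limit of the identities for smooth
  test functions.\<close>

lemma shear_octant_identity:
  assumes L: "L > 0" and v: "H1_shear L U v G" and r: "0 \<le> r"
  shows "(LINT x:Omega L|lebesgue. (v x $ i - vector [U, 0, 0] $ i) * (if p < x $ 1 \<and> q < x $ 2 \<and> r < x $ 3 then 1 else 0))
    = - (LINT x:Omega L|lebesgue. G x $ i $ 3 * (if p < x $ 1 \<and> q < x $ 2 then ramp r (x $ 3) else 0))"
proof -
  let ?w = "\<lambda>x. v x $ i - (vector [U, 0, 0] :: real^3) $ i"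
  define \<sigma> where "\<sigma> n x = smooth_step n (x $ 1 - p) * smooth_step n (x $ 2 - q) * smooth_step n (x $ 3 - r)"
    for n and x :: "real^3"
  \<comment> \<open>Subtracting the constant \<open>smooth_ramp n (- r)\<close> makes
    \<open>\<psi> n\<close> vanish exactly at the lower wall. The constant tends to 0 because
    \<open>r\<close> is nonnegative.\<close>
  define \<psi> where "\<psi> n x = smooth_step n (x $ 1 - p) * smooth_step n (x $ 2 - q)
      * (smooth_ramp n (x $ 3 - r) - smooth_ramp n (- r))" for n and x :: "real^3"
  have ramp': "((\<lambda>t. smooth_ramp n (t - r) - smooth_ramp n (- r)) has_real_derivative smooth_step n (t - r)) (at t)" for n t
    using DERIV_diff[OF has_real_derivative_shift[OF smooth_ramp_has_derivative] DERIV_const] by simp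
  note step' = has_real_derivative_shift[OF smooth_step_has_derivative]
  have c_bump: "continuous_on UNIV (\<lambda>t. smooth_bump n (t - s))"
    and c_step: "continuous_on UNIV (\<lambda>t. smooth_step n (t - s))" for n s
    by (auto intro!: continuous_on_compose2[OF continuous_smooth_bump] continuous_on_compose2[OF continuous_smooth_step] continuous_intros)
  have test: "(LINT x:Omega L|lebesgue. ?w x * \<sigma> n x) = - (LINT x:Omega L|lebesgue. G x $ i $ 3 * \<psi> n x)" for n
  proof -
    from C1_with_gradient_product[OF step'[where s = p] c_bump step'[where s = q] c_bump ramp' c_step]
    have "C1_with_gradient (\<psi> n) (\<lambda>x. vector [smooth_bump n (x $ 1 - p) * smooth_step n (x $ 2 - q)
        * (smooth_ramp n (x $ 3 - r) - smooth_ramp n (- r)),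
        smooth_step n (x $ 1 - p) * smooth_bump n (x $ 2 - q) * (smooth_ramp n (x $ 3 - r) - smooth_ramp n (- r)),
        \<sigma> n x])"
      unfolding \<psi>_def \<sigma>_def .
    from shear_trace_test[OF L v this, of i] show ?thesis
      by (simp add: \<psi>_def)
  qed
  have wi: "set_integrable lebesgue (Omega L) ?w"
    by (intro set_integral_diff set_integrable_Omega_const H1_shear_components[OF v])
  note Gi = H1_shear_components(4)[OF v, of i 3]
  note DCT = Omega_dominated_convergence
  have s01: "\<bar>smooth_step n t\<bar> \<le> 1" for n t
    using smooth_step_bounds[of n t] by simp
  have lim_w: "(\<lambda>n. LINT x:Omega L|lebesgue. ?w x * \<sigma> n x) \<longlonglongrightarrow>
      (LINT x:Omega L|lebesgue. ?w x * (if p < x $ 1 \<and> q < x $ 2 \<and> r < x $ 3 then 1 else 0))"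
  proof (rule DCT[OF wi, where M = 1])
    show "(\<lambda>n. \<sigma> n x) \<longlonglongrightarrow> (if p < x $ 1 \<and> q < x $ 2 \<and> r < x $ 3 then 1 else 0)" for x
      unfolding \<sigma>_def
      using tendsto_mult[OF tendsto_mult[OF smooth_step_tendsto[of "x $ 1 - p"] smooth_step_tendsto[of "x $ 2 - q"]] smooth_step_tendsto[of "x $ 3 - r"]]
      by (auto split: if_splits)
    show "\<bar>\<sigma> n x\<bar> \<le> 1" for n x
      unfolding \<sigma>_def abs_mult by (intro mult_le_one s01) auto
  qed (unfold \<sigma>_def, measurable)
  have "(\<lambda>n. LINT x:Omega L|lebesgue. G x $ i $ 3 * \<psi> n x) \<longlonglongrightarrow>
      (LINT x:Omega L|lebesgue. G x $ i $ 3 * (if p < x $ 1 \<and> q < x $ 2 then ramp r (x $ 3) else 0))"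
  proof (rule DCT[OF Gi, where M = L])
    fix x :: "real^3" assume x: "x \<in> Omega L"
    have "(\<lambda>n. smooth_ramp n (x $ 3 - r) - smooth_ramp n (- r)) \<longlonglongrightarrow> ramp r (x $ 3)"
      using tendsto_diff[OF smooth_ramp_tendsto[of "x $ 3 - r"] smooth_ramp_tendsto[of "- r"]] r by (simp add: ramp_def)
    from tendsto_mult[OF tendsto_mult[OF smooth_step_tendsto[of "x $ 1 - p"] smooth_step_tendsto[of "x $ 2 - q"]] this]
    show "(\<lambda>n. \<psi> n x) \<longlonglongrightarrow> (if p < x $ 1 \<and> q < x $ 2 then ramp r (x $ 3) else 0)"
      unfolding \<psi>_def by (auto split: if_splits)
    show "\<bar>\<psi> n x\<bar> \<le> L" for n
    proof -
      have "\<bar>smooth_ramp n (x $ 3 - r) - smooth_ramp n (- r)\<bar> \<le> L"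
        using smooth_ramp_diff[of "- r" "x $ 3 - r" n] x by (auto simp: mem_Omega less_imp_le intro: order_trans)
      moreover have "\<bar>smooth_step n (x $ 1 - p) * smooth_step n (x $ 2 - q)\<bar> \<le> 1"
        unfolding abs_mult by (intro mult_le_one s01) auto
      ultimately have "\<bar>smooth_step n (x $ 1 - p) * smooth_step n (x $ 2 - q)\<bar>
          * \<bar>smooth_ramp n (x $ 3 - r) - smooth_ramp n (- r)\<bar> \<le> 1 * L"
        using L by (intro mult_mono) auto
      then show ?thesis
        by (simp add: \<psi>_def abs_mult)
    qed
  qed (unfold \<psi>_def, measurable)
  from LIMSEQ_unique[OF lim_w[unfolded test] tendsto_minus[OF this]] show ?thesis .
qed

text \<open>The test functions depend on the third coordinate only, so they meet both requirements
  of \<open>shear_trace_periodic\<close>. The result removes the constant part of the velocity from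
  the convective term.\<close>

lemma shear_periodic_ramp:
  assumes L: "L > 0" and v: "H1_shear L U v G" and r: "0 \<le> r"
  shows "(LINT x:Omega L|lebesgue. G x $ i $ 1 * ramp r (x $ 3)) = 0"
proof -
  define \<psi> where "\<psi> n x = smooth_ramp n (x $ 3 - r) - smooth_ramp n (- r)" for n and x :: "real^3"
  have "(LINT x:Omega L|lebesgue. G x $ i $ 1 * \<psi> n x) = 0" for n
  proof -
    have 1: "((\<lambda>t. 1) has_real_derivative (\<lambda>t. 0) t) (at t)" "continuous_on UNIV (\<lambda>t::real. 0::real)" for t :: real
      by auto
    have 2: "((\<lambda>t. smooth_ramp n (t - r) - smooth_ramp n (- r)) has_real_derivative smooth_step n (t - r)) (at t)" for t
      using DERIV_diff[OF has_real_derivative_shift[OF smooth_ramp_has_derivative] DERIV_const] by simp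
    have 3: "continuous_on UNIV (\<lambda>t. smooth_step n (t - r))"
      by (auto intro!: continuous_on_compose2[OF continuous_smooth_step] continuous_intros)
    from C1_with_gradient_product[OF 1 1 2 3]
    have "C1_with_gradient (\<psi> n) (\<lambda>x. vector [0, 0, smooth_step n (x $ 3 - r)])"
      unfolding \<psi>_def by simp
    from shear_trace_periodic[OF v this] show ?thesis
      by (simp add: \<psi>_def)
  qed
  moreover have "(\<lambda>n. LINT x:Omega L|lebesgue. G x $ i $ 1 * \<psi> n x)
      \<longlonglongrightarrow> (LINT x:Omega L|lebesgue. G x $ i $ 1 * ramp r (x $ 3))"
  proof (rule Omega_dominated_convergence[where M = L])
    fix x :: "real^3" assume x: "x \<in> Omega L"
    show "(\<lambda>n. \<psi> n x) \<longlonglongrightarrow> ramp r (x $ 3)"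
      using tendsto_diff[OF smooth_ramp_tendsto[of "x $ 3 - r"] smooth_ramp_tendsto[of "- r"]] r
      by (simp add: ramp_def \<psi>_def)
    show "\<bar>\<psi> n x\<bar> \<le> L" for n
      using smooth_ramp_diff[of "- r" "x $ 3 - r" n] x
      by (auto simp: \<psi>_def mem_Omega less_imp_le intro: order_trans)
  qed (auto simp: \<psi>_def intro: H1_shear_components[OF v])
  ultimately show ?thesis
    by (simp add: LIMSEQ_const_iff)
qed

section \<open>A Poincare inequality at the upper wall\<close>

lemma borel_eq_sigma_octants:
  "sets (borel :: (real^'n) measure) = sigma_sets UNIV (range (\<lambda>p. {x. \<forall>i. p $ i < x $ i}))"
proof -
  have "Collect (eucl_less a) = {x. \<forall>i. a $ i < x $ i}" for a :: "real^'n"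
    by (auto simp: eucl_less_def Basis_vec_def inner_axis)
  then show ?thesis
    by (subst borel_eq_greaterThan) simp
qed

text \<open>Dynkin's argument: octants generate the Borel sets and are stable under intersection, so
  the integral of \<open>h\<close> over every Borel set is zero, and a density is determined almost
  everywhere by its integrals.\<close>

lemma AE_zero_if_octant_integrals_zero:
  fixes h :: "real^'n \<Rightarrow> real"
  assumes h: "integrable lborel h" and zero: "\<And>p. (LINT x:{x. \<forall>i. p $ i < x $ i}|lborel. h x) = 0"
  shows "AE x in lborel. h x = 0"
proof -
  let ?oct = "\<lambda>p::real^'n. {x::real^'n. \<forall>i. p $ i < x $ i}"
  let ?E = "range ?oct"
  have borel_eq: "sets (borel :: (real^'n) measure) = sigma_sets UNIV ?E"
    by (rule borel_eq_sigma_octants)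
  have oct_borel: "?oct p \<in> sets borel" for p
    unfolding borel_eq by blast
  have hA: "set_integrable lborel A h" if "A \<in> sets borel" for A
    using h that unfolding set_integrable_def by (intro integrable_mult_indicator) auto
  \<comment> \<open>Passing to complements requires the integral over the whole space, obtained by
    exhausting it with growing octants.\<close>
  have UNIV: "(LINT x:UNIV|lborel. h x) = 0"
  proof -
    let ?A = "\<lambda>n::nat. ?oct (\<chi> i. - real n)"
    have "(\<Union>n. ?A n) = UNIV"
    proof (intro equalityI subsetI UNIV_I)
      fix x :: "real^'n"
      obtain n where "norm x < real n"
        using reals_Archimedean2 by blast
      then have "- real n < x $ i" for i
        using component_le_norm_cart[of x i] by linarith
      then show "x \<in> (\<Union>n. ?A n)"
        by auto
    qed
    moreover have "(\<lambda>n. LINT x:?A n|lborel. h x) \<longlonglongrightarrow> (LINT x:(\<Union>n. ?A n)|lborel. h x)"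
    proof (rule set_integral_cont_up)
      show "incseq ?A"
        by (auto simp: incseq_def) (metis le_less_trans neg_le_iff_le of_nat_le_iff)
    qed (use oct_borel in \<open>auto intro: hA\<close>)
    ultimately show ?thesis
      by (simp only: zero LIMSEQ_const_iff)
  qed
  have all: "(LINT x:A|lborel. h x) = 0" if "A \<in> sets borel" for A
  proof -
    have "Int_stable ?E"
    proof (rule Int_stableI, elim rangeE)
      fix A B p q assume AB: "A = ?oct p" "B = ?oct q"
      have "?oct p \<inter> ?oct q = ?oct (\<chi> i. max (p $ i) (q $ i))"
        by auto
      then show "A \<inter> B \<in> ?E"
        unfolding AB by blast
    qed
    moreover have "?E \<subseteq> Pow UNIV"
      by simp
    ultimately show ?thesis
      using that[unfolded borel_eq]
    proof (induction rule: sigma_sets_induct_disjoint)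
      case (basic A)
      then show ?case using zero by auto
    next
      case empty
      then show ?case by (simp add: set_lebesgue_integral_def)
    next
      case (compl A)
      have A: "A \<in> sets borel"
        using compl by (simp add: borel_eq)
      have "(LINT x:(UNIV - A) \<union> A|lborel. h x) = (LINT x:UNIV - A|lborel. h x) + (LINT x:A|lborel. h x)"
        using A by (intro set_integral_Un hA) auto
      then show ?case
        using compl UNIV by simp
    next
      case (union A)
      have A: "A i \<in> sets borel" for i
        using union by (auto simp: borel_eq)
      have "(LINT x:(\<Union>i. A i)|lborel. h x) = (\<Sum>i. LINT x:A i|lborel. h x)"
        using A union(1) by (intro lebesgue_integral_countable_add hA) (auto simp: disjoint_family_on_def)
      then show ?case
        using union by simp
    qed
  qed
  show ?thesis
    using density_unique_real[OF h, of "\<lambda>_. 0"] all by simp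
qed

text \<open>The last hypothesis says that \<open>w\<close> has third partial derivative \<open>g\<close> and vanishes at \<open>x $ 3 = L\<close>,
  tested against octants, which generate the Borel sets.\<close>

lemma wall_representation:
  fixes w g :: "real^3 \<Rightarrow> real"
  assumes L: "L > 0" and [measurable]: "w \<in> borel_measurable borel" "g \<in> borel_measurable borel"
    and w: "set_integrable lborel (Omega L) w" and g: "set_integrable lborel (Omega L) g"
    and id: "\<And>p q r. 0 \<le> r \<Longrightarrow>
      (LINT x:Omega L|lborel. w x * (if p < x $ 1 \<and> q < x $ 2 \<and> r < x $ 3 then 1 else 0))
      = - (LINT x:Omega L|lborel. g x * (if p < x $ 1 \<and> q < x $ 2 then ramp r (x $ 3) else 0))"
  shows "AE x in lborel. x \<in> Omega L \<longrightarrow>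
    w x = - (LINT s:{0<..<L}|lborel. (if x $ 3 < s then g (on_face 3 s x) else 0))"
proof -
  define f where "f s x = (if x $ 3 < s then g (on_face 3 s x) else 0)" for s and x :: "real^3"
  have [measurable]: "(\<lambda>p. g (snd p)) \<in> borel_measurable (borel :: (real \<times> (real^3)) measure)"
    "(\<lambda>p. snd p $ k) \<in> borel_measurable (borel :: (real \<times> (real^3)) measure)"
    "fst \<in> borel_measurable (borel :: (real \<times> (real^3)) measure)" for k
    unfolding borel_prod[symmetric] by measurable
  let ?Q = "{0<..<L} \<times> Omega L"
  have Q[measurable]: "?Q \<in> sets borel"
    by (intro borel_open open_Times) (auto simp: Omega_def)
  have restrict: "set_integrable lborel ?Q (\<lambda>p. if P p then g (snd p) else 0)"
    if [measurable]: "Measurable.pred borel P" for P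
    unfolding set_integrable_def
    by (rule Bochner_Integration.integrable_bound[OF set_integrable_slab_snd(1)[OF L g, unfolded set_integrable_def]])
       (auto simp: indicator_def)
  have f_eq: "f s x = (\<lambda>p. if fst p < snd p $ 3 then g (snd p) else 0) (swap_coord 3 (s, x))" for s x
    by (simp add: f_def swap_coord_def)
  have f_int: "set_integrable lborel ?Q (\<lambda>p. f (fst p) (snd p))"
    unfolding f_eq prod.collapse by (subst set_integrable_slab_swap) (auto intro: restrict)
  \<comment> \<open>The defect in the claimed representation; the goal is that it vanishes almost
    everywhere.\<close>
  define h where "h x = indicator (Omega L) x * (w x + (LINT s:{0<..<L}|lborel. f s x))" for x
  have If: "set_integrable lborel (Omega L) (\<lambda>x. LINT s:{0<..<L}|lborel. f s x)"
    using integral_over_slab(3)[OF f_int] by simp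
  have h: "integrable lborel h"
    using set_integral_add(1)[OF w If] by (simp add: h_def[abs_def] set_integrable_def)
  have "(LINT x:{x. \<forall>i. P $ i < x $ i}|lborel. h x) = 0" for P
  proof -
    let ?O = "{x::real^3. \<forall>i. P $ i < x $ i}"
    \<comment> \<open>Inside the box the third coordinate is positive, so a corner with negative
      third coordinate may be raised to 0. This meets the condition on \<open>r\<close> in the
      hypothesis \<open>id\<close>.\<close>
    define r where "r = max 0 (P $ 3)"
    have mem: "x \<in> ?O \<longleftrightarrow> P $ 1 < x $ 1 \<and> P $ 2 < x $ 2 \<and> r < x $ 3" if "x \<in> Omega L" for x
      using that by (auto simp: forall_3 r_def mem_Omega)
    have [measurable]: "?O \<in> sets borel"
      unfolding borel_eq_sigma_octants by blast
    let ?F = "\<lambda>p. if fst p < snd p $ 3 \<and> r < fst p \<and> P $ 1 < snd p $ 1 \<and> P $ 2 < snd p $ 2 then g (snd p) else 0"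
    have F: "set_integrable lborel ?Q ?F"
      by (rule restrict) measurable
    have Fm: "?F \<in> borel_measurable borel"
      by measurable
    \<comment> \<open>The ramp is written as the length of the set of \<open>s\<close> between
      \<open>r\<close> and \<open>x $ 3\<close>. Exchanging \<open>s\<close> and
      \<open>x $ 3\<close> then turns the weight on \<open>g\<close> into an integral of
      \<open>g\<close> from the current height up to the wall, restricted to the octant.\<close>
    have "(LINT x:Omega L|lborel. g x * (if P $ 1 < x $ 1 \<and> P $ 2 < x $ 2 then ramp r (x $ 3) else 0))
        = (LINT x:Omega L|lborel. LINT s:{0<..<L}|lborel. ?F (s, x))"
    proof (rule set_lebesgue_integral_cong)
      show "\<forall>x. x \<in> Omega L \<longrightarrow> g x * (if P $ 1 < x $ 1 \<and> P $ 2 < x $ 2 then ramp r (x $ 3) else 0)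
          = (LINT s:{0<..<L}|lborel. ?F (s, x))"
      proof (intro allI impI)
        fix x assume x: "x \<in> Omega L"
        have "(LINT s:{0<..<L}|lborel. ?F (s, x))
            = (LINT s|lborel. indicator {r<..<x $ 3} s * (if P $ 1 < x $ 1 \<and> P $ 2 < x $ 2 then g x else 0))"
          unfolding set_lebesgue_integral_def using x
          by (intro Bochner_Integration.integral_cong) (auto simp: indicator_def r_def mem_Omega intro: less_trans)
        also have "\<dots> = ramp r (x $ 3) * (if P $ 1 < x $ 1 \<and> P $ 2 < x $ 2 then g x else 0)"
          by (cases "r \<le> x $ 3") (simp_all add: ramp_def)
        finally show "g x * (if P $ 1 < x $ 1 \<and> P $ 2 < x $ 2 then ramp r (x $ 3) else 0)
          = (LINT s:{0<..<L}|lborel. ?F (s, x))"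
          by simp
      qed
    qed simp
    also have "\<dots> = (LINT p:?Q|lborel. ?F (swap_coord 3 p))"
      using integral_over_slab(1)[OF F] integral_slab_swap[OF Fm] by simp
    also have "\<dots> = (LINT x:Omega L|lborel. LINT s:{0<..<L}|lborel. ?F (swap_coord 3 (s, x)))"
      using integral_over_slab(1)[of L "\<lambda>p. ?F (swap_coord 3 p)"] set_integrable_slab_swap[OF Fm] F by simp
    also have "\<dots> = (LINT x:Omega L|lborel. indicator ?O x * (LINT s:{0<..<L}|lborel. f s x))"
    proof (rule set_lebesgue_integral_cong)
      have "?F (swap_coord 3 (s, x)) = indicator ?O x * f s x" if "x \<in> Omega L" for s x
        unfolding indicator_def mem[OF that] by (auto simp: swap_coord_def f_def)
      then show "\<forall>x. x \<in> Omega L \<longrightarrow> (LINT s:{0<..<L}|lborel. ?F (swap_coord 3 (s, x)))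
          = indicator ?O x * (LINT s:{0<..<L}|lborel. f s x)"
        by simp
    qed simp
    finally have 1: "(LINT x:Omega L|lborel. g x * (if P $ 1 < x $ 1 \<and> P $ 2 < x $ 2 then ramp r (x $ 3) else 0))
      = (LINT x:Omega L|lborel. indicator ?O x * (LINT s:{0<..<L}|lborel. f s x))" .
    have 2: "(LINT x:Omega L|lborel. w x * (if P $ 1 < x $ 1 \<and> P $ 2 < x $ 2 \<and> r < x $ 3 then 1 else 0))
        = (LINT x:Omega L|lborel. indicator ?O x * w x)"
    proof (rule set_lebesgue_integral_cong)
      have "w x * (if P $ 1 < x $ 1 \<and> P $ 2 < x $ 2 \<and> r < x $ 3 then 1 else 0) = indicator ?O x * w x"
        if "x \<in> Omega L" for x
        unfolding indicator_def mem[OF that] by simp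
      then show "\<forall>x. x \<in> Omega L \<longrightarrow> w x * (if P $ 1 < x $ 1 \<and> P $ 2 < x $ 2 \<and> r < x $ 3 then 1 else 0)
          = indicator ?O x * w x"
        by blast
    qed simp
    have oct_int: "set_integrable lborel (Omega L) (\<lambda>x. indicator ?O x * k x)"
      if "set_integrable lborel (Omega L) k" for k :: "real^3 \<Rightarrow> real"
    proof -
      have "integrable lborel (\<lambda>x. indicator ?O x *\<^sub>R (indicator (Omega L) x *\<^sub>R k x))"
        using that unfolding set_integrable_def by (rule integrable_mult_indicator[rotated]) measurable
      then show ?thesis
        by (simp add: set_integrable_def mult.left_commute)
    qed
    have "(LINT x:?O|lborel. h x)
        = (LINT x:Omega L|lborel. indicator ?O x * w x + indicator ?O x * (LINT s:{0<..<L}|lborel. f s x))"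
      unfolding set_lebesgue_integral_def h_def
      by (intro Bochner_Integration.integral_cong) (auto simp: indicator_def)
    also have "\<dots> = (LINT x:Omega L|lborel. indicator ?O x * w x)
        + (LINT x:Omega L|lborel. indicator ?O x * (LINT s:{0<..<L}|lborel. f s x))"
      by (intro set_integral_add oct_int w If)
    finally show ?thesis
      using id[of r "P $ 1" "P $ 2"] 1 2 by (simp add: r_def)
  qed
  from AE_zero_if_octant_integrals_zero[OF h this] show ?thesis
    by eventually_elim (auto simp: h_def f_def indicator_def)
qed

text \<open>The Cauchy-Schwarz inequality against a constant, from the nonnegativity of the
  variance: \<open>t\<close> is the mean of \<open>a\<close> over \<open>A\<close>.\<close>

lemma set_integral_square_le:
  fixes a :: "'a \<Rightarrow> real"
  assumes A: "A \<in> sets M" and d: "measure M A = d" "d > 0"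
    and a: "set_integrable M A a" and a2: "set_integrable M A (\<lambda>s. (a s)\<^sup>2)"
  shows "(LINT s:A|M. a s)\<^sup>2 \<le> d * (LINT s:A|M. (a s)\<^sup>2)"
proof -
  let ?I = "LINT s:A|M. a s" and ?S = "LINT s:A|M. (a s)\<^sup>2"
  define t where "t = ?I / d"
  have fin: "emeasure M A \<noteq> \<infinity>"
    using d by (auto simp: measure_def)
  have c: "set_integrable M A (\<lambda>s. t\<^sup>2)"
    using A fin unfolding set_integrable_def
    by (intro integrable_scaleR_left integrable_real_indicator) (auto simp: less_top)
  have "0 \<le> (LINT s:A|M. (a s - t)\<^sup>2)"
    unfolding set_lebesgue_integral_def by (intro integral_nonneg_AE) auto
  also have "(LINT s:A|M. (a s - t)\<^sup>2) = (LINT s:A|M. (a s)\<^sup>2 - 2 * t * a s + t\<^sup>2)"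
    by (simp add: power2_diff algebra_simps)
  also have "\<dots> = ?S - 2 * t * ?I + t\<^sup>2 * d"
    using a a2 c set_integral_const[OF A fin, of "t\<^sup>2"] d by (simp add: set_integral_add set_integral_diff)
  also have "\<dots> = ?S - ?I\<^sup>2 / d"
    using d by (simp add: t_def power2_eq_square field_simps)
  finally show ?thesis
    using d by (simp add: field_simps)
qed

text \<open>Cauchy-Schwarz on the segment from a point of the layer to the wall gives one factor
  \<open>d\<close>, and integration over the heights in the layer gives the other.\<close>

lemma wall_Poincare_borel:
  fixes w g :: "real^3 \<Rightarrow> real"
  assumes L: "L > 0" and d: "0 < d" "d \<le> L"
    and [measurable]: "w \<in> borel_measurable borel" "g \<in> borel_measurable borel"
    and w: "set_integrable lborel (Omega L) w" and g: "set_integrable lborel (Omega L) g"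
    and w2: "set_integrable lborel (Omega L) (\<lambda>x. (w x)\<^sup>2)" and g2: "set_integrable lborel (Omega L) (\<lambda>x. (g x)\<^sup>2)"
    and id: "\<And>p q r. 0 \<le> r \<Longrightarrow>
      (LINT x:Omega L|lborel. w x * (if p < x $ 1 \<and> q < x $ 2 \<and> r < x $ 3 then 1 else 0))
      = - (LINT x:Omega L|lborel. g x * (if p < x $ 1 \<and> q < x $ 2 then ramp r (x $ 3) else 0))"
  shows "(LINT x:Omega L|lborel. if L - d < x $ 3 then (w x)\<^sup>2 else 0) \<le> d\<^sup>2 * (LINT x:Omega L|lborel. (g x)\<^sup>2)"
proof -
  let ?Q = "{0<..<L} \<times> Omega L"
  have [measurable]: "(\<lambda>p. g (snd p)) \<in> borel_measurable (borel :: (real \<times> (real^3)) measure)"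
    "(\<lambda>p. snd p $ k) \<in> borel_measurable (borel :: (real \<times> (real^3)) measure)"
    "fst \<in> borel_measurable (borel :: (real \<times> (real^3)) measure)" for k
    unfolding borel_prod[symmetric] by measurable
  have Q[measurable]: "?Q \<in> sets borel"
    by (intro borel_open open_Times) (auto simp: Omega_def)
  have gm: "(\<lambda>p. g (snd p)) \<in> borel_measurable (borel :: (real \<times> (real^3)) measure)"
    by measurable
  have sec1: "AE x in lborel. x \<in> Omega L \<longrightarrow> set_integrable lborel {0<..<L} (\<lambda>s. g (on_face 3 s x))"
    using integral_over_slab(4)[OF set_integrable_slab_swap[OF gm, THEN iffD2, OF set_integrable_slab_snd(1)[OF L g]], of 3]
    by (simp add: swap_coord_def)
  \<comment> \<open>The cutoff acts on the extra scalar. After \<open>swap_coord 3\<close> it acts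
    on \<open>x $ 3\<close>, while \<open>g\<close> is evaluated at height \<open>s\<close>, which
    runs over the whole edge.\<close>
  let ?k = "\<lambda>p. if L - d < fst p then (g (snd p))\<^sup>2 else 0"
  have km: "?k \<in> borel_measurable borel" and g2m: "(\<lambda>p. (g (snd p))\<^sup>2) \<in> borel_measurable (borel :: (real \<times> (real^3)) measure)"
    by measurable
  have sec2: "AE x in lborel. x \<in> Omega L \<longrightarrow> set_integrable lborel {0<..<L} (\<lambda>s. (g (on_face 3 s x))\<^sup>2)"
    using integral_over_slab(4)[OF set_integrable_slab_swap[OF g2m, THEN iffD2, OF set_integrable_slab_snd(1)[OF L g2]], of 3]
    by (simp add: swap_coord_def)
  have k: "set_integrable lborel ?Q ?k"
    unfolding set_integrable_def
    by (rule Bochner_Integration.integrable_bound[OF set_integrable_slab_snd(1)[OF L g2, unfolded set_integrable_def]])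
       (auto simp: indicator_def)
  have k': "set_integrable lborel ?Q (\<lambda>p. ?k (swap_coord 3 p))"
    using k set_integrable_slab_swap[OF km] by blast
  have "(LINT x:Omega L|lborel. if L - d < x $ 3 then (w x)\<^sup>2 else 0)
      \<le> (LINT x:Omega L|lborel. d * (LINT s:{0<..<L}|lborel. ?k (swap_coord 3 (s, x))))"
  proof (rule set_integral_mono_AE)
    show "set_integrable lborel (Omega L) (\<lambda>x. if L - d < x $ 3 then (w x)\<^sup>2 else 0)"
      unfolding set_integrable_def
      by (rule Bochner_Integration.integrable_bound[OF w2[unfolded set_integrable_def]]) (auto simp: indicator_def)
    show "set_integrable lborel (Omega L) (\<lambda>x. d * (LINT s:{0<..<L}|lborel. ?k (swap_coord 3 (s, x))))"
      using integral_over_slab(3)[OF k'] by simp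
    show "AE x\<in>Omega L in lborel. (if L - d < x $ 3 then (w x)\<^sup>2 else 0)
        \<le> d * (LINT s:{0<..<L}|lborel. ?k (swap_coord 3 (s, x)))"
      using wall_representation[OF L _ _ w g id, simplified] sec1 sec2
    proof eventually_elim
      case (elim x)
      show ?case
      proof (intro impI)
        assume x: "x \<in> Omega L"
        let ?A = "{L - d<..<L}"
        show "(if L - d < x $ 3 then (w x)\<^sup>2 else 0) \<le> d * (LINT s:{0<..<L}|lborel. ?k (swap_coord 3 (s, x)))"
        proof (cases "L - d < x $ 3")
          case True
          let ?f = "\<lambda>s. if x $ 3 < s then g (on_face 3 s x) else 0"
          have int_g: "set_integrable lborel ?A (\<lambda>s. g (on_face 3 s x))"
            and int_g2: "set_integrable lborel ?A (\<lambda>s. (g (on_face 3 s x))\<^sup>2)"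
            using elim x d by (auto intro: set_integrable_subset[of lborel "{0<..<L}"])
          have int_f: "set_integrable lborel ?A ?f" and int_f2: "set_integrable lborel ?A (\<lambda>s. (?f s)\<^sup>2)"
            unfolding set_integrable_def
            by (rule Bochner_Integration.integrable_bound[OF int_g[unfolded set_integrable_def]]
                Bochner_Integration.integrable_bound[OF int_g2[unfolded set_integrable_def]]; auto simp: indicator_def)+
          \<comment> \<open>\<open>?f\<close> vanishes below \<open>x $ 3\<close>, which lies in the
            layer, so only an interval of length \<open>d\<close> counts.\<close>
          have "(LINT s:{0<..<L}|lborel. ?f s) = (LINT s:?A|lborel. ?f s)"
            unfolding set_lebesgue_integral_def using True d
            by (intro Bochner_Integration.integral_cong) (auto simp: indicator_def)
          then have "(w x)\<^sup>2 = (LINT s:?A|lborel. ?f s)\<^sup>2"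
            using elim x by simp
          also have "\<dots> \<le> d * (LINT s:?A|lborel. (?f s)\<^sup>2)"
            using d int_f int_f2 by (intro set_integral_square_le) auto
          also have "\<dots> \<le> d * (LINT s:{0<..<L}|lborel. (g (on_face 3 s x))\<^sup>2)"
          proof (rule mult_left_mono)
            show "(LINT s:?A|lborel. (?f s)\<^sup>2) \<le> (LINT s:{0<..<L}|lborel. (g (on_face 3 s x))\<^sup>2)"
              using int_f2 elim x d unfolding set_integrable_def set_lebesgue_integral_def
              by (intro integral_mono) (auto simp: indicator_def)
          qed (use d in simp)
          finally show ?thesis
            using True by (simp add: swap_coord_def)
        qed (use d in \<open>simp add: swap_coord_def\<close>)
      qed
    qed
  qed
  also have "\<dots> = d * (LINT p:?Q|lborel. ?k p)"
    using integral_over_slab(1)[OF k'] integral_slab_swap[OF km] by simp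
  \<comment> \<open>Undoing the exchange separates the cutoff from \<open>g\<close>, so its integral
    over \<open>s\<close> is the second factor \<open>d\<close>.\<close>
  also have "(LINT p:?Q|lborel. ?k p) = (LINT s:{0<..<L}|lborel. indicator {L - d<..<L} s * (LINT x:Omega L|lborel. (g x)\<^sup>2))"
    unfolding integral_over_slab(2)[OF k, symmetric]
    by (intro set_lebesgue_integral_cong) (auto simp: indicator_def)
  also have "\<dots> = (LINT s|lborel. indicator {L - d<..<L} s * (LINT x:Omega L|lborel. (g x)\<^sup>2))"
    unfolding set_lebesgue_integral_def[of lborel "{0<..<L}"] using d
    by (intro Bochner_Integration.integral_cong) (auto simp: indicator_def)
  also have "\<dots> = d * (LINT x:Omega L|lborel. (g x)\<^sup>2)"
    using d by simp
  finally show ?thesis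
    by (simp add: power2_eq_square mult.assoc)
qed

lemma Omega_representative:
  fixes f g :: "real^3 \<Rightarrow> real"
  assumes [measurable]: "g \<in> borel_measurable borel" and eq: "AE x in lebesgue. x \<in> Omega L \<longrightarrow> f x = g x"
  shows "set_integrable lebesgue (Omega L) f \<longleftrightarrow> set_integrable lborel (Omega L) g"
    and "(LINT x:Omega L|lebesgue. f x) = (LINT x:Omega L|lborel. g x)"
proof -
  have m: "(\<lambda>x. indicator (Omega L) x *\<^sub>R g x) \<in> borel_measurable borel"
    by measurable
  have "AE x in lebesgue. indicator (Omega L) x *\<^sub>R f x = indicator (Omega L) x *\<^sub>R g x"
    using eq by eventually_elim (auto simp: indicator_def)
  from integrable_lebesgue_iff_borel_representative[OF m this]
  show "set_integrable lebesgue (Omega L) f \<longleftrightarrow> set_integrable lborel (Omega L) g"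
    and "(LINT x:Omega L|lebesgue. f x) = (LINT x:Omega L|lborel. g x)"
    by (simp_all add: set_integrable_def set_lebesgue_integral_def)
qed

lemma H1_shear_squares:
  assumes v: "H1_shear L U v G"
  shows "set_integrable lebesgue (Omega L) (\<lambda>x. (v x $ i - c)\<^sup>2)"
    and "set_integrable lebesgue (Omega L) (\<lambda>x. (G x $ i $ k)\<^sup>2)"
    and "set_integrable lebesgue (Omega L) (\<lambda>x. (norm (G x))\<^sup>2)"
proof -
  have v2: "set_integrable lebesgue (Omega L) (\<lambda>x. (norm (v x))\<^sup>2)"
    and G2: "set_integrable lebesgue (Omega L) (\<lambda>x. (norm (G x))\<^sup>2)"
    using v by (auto simp: H1_shear_def L2_on_def)
  note [measurable] = H1_shear_components(1,2)[OF v]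
  have "(a - c)\<^sup>2 \<le> 2 * b\<^sup>2 + 2 * c\<^sup>2" if "\<bar>a\<bar> \<le> b" for a b :: real
  proof -
    have "a\<^sup>2 \<le> b\<^sup>2"
      using that power_mono[of "\<bar>a\<bar>" b 2] by simp
    moreover have "0 \<le> (a + c)\<^sup>2"
      by simp
    ultimately show ?thesis
      by (simp add: power2_sum power2_diff)
  qed
  from this[OF component_le_norm_cart]
  have bound: "(v x $ i - c)\<^sup>2 \<le> 2 * (norm (v x))\<^sup>2 + 2 * c\<^sup>2" for x .
  have "set_integrable lebesgue (Omega L) (\<lambda>x. 2 * (norm (v x))\<^sup>2 + 2 * c\<^sup>2)"
    by (intro set_integral_add set_integrable_Omega_const set_integrable_mult_right v2)
  then show "set_integrable lebesgue (Omega L) (\<lambda>x. (v x $ i - c)\<^sup>2)"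
    by (rule set_integrable_dominated[rotated 2]) (use bound in auto)
  have bound: "(G x $ i $ k)\<^sup>2 \<le> (norm (G x))\<^sup>2" for x
    using power_mono[OF abs_gradient_entry_le, of "G x" i k 2] by simp
  from G2 show "set_integrable lebesgue (Omega L) (\<lambda>x. (G x $ i $ k)\<^sup>2)"
    by (rule set_integrable_dominated[rotated 2]) (use bound in auto)
qed (use v in \<open>auto simp: H1_shear_def L2_on_def\<close>)

lemma wall_Poincare:
  assumes L: "L > 0" and d: "0 < d" "d \<le> L" and v: "H1_shear L U v G"
  shows "(LINT x:Omega L|lebesgue. if L - d < x $ 3 then (v x $ i - vector [U, 0, 0] $ i)\<^sup>2 else 0)
    \<le> d\<^sup>2 * (LINT x:Omega L|lebesgue. (G x $ i $ 3)\<^sup>2)"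
proof -
  let ?c = "(vector [U, 0, 0] :: real^3) $ i"
  have "(\<lambda>x. v x $ i - ?c) \<in> borel_measurable (lebesgue_on (Omega L))"
    using H1_shear_components(1)[OF v] by simp
  then obtain w where wm[measurable]: "w \<in> borel_measurable borel"
    and w: "AE x in lebesgue. x \<in> Omega L \<longrightarrow> v x $ i - ?c = w x"
    by (rule Omega_ex_borel_representative)
  obtain g where gm[measurable]: "g \<in> borel_measurable borel"
    and g: "AE x in lebesgue. x \<in> Omega L \<longrightarrow> G x $ i $ 3 = g x"
    using H1_shear_components(2)[OF v] by (rule Omega_ex_borel_representative)
  \<comment> \<open>The arbitrary \<open>F\<close> covers in one statement the squares, the cutoffs
    and the octant weights to which the representatives are applied.\<close>
  have w': "AE x in lebesgue. x \<in> Omega L \<longrightarrow> F (v x $ i - ?c) x = F (w x) x"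
    and g': "AE x in lebesgue. x \<in> Omega L \<longrightarrow> F (G x $ i $ 3) x = F (g x) x" for F :: "real \<Rightarrow> real^3 \<Rightarrow> real"
    by (rule eventually_mono[OF w], simp) (rule eventually_mono[OF g], simp)
  note rep = Omega_representative
  have "(LINT x:Omega L|lborel. if L - d < x $ 3 then (w x)\<^sup>2 else 0) \<le> d\<^sup>2 * (LINT x:Omega L|lborel. (g x)\<^sup>2)"
  proof (rule wall_Poincare_borel[OF L d])
    show "set_integrable lborel (Omega L) w"
      by (rule rep(1)[OF wm w, THEN iffD1], intro set_integral_diff H1_shear_components[OF v] set_integrable_Omega_const)
    show "set_integrable lborel (Omega L) g"
      by (rule rep(1)[OF gm g, THEN iffD1], rule H1_shear_components[OF v])
    have "(\<lambda>x. (w x)\<^sup>2) \<in> borel_measurable borel" "(\<lambda>x. (g x)\<^sup>2) \<in> borel_measurable borel"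
      by measurable
    then show "set_integrable lborel (Omega L) (\<lambda>x. (w x)\<^sup>2)" "set_integrable lborel (Omega L) (\<lambda>x. (g x)\<^sup>2)"
      using rep(1)[OF _ w'[of "\<lambda>y x. y\<^sup>2"]] rep(1)[OF _ g'[of "\<lambda>y x. y\<^sup>2"]] H1_shear_squares(1,2)[OF v] by blast+
    fix p q r :: real assume "0 \<le> r"
    let ?A = "\<lambda>x::real^3. if p < x $ 1 \<and> q < x $ 2 \<and> r < x $ 3 then 1 else 0 :: real"
    let ?B = "\<lambda>x::real^3. if p < x $ 1 \<and> q < x $ 2 then ramp r (x $ 3) else 0"
    have "(\<lambda>x. w x * ?A x) \<in> borel_measurable borel" "(\<lambda>x. g x * ?B x) \<in> borel_measurable borel"
      by measurable
    from rep(2)[OF this(1) w'[of "\<lambda>y x. y * ?A x"]] rep(2)[OF this(2) g'[of "\<lambda>y x. y * ?B x"]]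
      shear_octant_identity[OF L v \<open>0 \<le> r\<close>, of i p q]
    show "(LINT x:Omega L|lborel. w x * ?A x) = - (LINT x:Omega L|lborel. g x * ?B x)"
      by (simp only:)
  qed (use d in measurable)
  moreover have "(\<lambda>x. if L - d < x $ 3 then (w x)\<^sup>2 else 0) \<in> borel_measurable borel" "(\<lambda>x. (g x)\<^sup>2) \<in> borel_measurable borel"
    by measurable
  ultimately show ?thesis
    using rep(2)[OF _ w'[of "\<lambda>y x. if L - d < x $ 3 then y\<^sup>2 else 0"]] rep(2)[OF _ g'[of "\<lambda>y x. y\<^sup>2"]]
    by presburger
qed

section \<open>The convective term\<close>

lemma convective_shear_profile: "(G *v v) \<bullet> shear_profile c r x = c * ramp r (x $ 3) * (G $ 1 \<bullet> v)"
proof -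
  have "(G *v v) $ 1 = G $ 1 \<bullet> v"
    by (simp add: matrix_vector_mult_def inner_vec_def)
  then show ?thesis
    by (simp add: shear_profile_def inner_axis)
qed

lemma norm_matrix_square: "(norm (G :: real^3^3))\<^sup>2 = (\<Sum>i\<in>UNIV. \<Sum>k\<in>UNIV. (G $ i $ k)\<^sup>2)"
  unfolding power2_norm_eq_inner inner_vec_def by (simp add: power2_eq_square)

lemma row_square_le: "(\<Sum>k\<in>UNIV. (G $ i $ k)\<^sup>2) \<le> (norm (G :: real^3^3))\<^sup>2"
  unfolding norm_matrix_square by (rule member_le_sum) (auto intro: sum_nonneg)

lemma column_square_le: "(\<Sum>i\<in>UNIV. (G $ i $ k)\<^sup>2) \<le> (norm (G :: real^3^3))\<^sup>2"
  unfolding norm_matrix_square by (intro sum_mono member_le_sum) auto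

lemma set_integrable_sum_finite:
  fixes f :: "'i \<Rightarrow> 'a \<Rightarrow> real"
  assumes "\<And>i. i \<in> I \<Longrightarrow> set_integrable M A (f i)"
  shows "set_integrable M A (\<lambda>x. \<Sum>i\<in>I. f i x)"
    and "(LINT x:A|M. \<Sum>i\<in>I. f i x) = (\<Sum>i\<in>I. LINT x:A|M. f i x)"
  using assms by (simp_all add: set_integrable_def set_lebesgue_integral_def sum_distrib_left Bochner_Integration.integral_sum)

text \<open>Writing \<open>v = (U, 0, 0) + w\<close>, the constant part contributes nothing by periodicity, and \<open>w\<close>
  vanishes at the wall, so that the Poincare inequality applies to it.\<close>

lemma convective_bound:
  assumes L: "L > 0" and d: "0 < d" "d \<le> L" and c: "c > 0" "U = c * d" and v: "H1_shear L U v G"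
  shows "\<bar>LINT x:Omega L|lebesgue. (G x *v v x) \<bullet> shear_profile c (L - d) x\<bar>
    \<le> U * d * (LINT x:Omega L|lebesgue. (norm (G x))\<^sup>2)"
proof -
  let ?r = "L - d"
  define w where "w x k = v x $ k - (vector [U, 0, 0] :: real^3) $ k" for x k
  define a where "a x = c * ramp ?r (x $ 3) * (\<Sum>k\<in>UNIV. G x $ 1 $ k * w x k)" for x
  define b where "b x = U * c * (G x $ 1 $ 1 * ramp ?r (x $ 3))" for x
  \<comment> \<open>Young's inequality with weight \<open>d\<close>. The Poincare inequality turns
    the second part into \<open>d / 2\<close> times the gradient integral, so the two parts add up
    to the constant \<open>d\<close>. The first part involves a row of the gradient and the second
    leads to a column, each bounded by the Frobenius norm.\<close>
  define h where "h x = U * (d / 2 * (\<Sum>k\<in>UNIV. (G x $ 1 $ k)\<^sup>2)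
      + 1 / (2 * d) * (\<Sum>k\<in>UNIV. if ?r < x $ 3 then (w x k)\<^sup>2 else 0))" for x
  note comps = H1_shear_components[OF v] and squares = H1_shear_squares[OF v]
  have [measurable]: "(\<lambda>x. v x $ i) \<in> borel_measurable (lebesgue_on (Omega L))"
    "(\<lambda>x. G x $ i $ k) \<in> borel_measurable (lebesgue_on (Omega L))" for i k
    by (rule comps)+
  have [measurable]: "(\<lambda>x::real^3. x $ 3) \<in> borel_measurable (lebesgue_on (Omega L))"
    "(\<lambda>x::real^3. ramp ?r (x $ 3)) \<in> borel_measurable (lebesgue_on (Omega L))"
    by (intro borel_imp_lebesgue_on; measurable)+
  have wm[measurable]: "(\<lambda>x. w x k) \<in> borel_measurable (lebesgue_on (Omega L))" for k
    unfolding w_def by measurable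
  have split: "(G x *v v x) \<bullet> shear_profile c ?r x = a x + b x" for x
  proof -
    have "G x $ 1 \<bullet> v x = (\<Sum>k\<in>UNIV. G x $ 1 $ k * w x k) + U * G x $ 1 $ 1"
      by (simp add: inner_vec_def w_def sum_3 algebra_simps)
    then show ?thesis
      by (simp add: convective_shear_profile a_def b_def algebra_simps)
  qed
  have w2: "set_integrable lebesgue (Omega L) (\<lambda>x. if ?r < x $ 3 then (w x k)\<^sup>2 else 0)" for k
    by (rule set_integrable_dominated[OF _ _ squares(1)[of k "(vector [U, 0, 0] :: real^3) $ k"]])
       (auto simp: w_def[symmetric])
  have h: "set_integrable lebesgue (Omega L) h"
    unfolding h_def by (intro set_integrable_mult_right set_integral_add set_integrable_sum_finite squares w2)
  have bound: "\<bar>a x\<bar> \<le> h x" if x: "x \<in> Omega L" for x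
  proof (cases "?r < x $ 3")
    case True
    have "\<bar>c * ramp ?r (x $ 3)\<bar> \<le> U"
    proof -
      have "x $ 3 < L"
        using x by (simp add: mem_Omega)
      then show ?thesis
        using True c by (simp add: ramp_def abs_mult)
    qed
    moreover have "\<bar>\<Sum>k\<in>UNIV. G x $ 1 $ k * w x k\<bar> \<le> (\<Sum>k\<in>UNIV. d / 2 * (G x $ 1 $ k)\<^sup>2 + 1 / (2 * d) * (w x k)\<^sup>2)"
    proof (rule order_trans[OF sum_abs], rule sum_mono)
      fix k
      have "0 \<le> (d * \<bar>G x $ 1 $ k\<bar> - \<bar>w x k\<bar>)\<^sup>2 / (2 * d)"
        using d by simp
      also have "\<dots> = d / 2 * (G x $ 1 $ k)\<^sup>2 + 1 / (2 * d) * (w x k)\<^sup>2 - \<bar>G x $ 1 $ k * w x k\<bar>"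
        using d by (simp add: power2_diff power_mult_distrib abs_mult field_simps power2_eq_square)
      finally show "\<bar>G x $ 1 $ k * w x k\<bar> \<le> d / 2 * (G x $ 1 $ k)\<^sup>2 + 1 / (2 * d) * (w x k)\<^sup>2"
        by simp
    qed
    ultimately have "\<bar>a x\<bar> \<le> U * (\<Sum>k\<in>UNIV. d / 2 * (G x $ 1 $ k)\<^sup>2 + 1 / (2 * d) * (w x k)\<^sup>2)"
      unfolding a_def abs_mult[of "c * _"] using c d by (intro mult_mono) auto
    then show ?thesis
      using True by (simp add: h_def sum.distrib sum_distrib_left)
  next
    case False
    then have "a x = 0"
      by (simp add: a_def ramp_def)
    moreover have "0 \<le> h x"
      unfolding h_def using c d by (intro mult_nonneg_nonneg add_nonneg_nonneg sum_nonneg) auto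
    ultimately show ?thesis by simp
  qed
  have a: "set_integrable lebesgue (Omega L) a"
  proof (rule set_integrable_dominated[OF _ _ h])
    show "a \<in> borel_measurable (lebesgue_on (Omega L))"
      unfolding a_def[abs_def] by measurable
  qed (use bound in auto)
  have b: "set_integrable lebesgue (Omega L) b"
    unfolding b_def
  proof (intro set_integrable_mult_right L2_times_bounded_integrable[where M = L])
    show "L2_on (Omega L) G"
      using v by (simp add: H1_shear_def)
    show "\<bar>ramp ?r (x $ 3)\<bar> \<le> L" if "x \<in> Omega L" for x
    proof -
      have "x $ 3 < L"
        using that by (simp add: mem_Omega)
      then show ?thesis
        using d by (simp add: ramp_def)
    qed
  qed (auto simp: abs_gradient_entry_le)
  have "(LINT x:Omega L|lebesgue. b x) = 0"
    unfolding b_def using shear_periodic_ramp[OF L v, of ?r 1] d by simp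
  then have "(LINT x:Omega L|lebesgue. (G x *v v x) \<bullet> shear_profile c ?r x) = (LINT x:Omega L|lebesgue. a x)"
    unfolding split using a b by simp
  moreover have "\<bar>LINT x:Omega L|lebesgue. a x\<bar> \<le> (LINT x:Omega L|lebesgue. h x)"
  proof -
    have "\<bar>LINT x:Omega L|lebesgue. a x\<bar> \<le> (LINT x:Omega L|lebesgue. \<bar>a x\<bar>)"
      using integral_norm_bound[of lebesgue "\<lambda>x. indicator (Omega L) x *\<^sub>R a x"]
      by (simp add: set_lebesgue_integral_def abs_mult)
    also have "\<dots> \<le> (LINT x:Omega L|lebesgue. h x)"
      using bound by (intro set_integral_mono set_integrable_abs a h) auto
    finally show ?thesis .
  qed
  moreover have "(LINT x:Omega L|lebesgue. h x) \<le> U * d * (LINT x:Omega L|lebesgue. (norm (G x))\<^sup>2)"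
  proof -
    let ?I = "LINT x:Omega L|lebesgue. (norm (G x))\<^sup>2"
    have "(LINT x:Omega L|lebesgue. h x) = U * (d / 2 * (LINT x:Omega L|lebesgue. (\<Sum>k\<in>UNIV. (G x $ 1 $ k)\<^sup>2))
      + 1 / (2 * d) * (\<Sum>k\<in>UNIV. LINT x:Omega L|lebesgue. (if ?r < x $ 3 then (w x k)\<^sup>2 else 0)))"
      unfolding h_def
      by (subst set_integral_mult_right, subst set_integral_add(2))
         (auto intro!: set_integrable_mult_right set_integrable_sum_finite squares w2
           simp only: set_integral_mult_right set_integrable_sum_finite(2)[OF w2])
    also have "\<dots> \<le> U * (d / 2 * ?I + 1 / (2 * d) * (d\<^sup>2 * ?I))"
    proof (intro mult_left_mono add_mono)
      show "(LINT x:Omega L|lebesgue. (\<Sum>k\<in>UNIV. (G x $ 1 $ k)\<^sup>2)) \<le> ?I"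
        by (intro set_integral_mono set_integrable_sum_finite squares row_square_le)
      have "(\<Sum>k\<in>UNIV. LINT x:Omega L|lebesgue. (if ?r < x $ 3 then (w x k)\<^sup>2 else 0))
          \<le> (\<Sum>k\<in>UNIV. d\<^sup>2 * (LINT x:Omega L|lebesgue. (G x $ k $ 3)\<^sup>2))"
        unfolding w_def by (intro sum_mono wall_Poincare[OF L d v])
      also have "\<dots> = d\<^sup>2 * (LINT x:Omega L|lebesgue. (\<Sum>k\<in>UNIV. (G x $ k $ 3)\<^sup>2))"
        by (simp only: sum_distrib_left set_integrable_sum_finite(2)[OF squares(2)])
      also have "\<dots> \<le> d\<^sup>2 * ?I"
        by (intro mult_left_mono set_integral_mono set_integrable_sum_finite squares column_square_le) auto
      finally show "(\<Sum>k\<in>UNIV. LINT x:Omega L|lebesgue. (if ?r < x $ 3 then (w x k)\<^sup>2 else 0)) \<le> d\<^sup>2 * ?I" .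
    qed (use c d in auto)
    also have "\<dots> = U * d * ?I"
      using d by (simp add: field_simps power2_eq_square)
    finally show ?thesis .
  qed
  ultimately show ?thesis
    by linarith
qed

text \<open>Testing the trace with the constant 1 gives the integral of the third derivative of the
  first component as the difference of the wall velocities times \<open>L\<^sup>2\<close>;
  Cauchy-Schwarz does the rest. This keeps the denominator of \<open>\<nu>e\<close> away from
  zero.\<close>

lemma shear_gradient_lower_bound:
  assumes L: "L > 0" and v: "H1_shear L U v G"
  shows "U\<^sup>2 * L \<le> (LINT x:Omega L|lebesgue. (norm (G x))\<^sup>2)"
proof -
  obtain b where b: "boundary_trace L v G b" "shear_boundary_values L U b"
    using v by (auto simp: H1_shear_def)
  have "C1_with_gradient (\<lambda>x. 1) (\<lambda>x. 0)"
    by (simp add: C1_with_gradient_def GDERIV_const)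
  then have "(LINT x:Omega L|lebesgue. v x $ 1 * (0::real^3) $ 3) + (LINT x:Omega L|lebesgue. G x $ 1 $ 3 * 1)
      = face_integral L 3 L (\<lambda>x. b x $ 1 * 1) - face_integral L 3 0 (\<lambda>x. b x $ 1 * 1)"
    using b(1) unfolding boundary_trace_def by blast
  moreover have "(LINT x:Omega L|lebesgue. b (on_face 3 L x) $ 1) = (LINT x:Omega L|lebesgue. U)"
    "(LINT x:Omega L|lebesgue. b (on_face 3 0 x) $ 1) = (LINT x:Omega L|lebesgue. 0)"
    using b(2) Omega_subset_cbox[of L] unfolding shear_boundary_values_def
    by (intro set_lebesgue_integral_cong; force)+
  moreover have vol: "measure lebesgue (Omega L) = L ^ 3"
    by (rule measure_Omega[OF L])
  moreover have "(LINT x:Omega L|lebesgue. U) = L ^ 3 * U"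
    using emeasure_Omega_finite[of L] vol by (subst set_integral_const) auto
  ultimately have "(LINT x:Omega L|lebesgue. G x $ 1 $ 3) = U * L\<^sup>2"
    using L by (simp add: face_integral_def power3_eq_cube power2_eq_square)
  then have "(U * L\<^sup>2)\<^sup>2 \<le> L ^ 3 * (LINT x:Omega L|lebesgue. (G x $ 1 $ 3)\<^sup>2)"
    using set_integral_square_le[OF Omega_lebesgue vol _ H1_shear_components(4)[OF v, of 1 3] H1_shear_squares(2)[OF v, of 1 3]] L
    by simp
  then have "L ^ 3 * (U\<^sup>2 * L) \<le> L ^ 3 * (LINT x:Omega L|lebesgue. (G x $ 1 $ 3)\<^sup>2)"
    by (simp add: power_mult_distrib power2_eq_square power3_eq_cube mult_ac)
  then have "U\<^sup>2 * L \<le> (LINT x:Omega L|lebesgue. (G x $ 1 $ 3)\<^sup>2)"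
    using L by simp
  also have "\<dots> \<le> (LINT x:Omega L|lebesgue. (norm (G x))\<^sup>2)"
    using power_mono[OF abs_gradient_entry_le, of _ 1 3 2]
    by (intro set_integral_mono H1_shear_squares[OF v]) simp
  finally show ?thesis .
qed

section \<open>Weak solutions and the eddy viscosity\<close>

lemma cylinder_borel: "S \<in> sets borel \<Longrightarrow> (S :: real set) \<times> Omega L \<in> sets borel"
  by (simp add: borel_prod[symmetric])

lemma cylinder_sets [measurable]: "S \<in> sets borel \<Longrightarrow> (S :: real set) \<times> Omega L \<in> sets lebesgue"
  using cylinder_borel by simp

lemma cylinder_const_integrable: "set_integrable lebesgue ({0<..<T::real} \<times> Omega L) (\<lambda>_. c :: real)"
proof (rule set_integrable_finite_const)
  have "bounded ({0<..<T} \<times> Omega L)"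
    unfolding Omega_def by (intro bounded_Times) auto
  from emeasure_bounded_finite[OF this] show "emeasure lebesgue ({0<..<T} \<times> Omega L) < \<infinity>"
    using cylinder_borel[of "{0<..<T}" L] by simp
qed (simp add: cylinder_sets)

lemma AE_lebesgue_on_iff:
  "S \<in> sets lebesgue \<Longrightarrow> (AE x in lebesgue_on S. P x) \<longleftrightarrow> (AE x in lebesgue. x \<in> S \<longrightarrow> P x)"
  by (simp add: AE_restrict_space_iff)

lemma weak_solution_AE_H1:
  assumes "weak_solution L U \<nu> \<nu>t u0 u Du"
  shows "AE t in lebesgue. 0 < t \<longrightarrow> H1_shear L U (u t) (Du t)"
proof -
  have "AE t in lebesgue_on {0<..}. H1_shear L U (u t) (Du t) \<and> divergence_free L (Du t)"
    using assms by (simp add: weak_solution_def)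
  then have "AE t in lebesgue. t \<in> {0<..} \<longrightarrow> H1_shear L U (u t) (Du t) \<and> divergence_free L (Du t)"
    by (subst (asm) AE_lebesgue_on_iff) auto
  then show ?thesis
    by eventually_elim auto
qed

lemma weak_solution_measurable:
  assumes "weak_solution L U \<nu> \<nu>t u0 u Du" "T > 0"
  shows "(\<lambda>z. u (fst z) (snd z)) \<in> borel_measurable (lebesgue_on ({0<..<T} \<times> Omega L))"
    and "(\<lambda>z. Du (fst z) (snd z)) \<in> borel_measurable (lebesgue_on ({0<..<T} \<times> Omega L))"
    and "set_integrable lebesgue ({0<..<T} \<times> Omega L) (\<lambda>z. (norm (Du (fst z) (snd z)))\<^sup>2)"
    and "set_integrable lebesgue ({0<..<T} \<times> Omega L) (\<lambda>z. \<nu>t (fst z) (snd z) * (norm (Du (fst z) (snd z)))\<^sup>2)"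
proof -
  have "(\<lambda>z. u (fst z) (snd z)) \<in> borel_measurable (lebesgue_on ({0<..} \<times> Omega L))"
    using assms by (simp add: weak_solution_def case_prod_beta')
  then show "(\<lambda>z. u (fst z) (snd z)) \<in> borel_measurable (lebesgue_on ({0<..<T} \<times> Omega L))"
    by (rule measurable_restrict_mono) auto
  have "L2_on ({0<..<T} \<times> Omega L) (\<lambda>(t, x). Du t x)"
    using assms unfolding weak_solution_def by blast
  then show "(\<lambda>z. Du (fst z) (snd z)) \<in> borel_measurable (lebesgue_on ({0<..<T} \<times> Omega L))"
    and "set_integrable lebesgue ({0<..<T} \<times> Omega L) (\<lambda>z. (norm (Du (fst z) (snd z)))\<^sup>2)"
    by (auto simp: L2_on_def case_prod_beta')
  have "set_integrable lebesgue ({0<..<T} \<times> Omega L) (\<lambda>(t, x). \<nu>t t x * (norm (Du t x))\<^sup>2)"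
    using assms unfolding weak_solution_def by blast
  then show "set_integrable lebesgue ({0<..<T} \<times> Omega L) (\<lambda>z. \<nu>t (fst z) (snd z) * (norm (Du (fst z) (snd z)))\<^sup>2)"
    by (simp add: case_prod_beta')
qed

text \<open>The spatial norm is bounded uniformly for almost every time below \<open>T\<close>, and
  a constant is integrable over the bounded time interval.\<close>

lemma weak_solution_square_integrable:
  assumes sol: "weak_solution L U \<nu> \<nu>t u0 u Du" and T: "T > 0"
  shows "set_integrable lebesgue ({0<..<T} \<times> Omega L) (\<lambda>z. (norm (u (fst z) (snd z)))\<^sup>2)"
proof -
  obtain C where "AE t in lebesgue_on {0<..<T}. L2_on (Omega L) (u t) \<and> (LINT x:Omega L|lebesgue. (norm (u t x))\<^sup>2) \<le> C"
    using sol T unfolding weak_solution_def by blast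
  then have C: "AE t in lebesgue. t \<in> {0<..<T} \<longrightarrow> L2_on (Omega L) (u t) \<and> (LINT x:Omega L|lebesgue. (norm (u t x))\<^sup>2) \<le> C"
    by (subst (asm) AE_lebesgue_on_iff) auto
  have ind: "indicator ({0<..<T} \<times> Omega L) (t, x) = (indicator {0<..<T} t * indicator (Omega L) x :: real)" for t x
    by (auto simp: indicator_def)
  show ?thesis
    unfolding set_integrable_def
  proof (rule lebesgue_Tonelli_integrable)
    show "AE t in lebesgue. integrable lebesgue (\<lambda>x. indicat_real ({0<..<T} \<times> Omega L) (t, x) *\<^sub>R (norm (u (fst (t, x)) (snd (t, x))))\<^sup>2)
        \<and> (LINT x|lebesgue. indicat_real ({0<..<T} \<times> Omega L) (t, x) *\<^sub>R (norm (u (fst (t, x)) (snd (t, x))))\<^sup>2) \<le> indicator {0<..<T} t * C"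
      using C
    proof eventually_elim
      case (elim t)
      then show ?case
        by (cases "t \<in> {0<..<T}") (auto simp: ind L2_on_def set_integrable_def set_lebesgue_integral_def)
    qed
    show "integrable lebesgue (\<lambda>t. indicator {0<..<T} t * C)"
      by (intro integrable_mult_left integrable_real_indicator) (use T in auto)
    show "(\<lambda>z. indicat_real ({0<..<T} \<times> Omega L) z *\<^sub>R (norm (u (fst z) (snd z)))\<^sup>2) \<in> borel_measurable lebesgue"
      using weak_solution_measurable(1)[OF sol T]
      by (subst borel_measurable_restrict_space_iff[symmetric]) (auto simp: cylinder_sets)
  qed auto
qed

lemma nu_turb_nonneg: "0 \<le> \<mu> \<Longrightarrow> 0 \<le> \<tau> \<Longrightarrow> 0 \<le> nu_turb \<mu> \<tau> J u t x"
  unfolding nu_turb_def ensemble_avg_def by (auto intro!: mult_nonneg_nonneg divide_nonneg_nonneg sum_nonneg)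

text \<open>A crude majorant by the triangle and Cauchy-Schwarz inequalities. It serves only to make
  the eddy viscosity integrable on bounded time intervals, so its constant never reaches the final
  estimate.\<close>

lemma nu_turb_le:
  assumes J: "J \<ge> 1" and pos: "0 \<le> \<mu>" "0 \<le> \<tau>"
  shows "nu_turb \<mu> \<tau> J u t x \<le> \<mu> * \<tau> * (4 * real J * (\<Sum>i=1..J. (norm (u i t x))\<^sup>2))"
proof -
  let ?s = "\<Sum>i=1..J. norm (u i t x)"
  have avg: "norm (ensemble_avg J (\<lambda>i. u i t x)) \<le> ?s"
  proof -
    have "norm (ensemble_avg J (\<lambda>i. u i t x)) = 1 / real J * norm (\<Sum>i=1..J. u i t x)"
      by (simp add: ensemble_avg_def)
    also have "\<dots> \<le> 1 * norm (\<Sum>i=1..J. u i t x)"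
      using J by (intro mult_right_mono) auto
    also have "\<dots> \<le> ?s"
      using norm_sum by simp
    finally show ?thesis .
  qed
  have "(norm (fluctuation J u j t x))\<^sup>2 \<le> 4 * (real J * (\<Sum>i=1..J. (norm (u i t x))\<^sup>2))" if j: "j \<in> {1..J}" for j
  proof -
    have "norm (u j t x) \<le> ?s"
      using j by (intro member_le_sum) auto
    then have "norm (fluctuation J u j t x) \<le> 2 * ?s"
      unfolding fluctuation_def using avg norm_triangle_ineq4[of "u j t x" "ensemble_avg J (\<lambda>i. u i t x)"] by linarith
    then have "(norm (fluctuation J u j t x))\<^sup>2 \<le> (2 * ?s)\<^sup>2"
      by (intro power_mono) auto
    also have "\<dots> = 4 * ?s\<^sup>2"
      by (simp add: power_mult_distrib)
    also have "?s\<^sup>2 \<le> real J * (\<Sum>i=1..J. (norm (u i t x))\<^sup>2)"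
      using sum_squared_le_sum_of_squares[of "\<lambda>i. norm (u i t x)" "{1..J}"] by (simp add: mult.commute)
    finally show ?thesis
      by simp
  qed
  then have "(\<Sum>j=1..J. (norm (fluctuation J u j t x))\<^sup>2) \<le> real (card {1..J}) * (4 * (real J * (\<Sum>i=1..J. (norm (u i t x))\<^sup>2)))"
    by (intro sum_bounded_above) auto
  then have "ensemble_avg J (\<lambda>j. (norm (fluctuation J u j t x))\<^sup>2) \<le> 4 * real J * (\<Sum>i=1..J. (norm (u i t x))\<^sup>2)"
    using J by (simp add: ensemble_avg_def field_simps)
  then show ?thesis
    unfolding nu_turb_def using pos by (intro mult_left_mono) auto
qed

lemma nu_turb_integrable:
  assumes J: "J \<ge> 1" and pos: "0 \<le> \<mu>" "0 \<le> \<tau>" and T: "T > 0"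
    and sol: "\<And>j. j \<in> {1..J} \<Longrightarrow> weak_solution L U \<nu> \<nu>t (u0 j) (u j) (Du j)"
  shows "(\<lambda>z. nu_turb \<mu> \<tau> J u (fst z) (snd z)) \<in> borel_measurable (lebesgue_on ({0<..<T} \<times> Omega L))"
    and "set_integrable lebesgue ({0<..<T} \<times> Omega L) (\<lambda>z. nu_turb \<mu> \<tau> J u (fst z) (snd z))"
proof -
  let ?M = "lebesgue_on ({0<..<T} \<times> Omega L)"
  have um: "(\<lambda>z. u j (fst z) (snd z)) \<in> borel_measurable ?M" if "j \<in> {1..J}" for j
    using weak_solution_measurable(1)[OF sol[OF that] T] .
  have "(\<lambda>z. \<Sum>i=1..J. u i (fst z) (snd z)) \<in> borel_measurable ?M"
    by (intro borel_measurable_sum um)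
  then have "(\<lambda>z. u j (fst z) (snd z) - (1 / real J) *\<^sub>R (\<Sum>i=1..J. u i (fst z) (snd z))) \<in> borel_measurable ?M"
    if "j \<in> {1..J}" for j
    using um[OF that] by measurable
  then have fm: "(\<lambda>z. norm (u j (fst z) (snd z) - (1 / real J) *\<^sub>R (\<Sum>i=1..J. u i (fst z) (snd z)))) \<in> borel_measurable ?M"
    if "j \<in> {1..J}" for j
    using that by measurable
  show m: "(\<lambda>z. nu_turb \<mu> \<tau> J u (fst z) (snd z)) \<in> borel_measurable ?M"
    unfolding nu_turb_def fluctuation_def ensemble_avg_def
    by (intro borel_measurable_times borel_measurable_scaleR borel_measurable_const borel_measurable_sum
        borel_measurable_power fm)
  show "set_integrable lebesgue ({0<..<T} \<times> Omega L) (\<lambda>z. nu_turb \<mu> \<tau> J u (fst z) (snd z))"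
  proof (rule set_integrable_dominated[OF _ m])
    show "set_integrable lebesgue ({0<..<T} \<times> Omega L)
        (\<lambda>z. \<mu> * \<tau> * (4 * real J * (\<Sum>i=1..J. (norm (u i (fst z) (snd z)))\<^sup>2)))"
      by (intro set_integrable_mult_right set_integrable_sum_finite weak_solution_square_integrable[OF sol T])
    show "AE z in lebesgue. z \<in> {0<..<T} \<times> Omega L \<longrightarrow> \<bar>nu_turb \<mu> \<tau> J u (fst z) (snd z)\<bar>
        \<le> \<mu> * \<tau> * (4 * real J * (\<Sum>i=1..J. (norm (u i (fst z) (snd z)))\<^sup>2))"
      using nu_turb_le[OF J pos] nu_turb_nonneg[OF pos] by simp
  qed (simp add: cylinder_sets)
qed

section \<open>Time integrals and the wall layer\<close>

text \<open>No measurability is required: the Lebesgue measure is complete, and the integral of a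
  non-measurable function is \<open>0\<close>.\<close>

lemma integral_lebesgue_cong_AE:
  fixes f g :: "'a::euclidean_space \<Rightarrow> real"
  assumes eq: "AE x in lebesgue. f x = g x"
  shows "integral\<^sup>L lebesgue f = integral\<^sup>L lebesgue g"
proof (cases "f \<in> borel_measurable lebesgue")
  case True
  then have "g \<in> borel_measurable lebesgue"
    using eq by (rule borel_measurable_AE)
  with True eq show ?thesis
    by (intro integral_cong_AE)
next
  case False
  have "AE x in lebesgue. g x = f x"
    using eq by eventually_elim simp
  then have "g \<notin> borel_measurable lebesgue"
    using False borel_measurable_AE by blast
  with False show ?thesis
    by (metis borel_measurable_integrable not_integrable_integral_eq)
qed

lemma AE_not_in_box_boundary: "AE x in lebesgue. x \<in> cbox a b \<longrightarrow> x \<in> box a (b :: 'a::euclidean_space)"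
proof -
  have "cbox a b - box a b \<in> null_sets lebesgue"
    using negligible_frontier_interval negligible_iff_null_sets by blast
  then have "AE x in lebesgue. x \<notin> cbox a b - box a b"
    by (rule AE_not_in)
  then show ?thesis
    by eventually_elim auto
qed

lemma time_integral_open_interval: "(LINT t:{0..T}|lebesgue. f t) = (LINT t:{0<..<T::real}|lebesgue. f t :: real)"
  unfolding set_lebesgue_integral_def
proof (rule integral_lebesgue_cong_AE)
  show "AE t in lebesgue. indicat_real {0..T} t *\<^sub>R f t = indicat_real {0<..<T} t *\<^sub>R f t"
    using AE_not_in_box_boundary[of 0 T] by eventually_elim (auto simp: indicator_def)
qed

lemma time_integral_continuous:
  fixes f :: "real \<Rightarrow> real"
  assumes f: "\<And>T. T > 0 \<Longrightarrow> set_integrable lebesgue {0<..<T} f"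
  shows "continuous_on {0<..} (\<lambda>T. LINT t:{0<..<T}|lebesgue. f t)"
proof -
  have eq: "(LINT t:{0<..<T}|lebesgue. f t) = integral {0..T} f" if "T > 0" for T
    using set_lebesgue_integral_eq_integral(2)[OF f[OF that]] by (simp add: integral_open_interval_real)
  have "isCont (\<lambda>T. integral {0..T} f) T" if "T > 0" for T
  proof -
    have "f integrable_on {0<..<T + 1}"
      using set_lebesgue_integral_eq_integral(1)[OF f[of "T + 1"]] that by simp
    then have "f integrable_on {0..T + 1}"
      by (simp add: integrable_on_open_interval_real)
    from continuous_on_interior[OF indefinite_integral_continuous_1[OF this], of T] that
    show ?thesis by simp
  qed
  then have "continuous_on {0<..} (\<lambda>T. integral {0..T} f)"
    by (simp add: continuous_on_eq_continuous_at)
  then show ?thesis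
    by (rule continuous_on_eq) (simp add: eq)
qed

text \<open>On a compact interval around \<open>T\<close> the set where the inequality holds is
  closed, and a closed set containing almost every point of an open interval contains all of it.
  This upgrades the energy estimate from almost every time to every time.\<close>

lemma AE_le_imp_le:
  fixes f g :: "real \<Rightarrow> real"
  assumes cont: "continuous_on {0<..} f" "continuous_on {0<..} g"
    and le: "AE T in lebesgue. 0 < T \<longrightarrow> f T \<le> g T" and T: "0 < T"
  shows "f T \<le> g T"
proof -
  have sub: "{T/2..2*T} \<subseteq> {0<..}"
    using T by auto
  have "closed {t \<in> {T/2..2*T}. f t \<le> g t}"
    by (rule continuous_on_closed_Collect_le[OF continuous_on_subset[OF cont(1) sub]
          continuous_on_subset[OF cont(2) sub] closed_atLeastAtMost])
  moreover have "AE t\<in>{T/2<..<2*T} in lebesgue. t \<in> {t \<in> {T/2..2*T}. f t \<le> g t}"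
    using le
  proof eventually_elim
    case (elim t)
    then show ?case using T by simp
  qed
  ultimately have "T \<in> {t \<in> {T/2..2*T}. f t \<le> g t}"
    by (rule mem_closed_if_AE_lebesgue_open[OF open_greaterThanLessThan]) (use T in simp)
  then show ?thesis by simp
qed

text \<open>The region contains parts of the lateral faces, so it agrees with the layer of the open
  box only up to a null set. The bound \<open>\<beta> \<le> 1\<close> keeps it inside the closed
  box.\<close>

lemma near_wall_region_integral:
  assumes "0 < \<beta>" "\<beta> \<le> 1" "L > 0"
  shows "(LINT x:near_wall_region L \<beta>|lebesgue. f x) = (LINT x:Omega L|lebesgue. if L - \<beta> * L < x $ 3 then f x else (0::real))"
  unfolding set_lebesgue_integral_def
proof (rule integral_lebesgue_cong_AE)
  have sub: "near_wall_region L \<beta> \<subseteq> cbox 0 (vec L)"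
  proof
    fix x assume "x \<in> near_wall_region L \<beta>"
    moreover have "0 \<le> (1 - \<beta>) * L"
      using assms by simp
    ultimately show "x \<in> cbox 0 (vec L)"
      by (simp add: near_wall_region_def mem_box_cart forall_3)
  qed
  show "AE x in lebesgue. indicat_real (near_wall_region L \<beta>) x *\<^sub>R f x
      = indicat_real (Omega L) x *\<^sub>R (if L - \<beta> * L < x $ 3 then f x else 0)"
    using AE_not_in_box_boundary[of 0 "vec L :: real^3"]
  proof eventually_elim
    case (elim x)
    have "x \<in> near_wall_region L \<beta> \<longleftrightarrow> x \<in> Omega L \<and> L - \<beta> * L < x $ 3"
    proof
      assume x: "x \<in> near_wall_region L \<beta>"
      then have "x \<in> Omega L"
        using elim sub by (auto simp: Omega_def)
      with x show "x \<in> Omega L \<and> L - \<beta> * L < x $ 3"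
        by (simp add: near_wall_region_def left_diff_distrib)
    next
      assume "x \<in> Omega L \<and> L - \<beta> * L < x $ 3"
      then show "x \<in> near_wall_region L \<beta>"
        by (simp add: near_wall_region_def mem_Omega left_diff_distrib less_imp_le)
    qed
    then show ?case
      by (simp add: indicator_def)
  qed
qed

lemma wall_layer_integral_const:
  assumes "0 < d" "d \<le> L"
  shows "(LINT x:Omega L|lebesgue. if L - d < x $ 3 then a else 0) = d * L\<^sup>2 * (a::real)"
proof -
  define l :: "real^3" where "l = vector [0, 0, L - d]"
  have "x \<in> box l (vec L) \<longleftrightarrow> x \<in> Omega L \<and> L - d < x $ 3" for x
    using assms by (auto simp: l_def Omega_def mem_box_cart forall_3)
  then have "(LINT x:Omega L|lebesgue. if L - d < x $ 3 then a else 0) = (LINT x:box l (vec L)|lebesgue. a)"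
    unfolding set_lebesgue_integral_def
    by (intro Bochner_Integration.integral_cong) (auto simp: indicator_def)
  also have "\<dots> = measure lebesgue (box l (vec L)) *\<^sub>R a"
    by (rule set_integral_const) (auto simp: emeasure_lborel_box_eq)
  also have "measure lebesgue (box l (vec L)) = (\<Prod>i\<in>UNIV. vec L $ i - l $ i)"
  proof -
    have "vec L \<in> cbox l (vec L)"
      using assms by (auto simp: l_def mem_box_cart forall_3)
    then have "cbox l (vec L) \<noteq> {}"
      by blast
    then have "measure lborel (cbox l (vec L)) = (\<Prod>i\<in>UNIV. vec L $ i - l $ i)"
      by (rule content_cbox_cart)
    moreover have "measure lborel (box l (vec L)) = measure lborel (cbox l (vec L))"
      by (simp only: measure_lborel_box_eq measure_lborel_cbox_eq)
    moreover have "measure lebesgue (box l (vec L)) = measure lborel (box l (vec L))"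
      by (rule measure_completion) simp
    ultimately show ?thesis
      by (simp only:)
  qed
  also have "\<dots> = d * L\<^sup>2"
  proof -
    have "(\<Prod>i\<in>UNIV. g i) = g 1 * g 2 * g (3::3)" for g :: "3 \<Rightarrow> real"
      unfolding UNIV_3 by (simp add: mult.assoc)
    then show ?thesis
      by (simp add: l_def power2_eq_square)
  qed
  finally show ?thesis by simp
qed

lemma measure_near_wall_region:
  assumes "0 < \<beta>" "\<beta> \<le> 1" "L > 0"
  shows "measure lebesgue (near_wall_region L \<beta>) = \<beta> * L ^ 3"
proof -
  have [measurable]: "near_wall_region L \<beta> \<in> sets borel"
    unfolding near_wall_region_def by measurable
  have "bounded (near_wall_region L \<beta>)"
  proof (rule bounded_subset[OF bounded_cbox])
    have "0 \<le> (1 - \<beta>) * L"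
      using assms by simp
    then show "near_wall_region L \<beta> \<subseteq> cbox 0 (vec L)"
      by (auto simp: near_wall_region_def mem_box_cart forall_3)
  qed
  then have "emeasure lebesgue (near_wall_region L \<beta>) < \<infinity>"
    using emeasure_bounded_finite by simp
  then have "(LINT x:near_wall_region L \<beta>|lebesgue. 1) = measure lebesgue (near_wall_region L \<beta>) *\<^sub>R (1::real)"
    by (intro set_integral_const) auto
  moreover have "(LINT x:near_wall_region L \<beta>|lebesgue. 1) = \<beta> * L * L\<^sup>2 * (1::real)"
    unfolding near_wall_region_integral[OF assms] using assms by (intro wall_layer_integral_const) auto
  ultimately show ?thesis
    by (simp add: power2_eq_square power3_eq_cube mult_ac)
qed

text \<open>Otherwise the region begins at a negative height \<open>y\<close>, and a point at height
  \<open>y / 2\<close> lies in it but below the box.\<close>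

lemma near_wall_region_subset_imp:
  assumes "L > 0" "near_wall_region L \<beta> \<subseteq> closure (Omega L)"
  shows "\<beta> \<le> 1"
proof (rule ccontr)
  assume "\<not> \<beta> \<le> 1"
  define y where "y = (1 - \<beta>) * L"
  have neg: "y < 0"
    using assms(1) \<open>\<not> \<beta> \<le> 1\<close> by (simp add: y_def mult_less_0_iff)
  define x :: "real^3" where "x = vector [0, 0, y / 2]"
  have "x \<in> near_wall_region L \<beta>"
    unfolding near_wall_region_def y_def[symmetric] using neg assms(1) by (simp add: x_def)
  then have "x \<in> cbox 0 (vec L)"
    using assms(2) closure_minimal[OF Omega_subset_cbox closed_cbox] by blast
  then show False
    using neg by (auto simp: x_def mem_box_cart forall_3)
qed

text \<open>In the limit \<open>A / 2\<close> is at most \<open>A / 8 + q * (s + x)\<close>. As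
  \<open>A\<close> is a real number, \<open>A / 8\<close> can be moved to the left; the remaining
  3/8 accounts for the factor 8/3.\<close>

lemma Limsup_absorption:
  fixes a e X :: "real \<Rightarrow> real"
  assumes A: "Limsup at_top (\<lambda>T. ereal (a T)) = ereal A" and E: "Limsup at_top (\<lambda>T. ereal (e T)) = ereal E"
    and X: "Limsup at_top (\<lambda>T. ereal (X T)) = ereal x"
    and ineq: "\<And>T. T > 0 \<Longrightarrow> 1 / 2 * a T \<le> K / T + p * e T + q * (s + X T)"
    and pos: "p \<ge> 0" "q \<ge> 0" and pE: "p * E = A / 8"
  shows "A \<le> 8 / 3 * q * (s + x)"
proof -
  have "A \<le> A / 4 + 2 * q * (s + x) + (2 + 2 * p + 2 * q) * \<delta>" if \<delta>: "\<delta> > 0" for \<delta>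
  proof -
    have "((\<lambda>T. K / T) \<longlongrightarrow> 0) at_top"
      by real_asymp
    then have "eventually (\<lambda>T. K / T < \<delta>) at_top"
      using \<delta> by (rule order_tendstoD)
    moreover have "eventually (\<lambda>T. ereal (e T) < ereal (E + \<delta>)) at_top"
      using E \<delta> by (intro Limsup_lessD) simp
    moreover have "eventually (\<lambda>T. ereal (X T) < ereal (x + \<delta>)) at_top"
      using X \<delta> by (intro Limsup_lessD) simp
    moreover note eventually_gt_at_top[of 0]
    ultimately have "eventually (\<lambda>T. ereal (a T) \<le> ereal (2 * \<delta> + 2 * (p * (E + \<delta>)) + 2 * (q * (s + (x + \<delta>))))) at_top"
    proof eventually_elim
      case (elim T)
      have "p * e T \<le> p * (E + \<delta>)" "q * (s + X T) \<le> q * (s + (x + \<delta>))"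
        using elim pos by (auto intro!: mult_left_mono)
      with ineq[OF elim(4)] elim(1)
      have "a T \<le> 2 * \<delta> + 2 * (p * (E + \<delta>)) + 2 * (q * (s + (x + \<delta>)))"
        by linarith
      then show ?case
        by simp
    qed
    then have "Limsup at_top (\<lambda>T. ereal (a T)) \<le> ereal (2 * \<delta> + 2 * (p * (E + \<delta>)) + 2 * (q * (s + (x + \<delta>))))"
      by (rule Limsup_bounded)
    then show ?thesis
      using pE by (simp add: A algebra_simps)
  qed
  note * = this
  have "A \<le> A / 4 + 2 * q * (s + x)"
  proof (rule field_le_epsilon)
    fix e :: real assume "e > 0"
    moreover have "2 + 2 * p + 2 * q > 0"
      using pos by simp
    ultimately show "A \<le> A / 4 + 2 * q * (s + x) + e"
      using *[of "e / (2 + 2 * p + 2 * q)"] by simp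
  qed
  then show ?thesis
    by simp
qed

section \<open>The energy inequality against the background flow\<close>

lemma inner_le_half_squares: "\<bar>a \<bullet> b\<bar> \<le> (norm a)\<^sup>2 / 2 + (norm b)\<^sup>2 / 2" for a b :: "'a::real_inner"
proof -
  have "\<bar>a \<bullet> b\<bar> \<le> norm a * norm b"
    by (rule Cauchy_Schwarz_ineq2)
  moreover have "2 * (norm a * norm b) \<le> (norm a)\<^sup>2 + (norm b)\<^sup>2"
    using sum_squares_bound[of "norm a" "norm b"] by (simp add: mult.assoc)
  ultimately show ?thesis
    by linarith
qed

lemma set_integrable_wall_layer:
  fixes f :: "real \<times> (real^3) \<Rightarrow> real"
  assumes "set_integrable lebesgue Q f"
  shows "set_integrable lebesgue Q (\<lambda>z. if a < snd z $ 3 then f z else 0)"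
proof -
  have "(\<lambda>z. snd z $ 3) \<in> borel_measurable (borel :: (real \<times> (real^3)) measure)"
    unfolding borel_prod[symmetric] by measurable
  then have "{z :: real \<times> (real^3). a < snd z $ 3} \<in> sets borel"
    using borel_measurable_less[of "\<lambda>_. a" borel "\<lambda>z. snd z $ 3"] by simp
  then have "{z :: real \<times> (real^3). a < snd z $ 3} \<in> sets lebesgue"
    by simp
  from integrable_mult_indicator[OF this assms[unfolded set_integrable_def]]
  have "integrable lebesgue (\<lambda>z. indicator {z. a < snd z $ 3} z *\<^sub>R (indicator Q z *\<^sub>R f z))" .
  also have "(\<lambda>z. indicator {z. a < snd z $ 3} z *\<^sub>R (indicator Q z *\<^sub>R f z))
      = (\<lambda>z. indicator Q z *\<^sub>R (if a < snd z $ 3 then f z else 0))"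
    by (auto simp: indicator_def)
  finally show ?thesis
    unfolding set_integrable_def .
qed

lemma total_dissipation_integrable:
  assumes sol: "weak_solution L U \<nu> \<nu>t u0 u Du" and T: "T > 0"
  shows "set_integrable lebesgue ({0<..<T} \<times> Omega L) (\<lambda>z. (\<nu> + \<nu>t (fst z) (snd z)) * (norm (Du (fst z) (snd z)))\<^sup>2)"
  unfolding distrib_right
  by (intro set_integral_add set_integrable_mult_right weak_solution_measurable[OF sol T])

text \<open>A single ensemble member with an abstract nonnegative viscosity \<open>\<nu>t\<close>
  and a free layer thickness \<open>d\<close>; \<open>c\<close> is the slope \<open>U / d\<close> of
  the profile. The link between \<open>d\<close> and the effective viscosity is made only in the
  final theorem.\<close>

context
  fixes L U \<nu> d c :: real and \<nu>t :: "real \<Rightarrow> real^3 \<Rightarrow> real" and u0 :: "real^3 \<Rightarrow> real^3"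
    and u :: "real \<Rightarrow> real^3 \<Rightarrow> real^3" and Du :: "real \<Rightarrow> real^3 \<Rightarrow> real^3^3"
  assumes L: "L > 0" and d: "0 < d" "d \<le> L" and c: "c > 0" "U = c * d" and \<nu>: "\<nu> > 0"
    and u0: "L2_on (Omega L) u0"
    and \<nu>t0: "\<And>t x. 0 \<le> \<nu>t t x"
    and \<nu>tm: "\<And>T. T > 0 \<Longrightarrow> (\<lambda>z. \<nu>t (fst z) (snd z)) \<in> borel_measurable (lebesgue_on ({0<..<T} \<times> Omega L))"
    and \<nu>ti: "\<And>T. T > 0 \<Longrightarrow> set_integrable lebesgue ({0<..<T} \<times> Omega L) (\<lambda>z. \<nu>t (fst z) (snd z))"
    and sol: "weak_solution L U \<nu> \<nu>t u0 u Du"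
    and energy: "energy_inequality L U \<nu> \<nu>t u0 u Du"
begin

lemma wall_viscosity_integrable:
  assumes T: "T > 0"
  shows "set_integrable lebesgue ({0<..<T} \<times> Omega L) (\<lambda>z. if L - d < snd z $ 3 then \<nu> + \<nu>t (fst z) (snd z) else 0)"
  by (intro set_integrable_wall_layer set_integral_add cylinder_const_integrable \<nu>ti[OF T])

text \<open>The gradient of the profile has norm \<open>c\<close> in the layer and 0 elsewhere, so
  Young's inequality leaves half of the dissipation and the viscosity integrated over the layer. The
  integrability is a premise of the energy inequality.\<close>

lemma viscous_coupling:
  assumes T: "T > 0"
  shows "set_integrable lebesgue ({0<..<T} \<times> Omega L)
      (\<lambda>z. (\<nu> + \<nu>t (fst z) (snd z)) * (Du (fst z) (snd z) \<bullet> shear_profile_grad c (L - d) (snd z)))"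
    and "(LINT z:{0<..<T} \<times> Omega L|lebesgue. (\<nu> + \<nu>t (fst z) (snd z)) * (Du (fst z) (snd z) \<bullet> shear_profile_grad c (L - d) (snd z)))
      \<le> 1 / 2 * (LINT z:{0<..<T} \<times> Omega L|lebesgue. (\<nu> + \<nu>t (fst z) (snd z)) * (norm (Du (fst z) (snd z)))\<^sup>2)
        + c\<^sup>2 / 2 * (LINT z:{0<..<T} \<times> Omega L|lebesgue. if L - d < snd z $ 3 then \<nu> + \<nu>t (fst z) (snd z) else 0)"
proof -
  let ?Q = "{0<..<T} \<times> Omega L"
  let ?f = "\<lambda>z. (\<nu> + \<nu>t (fst z) (snd z)) * (Du (fst z) (snd z) \<bullet> shear_profile_grad c (L - d) (snd z))"
  let ?D = "\<lambda>z. (\<nu> + \<nu>t (fst z) (snd z)) * (norm (Du (fst z) (snd z)))\<^sup>2"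
  let ?M = "\<lambda>z. if L - d < snd z $ 3 then \<nu> + \<nu>t (fst z) (snd z) else 0"
  have h: "set_integrable lebesgue ?Q (\<lambda>z. 1 / 2 * ?D z + c\<^sup>2 / 2 * ?M z)"
    by (intro set_integral_add set_integrable_mult_right total_dissipation_integrable[OF sol T] wall_viscosity_integrable[OF T])
  have bound: "\<bar>?f z\<bar> \<le> 1 / 2 * ?D z + c\<^sup>2 / 2 * ?M z" for z
  proof -
    have pos: "0 \<le> \<nu> + \<nu>t (fst z) (snd z)"
      using \<nu> \<nu>t0 by (simp add: add_nonneg_nonneg less_imp_le)
    then have "\<bar>?f z\<bar> \<le> (\<nu> + \<nu>t (fst z) (snd z)) * ((norm (Du (fst z) (snd z)))\<^sup>2 / 2
        + (norm (shear_profile_grad c (L - d) (snd z)))\<^sup>2 / 2)"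
      unfolding abs_mult by (simp add: mult_left_mono inner_le_half_squares)
    then show ?thesis
      by (simp add: norm_shear_profile_grad distrib_left mult.commute split: if_splits)
  qed
  have "(\<lambda>z. shear_profile_grad c (L - d) (snd z)) \<in> borel_measurable (borel :: (real \<times> (real^3)) measure)"
    unfolding borel_prod[symmetric] by measurable
  then have [measurable]: "(\<lambda>z. shear_profile_grad c (L - d) (snd z)) \<in> borel_measurable (lebesgue_on ?Q)"
    by (rule borel_imp_lebesgue_on)
  note [measurable] = weak_solution_measurable(1,2)[OF sol T] \<nu>tm[OF T]
  show f: "set_integrable lebesgue ?Q ?f"
    by (rule set_integrable_dominated[OF _ _ h]) (use bound in \<open>auto simp: cylinder_sets\<close>)
  have "(LINT z:?Q|lebesgue. ?f z) \<le> (LINT z:?Q|lebesgue. 1 / 2 * ?D z + c\<^sup>2 / 2 * ?M z)"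
    using bound abs_le_D1 by (intro set_integral_mono f h) blast
  also have "\<dots> = 1 / 2 * (LINT z:?Q|lebesgue. ?D z) + c\<^sup>2 / 2 * (LINT z:?Q|lebesgue. ?M z)"
    by (subst set_integral_add(2); (intro set_integrable_mult_right total_dissipation_integrable[OF sol T] wall_viscosity_integrable[OF T])?;
        simp only: set_integral_mult_right)
  finally show "(LINT z:?Q|lebesgue. ?f z) \<le> 1 / 2 * (LINT z:?Q|lebesgue. ?D z) + c\<^sup>2 / 2 * (LINT z:?Q|lebesgue. ?M z)" .
qed

lemma convective_coupling:
  assumes T: "T > 0"
  shows "set_integrable lebesgue ({0<..<T} \<times> Omega L)
      (\<lambda>z. (Du (fst z) (snd z) *v u (fst z) (snd z)) \<bullet> shear_profile c (L - d) (snd z))"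
    and "(LINT z:{0<..<T} \<times> Omega L|lebesgue. (Du (fst z) (snd z) *v u (fst z) (snd z)) \<bullet> shear_profile c (L - d) (snd z))
      \<le> U * d * (LINT z:{0<..<T} \<times> Omega L|lebesgue. (norm (Du (fst z) (snd z)))\<^sup>2)"
proof -
  let ?Q = "{0<..<T} \<times> Omega L"
  let ?f = "\<lambda>z. (Du (fst z) (snd z) *v u (fst z) (snd z)) \<bullet> shear_profile c (L - d) (snd z)"
  have U: "U > 0"
    using c d by simp
  \<comment> \<open>A rough majorant, for integrability on the cylinder only; the sharp constant
    \<open>U * d\<close> comes afterwards from \<open>convective_bound\<close> at almost every
    time.\<close>
  have h: "set_integrable lebesgue ?Q (\<lambda>z. U * ((norm (Du (fst z) (snd z)))\<^sup>2 + (norm (u (fst z) (snd z)))\<^sup>2))"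
    by (intro set_integral_add set_integrable_mult_right weak_solution_measurable[OF sol T] weak_solution_square_integrable[OF sol T])
  have bound: "\<bar>?f z\<bar> \<le> U * ((norm (Du (fst z) (snd z)))\<^sup>2 + (norm (u (fst z) (snd z)))\<^sup>2)" if z: "z \<in> ?Q" for z
  proof -
    let ?G = "Du (fst z) (snd z)" and ?v = "u (fst z) (snd z)"
    have x: "snd z $ 3 < L"
      using z by (auto simp: mem_Omega)
    have "\<bar>c * ramp (L - d) (snd z $ 3)\<bar> \<le> U"
      using x c d by (auto simp: ramp_def abs_mult)
    moreover have "\<bar>?G $ 1 \<bullet> ?v\<bar> \<le> (norm ?G)\<^sup>2 + (norm ?v)\<^sup>2"
    proof -
      have "\<bar>?G $ 1 \<bullet> ?v\<bar> \<le> (norm (?G $ 1))\<^sup>2 / 2 + (norm ?v)\<^sup>2 / 2"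
        by (rule inner_le_half_squares)
      moreover have "(norm (?G $ 1))\<^sup>2 \<le> (norm ?G)\<^sup>2"
        by (intro power_mono Finite_Cartesian_Product.norm_nth_le) simp
      moreover have "0 \<le> (norm ?G)\<^sup>2" "0 \<le> (norm ?v)\<^sup>2"
        by simp_all
      ultimately show ?thesis
        by linarith
    qed
    ultimately show ?thesis
      unfolding convective_shear_profile abs_mult[of "c * _"] using U by (intro mult_mono) auto
  qed
  have [measurable]: "(\<lambda>z. Du (fst z) (snd z) $ 1) \<in> borel_measurable (lebesgue_on ?Q)"
    by (rule measurable_compose[OF weak_solution_measurable(2)[OF sol T]])
       (intro borel_measurable_continuous_onI continuous_intros)
  have "(\<lambda>z. ramp (L - d) (snd z $ 3)) \<in> borel_measurable (borel :: (real \<times> (real^3)) measure)"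
    unfolding borel_prod[symmetric] by measurable
  then have [measurable]: "(\<lambda>z. ramp (L - d) (snd z $ 3)) \<in> borel_measurable (lebesgue_on ?Q)"
    by (rule borel_imp_lebesgue_on)
  note [measurable] = weak_solution_measurable(1)[OF sol T]
  have fm: "?f \<in> borel_measurable (lebesgue_on ?Q)"
    unfolding convective_shear_profile by measurable
  show f: "set_integrable lebesgue ?Q ?f"
    by (rule set_integrable_dominated[OF _ fm h]) (use bound in \<open>auto simp: cylinder_sets\<close>)
  note Ff = set_integrable_lebesgue_Fubini[OF f]
    and FD = set_integrable_lebesgue_Fubini[OF weak_solution_measurable(3)[OF sol T]]
  have "(LINT z:?Q|lebesgue. ?f z) = (LINT t:{0<..<T}|lebesgue. LINT x:Omega L|lebesgue. (Du t x *v u t x) \<bullet> shear_profile c (L - d) x)"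
    using Ff(3) by simp
  also have "\<dots> \<le> (LINT t:{0<..<T}|lebesgue. U * d * (LINT x:Omega L|lebesgue. (norm (Du t x))\<^sup>2))"
  proof (rule set_integral_mono_AE)
    show "AE t\<in>{0<..<T} in lebesgue. (LINT x:Omega L|lebesgue. (Du t x *v u t x) \<bullet> shear_profile c (L - d) x)
        \<le> U * d * (LINT x:Omega L|lebesgue. (norm (Du t x))\<^sup>2)"
      using weak_solution_AE_H1[OF sol]
    proof eventually_elim
      case (elim t)
      then show ?case
        using convective_bound[OF L d c, of "u t" "Du t"] by auto
    qed
  qed (use Ff(2) FD(2) in \<open>auto intro: set_integrable_mult_right\<close>)
  also have "\<dots> = U * d * (LINT z:?Q|lebesgue. (norm (Du (fst z) (snd z)))\<^sup>2)"
    using FD(3) by simp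
  finally show "(LINT z:?Q|lebesgue. ?f z) \<le> U * d * (LINT z:?Q|lebesgue. (norm (Du (fst z) (snd z)))\<^sup>2)" .
qed

text \<open>The weights 1/2 are chosen so that the term in \<open>v\<close> is exactly the kinetic
  energy on the left of the energy inequality. The two cancel, and no bound on the final kinetic
  energy enters.\<close>

lemma velocity_coupling:
  assumes v: "L2_on (Omega L) v"
  shows "(LINT x:Omega L|lebesgue. (v x - u0 x) \<bullet> shear_profile c r x)
    \<le> 1 / 2 * (LINT x:Omega L|lebesgue. (norm (v x))\<^sup>2) + 1 / 2 * (LINT x:Omega L|lebesgue. (norm (u0 x))\<^sup>2)
      + (LINT x:Omega L|lebesgue. (norm (shear_profile c r x))\<^sup>2)"
proof -
  have \<phi>: "set_integrable lebesgue (Omega L) (\<lambda>x. (norm (shear_profile c r x))\<^sup>2)"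
    unfolding shear_profile_def norm_axis_eq
    by (intro set_integrable_lborel_imp_lebesgue continuous_set_integrable_Omega continuous_intros)
  have v2: "set_integrable lebesgue (Omega L) (\<lambda>x. (norm (v x))\<^sup>2)"
    and u02: "set_integrable lebesgue (Omega L) (\<lambda>x. (norm (u0 x))\<^sup>2)"
    using v u0 by (auto simp: L2_on_def)
  have [measurable]: "shear_profile c r \<in> borel_measurable (lebesgue_on (Omega L))"
    by (rule borel_imp_lebesgue_on) measurable
  have [measurable]: "v \<in> borel_measurable (lebesgue_on (Omega L))" "u0 \<in> borel_measurable (lebesgue_on (Omega L))"
    using v u0 by (auto simp: L2_on_def)
  let ?h = "\<lambda>x. 1 / 2 * (norm (v x))\<^sup>2 + 1 / 2 * (norm (u0 x))\<^sup>2 + (norm (shear_profile c r x))\<^sup>2"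
  have h: "set_integrable lebesgue (Omega L) ?h"
    by (intro set_integral_add set_integrable_mult_right \<phi> v2 u02)
  have bound: "\<bar>(v x - u0 x) \<bullet> shear_profile c r x\<bar> \<le> ?h x" for x
    using inner_le_half_squares[of "v x" "shear_profile c r x"] inner_le_half_squares[of "u0 x" "shear_profile c r x"]
    unfolding inner_diff_left by linarith
  have f: "set_integrable lebesgue (Omega L) (\<lambda>x. (v x - u0 x) \<bullet> shear_profile c r x)"
    by (rule set_integrable_dominated[OF _ _ h]) (use bound in auto)
  have "(LINT x:Omega L|lebesgue. (v x - u0 x) \<bullet> shear_profile c r x) \<le> (LINT x:Omega L|lebesgue. ?h x)"
    using bound abs_le_D1 by (intro set_integral_mono f h) blast
  also have "\<dots> = 1 / 2 * (LINT x:Omega L|lebesgue. (norm (v x))\<^sup>2) + 1 / 2 * (LINT x:Omega L|lebesgue. (norm (u0 x))\<^sup>2)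
      + (LINT x:Omega L|lebesgue. (norm (shear_profile c r x))\<^sup>2)"
    by (simp only: set_integral_add(2) set_integral_add(1) set_integrable_mult_right set_integral_mult_right v2 u02 \<phi> simp_thms)
  finally show ?thesis .
qed

lemma energy_growth:
  "AE T in lebesgue. 0 < T \<longrightarrow>
    1 / 2 * (LINT z:{0<..<T} \<times> Omega L|lebesgue. (\<nu> + \<nu>t (fst z) (snd z)) * (norm (Du (fst z) (snd z)))\<^sup>2)
    \<le> (LINT x:Omega L|lebesgue. (norm (u0 x))\<^sup>2) + (LINT x:Omega L|lebesgue. (norm (shear_profile c (L - d) x))\<^sup>2)
      + U * d * (LINT z:{0<..<T} \<times> Omega L|lebesgue. (norm (Du (fst z) (snd z)))\<^sup>2)
      + c\<^sup>2 / 2 * (LINT z:{0<..<T} \<times> Omega L|lebesgue. if L - d < snd z $ 3 then \<nu> + \<nu>t (fst z) (snd z) else 0)"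
proof -
  have "H1_shear L U (shear_profile c (L - d)) (shear_profile_grad c (L - d)) \<and> divergence_free L (shear_profile_grad c (L - d))"
    using H1_shear_profile[OF L, of "L - d" U c] c d by simp
  note en = energy[unfolded energy_inequality_def, rule_format, OF this]
  have "AE T in lebesgue. T \<in> {0<..} \<longrightarrow>
     set_integrable lebesgue ({0<..<T} \<times> Omega L) (\<lambda>(t, x). (\<nu> + \<nu>t t x) * (Du t x \<bullet> shear_profile_grad c (L - d) x)) \<and>
     set_integrable lebesgue ({0<..<T} \<times> Omega L) (\<lambda>(t, x). (Du t x *v u t x) \<bullet> shear_profile c (L - d) x) \<longrightarrow>
     1/2 * (LINT x:Omega L|lebesgue. (norm (u T x))\<^sup>2) - 1/2 * (LINT x:Omega L|lebesgue. (norm (u0 x))\<^sup>2)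
     + (LINT (t, x):{0<..<T} \<times> Omega L|lebesgue. (\<nu> + \<nu>t t x) * (norm (Du t x))\<^sup>2)
     \<le> (LINT x:Omega L|lebesgue. (u T x - u0 x) \<bullet> shear_profile c (L - d) x)
     + (LINT (t, x):{0<..<T} \<times> Omega L|lebesgue. (\<nu> + \<nu>t t x) * (Du t x \<bullet> shear_profile_grad c (L - d) x))
     + (LINT (t, x):{0<..<T} \<times> Omega L|lebesgue. (Du t x *v u t x) \<bullet> shear_profile c (L - d) x)"
    using en by (subst (asm) AE_lebesgue_on_iff) auto
  then show ?thesis
    using weak_solution_AE_H1[OF sol]
  proof eventually_elim
    case (elim T)
    show ?case
    proof
      assume T: "0 < T"
      then have "L2_on (Omega L) (u T)"
        using elim(2) by (simp add: H1_shear_def)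
      from velocity_coupling[OF this, of "L - d"] elim(1) T viscous_coupling[OF T] convective_coupling[OF T]
      show "1 / 2 * (LINT z:{0<..<T} \<times> Omega L|lebesgue. (\<nu> + \<nu>t (fst z) (snd z)) * (norm (Du (fst z) (snd z)))\<^sup>2)
        \<le> (LINT x:Omega L|lebesgue. (norm (u0 x))\<^sup>2) + (LINT x:Omega L|lebesgue. (norm (shear_profile c (L - d) x))\<^sup>2)
        + U * d * (LINT z:{0<..<T} \<times> Omega L|lebesgue. (norm (Du (fst z) (snd z)))\<^sup>2)
        + c\<^sup>2 / 2 * (LINT z:{0<..<T} \<times> Omega L|lebesgue. if L - d < snd z $ 3 then \<nu> + \<nu>t (fst z) (snd z) else 0)"
        by (simp add: case_prod_beta')
    qed
  qed
qed

text \<open>Written with iterated integrals, both sides depend continuously on \<open>T\<close>, so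
  the estimate holds at every positive time. The first two terms on the right do not grow with
  \<open>T\<close> and disappear in the time average.\<close>

lemma energy_growth_time:
  assumes T: "T > 0"
  shows "1 / 2 * (LINT t:{0<..<T}|lebesgue. LINT x:Omega L|lebesgue. (\<nu> + \<nu>t t x) * (norm (Du t x))\<^sup>2)
    \<le> (LINT x:Omega L|lebesgue. (norm (u0 x))\<^sup>2) + (LINT x:Omega L|lebesgue. (norm (shear_profile c (L - d) x))\<^sup>2)
      + U * d * (LINT t:{0<..<T}|lebesgue. LINT x:Omega L|lebesgue. (norm (Du t x))\<^sup>2)
      + c\<^sup>2 / 2 * (T * (d * L\<^sup>2 * \<nu>)
        + (LINT t:{0<..<T}|lebesgue. LINT x:Omega L|lebesgue. if L - d < x $ 3 then \<nu>t t x else 0))"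
proof -
  let ?D = "\<lambda>t. LINT x:Omega L|lebesgue. (\<nu> + \<nu>t t x) * (norm (Du t x))\<^sup>2"
  let ?E = "\<lambda>t. LINT x:Omega L|lebesgue. (norm (Du t x))\<^sup>2"
  let ?N = "\<lambda>t. LINT x:Omega L|lebesgue. if L - d < x $ 3 then \<nu>t t x else 0"
  let ?K = "(LINT x:Omega L|lebesgue. (norm (u0 x))\<^sup>2) + (LINT x:Omega L|lebesgue. (norm (shear_profile c (L - d) x))\<^sup>2)"
  let ?I = "\<lambda>f T. LINT t:{0<..<T}|lebesgue. f t :: real"
  note F = set_integrable_lebesgue_Fubini(2,3)
  have D: "set_integrable lebesgue {0<..<T} ?D"
    "(LINT z:{0<..<T} \<times> Omega L|lebesgue. (\<nu> + \<nu>t (fst z) (snd z)) * (norm (Du (fst z) (snd z)))\<^sup>2) = ?I ?D T"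
    if "T > 0" for T
    using F[OF total_dissipation_integrable[OF sol that]] by simp_all
  have E: "set_integrable lebesgue {0<..<T} ?E"
    "(LINT z:{0<..<T} \<times> Omega L|lebesgue. (norm (Du (fst z) (snd z)))\<^sup>2) = ?I ?E T"
    if "T > 0" for T
    using F[OF weak_solution_measurable(3)[OF sol that]] by simp_all
  have N: "set_integrable lebesgue {0<..<T} ?N"
    "(LINT z:{0<..<T} \<times> Omega L|lebesgue. if L - d < snd z $ 3 then \<nu>t (fst z) (snd z) else 0) = ?I ?N T"
    if "T > 0" for T
    using F[OF set_integrable_wall_layer[OF \<nu>ti[OF that], of "L - d"]] unfolding fst_conv snd_conv by simp_all
  have wall: "(LINT z:{0<..<T} \<times> Omega L|lebesgue. if L - d < snd z $ 3 then \<nu> + \<nu>t (fst z) (snd z) else 0)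
      = T * (d * L\<^sup>2 * \<nu>) + ?I ?N T" if "T > 0" for T
  proof -
    let ?Q = "{0<..<T} \<times> Omega L"
    have "(LINT z:?Q|lebesgue. if L - d < snd z $ 3 then \<nu> + \<nu>t (fst z) (snd z) else 0)
        = (LINT z:?Q|lebesgue. (if L - d < snd z $ 3 then \<nu> else 0) + (if L - d < snd z $ 3 then \<nu>t (fst z) (snd z) else 0))"
      unfolding set_lebesgue_integral_def by (intro Bochner_Integration.integral_cong) auto
    also have "\<dots> = (LINT z:?Q|lebesgue. if L - d < snd z $ 3 then \<nu> else 0)
        + (LINT z:?Q|lebesgue. if L - d < snd z $ 3 then \<nu>t (fst z) (snd z) else 0)"
      by (intro set_integral_add(2) set_integrable_wall_layer cylinder_const_integrable \<nu>ti[OF that])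
    also have "(LINT z:?Q|lebesgue. if L - d < snd z $ 3 then \<nu> else 0)
        = (LINT t:{0<..<T}|lebesgue. LINT x:Omega L|lebesgue. if L - d < x $ 3 then \<nu> else 0)"
      using F(2)[OF set_integrable_wall_layer[OF cylinder_const_integrable[of T L \<nu>], of "L - d"]] by simp
    also have "\<dots> = T * (d * L\<^sup>2 * \<nu>)"
      unfolding wall_layer_integral_const[OF d] using that by (simp add: set_integral_const)
    finally show ?thesis
      using N(2)[OF that] by simp
  qed
  have "AE T in lebesgue. 0 < T \<longrightarrow>
      1 / 2 * ?I ?D T \<le> ?K + U * d * ?I ?E T + c\<^sup>2 / 2 * (T * (d * L\<^sup>2 * \<nu>) + ?I ?N T)"
    using energy_growth
  proof eventually_elim
    case (elim T)
    then show ?case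
      using D(2)[of T] E(2)[of T] wall[of T] by simp
  qed
  then show ?thesis
    by (rule AE_le_imp_le[OF _ _ _ T, rotated 2])
       (intro continuous_intros time_integral_continuous D E N; assumption)+
qed

end

section \<open>Long-time averages\<close>

lemma time_average_ensemble:
  fixes F :: "nat \<Rightarrow> real \<Rightarrow> real"
  assumes F: "\<And>j. j \<in> {1..J} \<Longrightarrow> set_integrable lebesgue {0<..<T} (F j)"
  shows "1 / T * (LINT t:{0..T}|lebesgue. ensemble_avg J (\<lambda>j. 1 / m * F j t))
    = ensemble_avg J (\<lambda>j. 1 / (T * m) * (LINT t:{0<..<T}|lebesgue. F j t))"
proof -
  have "(LINT t:{0..T}|lebesgue. ensemble_avg J (\<lambda>j. 1 / m * F j t))
      = 1 / real J * (LINT t:{0<..<T}|lebesgue. (\<Sum>j=1..J. 1 / m * F j t))"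
    unfolding time_integral_open_interval ensemble_avg_def by simp
  also have "(LINT t:{0<..<T}|lebesgue. (\<Sum>j=1..J. 1 / m * F j t)) = (\<Sum>j=1..J. 1 / m * (LINT t:{0<..<T}|lebesgue. F j t))"
    by (subst set_integrable_sum_finite(2)) (use F in \<open>auto intro: set_integrable_mult_right\<close>)
  finally show ?thesis
    by (simp add: ensemble_avg_def sum_divide_distrib mult_ac)
qed

lemma ensemble_avg_mono:
  fixes f g :: "nat \<Rightarrow> real"
  assumes "\<And>j. j \<in> {1..J} \<Longrightarrow> f j \<le> g j"
  shows "ensemble_avg J f \<le> ensemble_avg J g"
  unfolding ensemble_avg_def using assms by (auto intro!: divide_right_mono sum_mono)

lemma ensemble_avg_linear:
  fixes f g :: "nat \<Rightarrow> real"
  shows "ensemble_avg J (\<lambda>j. f j + g j) = ensemble_avg J f + ensemble_avg J g"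
    and "ensemble_avg J (\<lambda>j. a * f j) = a * ensemble_avg J f"
    and "J \<ge> 1 \<Longrightarrow> ensemble_avg J (\<lambda>j. a) = a"
  by (simp_all add: ensemble_avg_def sum.distrib add_divide_distrib sum_distrib_left[symmetric])

theorem theorem1:
  fixes L U \<nu> \<tau> \<mu> :: real and J :: nat
    and u0 :: "nat \<Rightarrow> real^3 \<Rightarrow> real^3"
    and u :: "nat \<Rightarrow> real \<Rightarrow> real^3 \<Rightarrow> real^3"
    and Du :: "nat \<Rightarrow> real \<Rightarrow> real^3 \<Rightarrow> real^3^3"
  defines "\<nu>t \<equiv> nu_turb \<mu> \<tau> J u"
  defines "\<nu>e \<equiv> nu_eff L \<nu> \<nu>t J Du"
  defines "Re_eff \<equiv> U * L / \<nu>e"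
  defines "\<beta> \<equiv> 1 / 8 * inverse Re_eff"
  assumes pos: "L > 0" "U > 0" "\<nu> > 0" "\<tau> > 0" "\<mu> > 0" and "\<tau> \<le> L / U" and "J \<ge> 1"
    and initial: "\<And>j. j \<in> {1..J} \<Longrightarrow> L2_on (Omega L) (u0 j) \<and> weakly_divergence_free (Omega L) (u0 j)"
    and solution: "\<And>j. j \<in> {1..J} \<Longrightarrow> weak_solution L U \<nu> \<nu>t (u0 j) (u j) (Du j)"
    and energy: "\<And>j. j \<in> {1..J} \<Longrightarrow> energy_inequality L U \<nu> \<nu>t (u0 j) (u j) (Du j)"
    and finite_avgs: "\<bar>viscous_avg L \<nu> \<nu>t J Du\<bar> \<noteq> \<infinity>" "\<bar>gradient_avg L J Du\<bar> \<noteq> \<infinity>"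
    and near_wall: "near_wall_region L \<beta> \<subseteq> closure (Omega L)"
  shows "time_avg (eps_model L \<nu> \<nu>t J Du)
    \<le> (5 / 2 + 16 * ereal (\<nu> / \<nu>e)
        + 32 * time_avg (\<lambda>t. space_avg (near_wall_region L \<beta>) (\<lambda>x. \<nu>t t x / \<nu>e)))
      * ereal (U ^ 3 / L)"
proof -
  note L = pos(1) and U = pos(2) and \<nu> = pos(3)
  let ?\<Omega> = "Omega L"
  define D where "D j t = (LINT x:?\<Omega>|lebesgue. (\<nu> + \<nu>t t x) * (norm (Du j t x))\<^sup>2)" for j t
  define E where "E j t = (LINT x:?\<Omega>|lebesgue. (norm (Du j t x))\<^sup>2)" for j t
  define ID where "ID j T = (LINT t:{0<..<T}|lebesgue. D j t)" for j T
  define IE where "IE j T = (LINT t:{0<..<T}|lebesgue. E j t)" for j T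
  define a where "a T = 1 / T * (LINT t:{0..T}|lebesgue. ensemble_avg J (\<lambda>j. 1 / L ^ 3 * D j t))" for T
  define e where "e T = 1 / T * (LINT t:{0..T}|lebesgue. ensemble_avg J (\<lambda>j. 1 / L ^ 3 * E j t))" for T
  have \<nu>t0: "0 \<le> \<nu>t t x" for t x
    unfolding \<nu>t_def using pos by (intro nu_turb_nonneg) auto
  have \<nu>tm: "(\<lambda>z. \<nu>t (fst z) (snd z)) \<in> borel_measurable (lebesgue_on ({0<..<T} \<times> ?\<Omega>))"
    and \<nu>ti: "set_integrable lebesgue ({0<..<T} \<times> ?\<Omega>) (\<lambda>z. \<nu>t (fst z) (snd z))" if "T > 0" for T
    unfolding \<nu>t_def using nu_turb_integrable[OF \<open>J \<ge> 1\<close> _ _ that solution] pos by simp_all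
  have D_int: "set_integrable lebesgue {0<..<T} (D j)" if "j \<in> {1..J}" "T > 0" for j T
    using set_integrable_lebesgue_Fubini(2)[OF total_dissipation_integrable[OF solution[OF that(1)] that(2)]]
    by (simp add: D_def[abs_def])
  have E_int: "set_integrable lebesgue {0<..<T} (E j)" if "j \<in> {1..J}" "T > 0" for j T
    using set_integrable_lebesgue_Fubini(2)[OF weak_solution_measurable(3)[OF solution[OF that(1)] that(2)]]
    by (simp add: E_def[abs_def])
  have a_eq: "a T = ensemble_avg J (\<lambda>j. 1 / (T * L ^ 3) * ID j T)"
    and e_eq: "e T = ensemble_avg J (\<lambda>j. 1 / (T * L ^ 3) * IE j T)" if "T > 0" for T
    unfolding a_def e_def ID_def IE_def
    by (rule time_average_ensemble, rule D_int E_int, assumption, rule that)+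
  have visc: "viscous_avg L \<nu> \<nu>t J Du = Limsup at_top (\<lambda>T. ereal (a T))"
    and grad: "gradient_avg L J Du = Limsup at_top (\<lambda>T. ereal (e T))"
    unfolding viscous_avg_def gradient_avg_def time_avg_def space_avg_def measure_Omega[OF L] a_def e_def D_def E_def
    by (rule refl)+
  have eps: "time_avg (eps_model L \<nu> \<nu>t J Du) = viscous_avg L \<nu> \<nu>t J Du"
    unfolding viscous_avg_def eps_model_def[abs_def] distrib_right ..

  \<comment> \<open>Positivity of the averages that define the effective viscosity\<close>
  have e_lower: "U\<^sup>2 / L\<^sup>2 \<le> e T" and a_lower: "\<nu> * e T \<le> a T" if T: "T > 0" for T
  proof -
    have "U\<^sup>2 / L\<^sup>2 \<le> 1 / (T * L ^ 3) * IE j T" if j: "j \<in> {1..J}" for j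
    proof -
      have "(LINT t:{0<..<T}|lebesgue. U\<^sup>2 * L) \<le> IE j T"
        unfolding IE_def
      proof (rule set_integral_mono_AE)
        show "set_integrable lebesgue {0<..<T} (\<lambda>t. U\<^sup>2 * L)"
          using T by (intro set_integrable_finite_const) auto
        show "AE t\<in>{0<..<T} in lebesgue. U\<^sup>2 * L \<le> E j t"
          using weak_solution_AE_H1[OF solution[OF j]]
          by eventually_elim (auto simp: E_def intro: shear_gradient_lower_bound[OF L])
      qed (rule E_int[OF j T])
      then have "T * (U\<^sup>2 * L) \<le> IE j T"
        using T by (simp add: set_integral_const mult_ac)
      then have "1 / (T * L ^ 3) * (T * (U\<^sup>2 * L)) \<le> 1 / (T * L ^ 3) * IE j T"
        using T L by (intro mult_left_mono) auto
      then show ?thesis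
        using T L by (simp add: power2_eq_square power3_eq_cube)
    qed
    from ensemble_avg_mono[of J "\<lambda>_. U\<^sup>2 / L\<^sup>2", OF this] show "U\<^sup>2 / L\<^sup>2 \<le> e T"
      by (simp add: e_eq[OF T] ensemble_avg_linear(3)[OF \<open>J \<ge> 1\<close>])
    have "\<nu> * (1 / (T * L ^ 3) * IE j T) \<le> 1 / (T * L ^ 3) * ID j T" if j: "j \<in> {1..J}" for j
    proof -
      have "(LINT t:{0<..<T}|lebesgue. \<nu> * E j t) \<le> ID j T"
        unfolding ID_def
      proof (rule set_integral_mono_AE)
        have "AE t in lebesgue. t \<in> {0<..<T} \<longrightarrow> set_integrable lebesgue ?\<Omega> (\<lambda>x. (\<nu> + \<nu>t t x) * (norm (Du j t x))\<^sup>2)"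
          using set_integrable_lebesgue_Fubini(1)[OF total_dissipation_integrable[OF solution[OF j] T]] by simp
        then show "AE t\<in>{0<..<T} in lebesgue. \<nu> * E j t \<le> D j t"
          using weak_solution_AE_H1[OF solution[OF j]]
        proof eventually_elim
          case (elim t)
          show ?case
          proof
            assume t: "t \<in> {0<..<T}"
            then have E: "set_integrable lebesgue ?\<Omega> (\<lambda>x. (norm (Du j t x))\<^sup>2)"
              using elim(2) H1_shear_squares(3) by auto
            have "(LINT x:?\<Omega>|lebesgue. \<nu> * (norm (Du j t x))\<^sup>2) \<le> D j t"
              unfolding D_def using elim(1) t \<nu>t0
              by (intro set_integral_mono set_integrable_mult_right E) (auto intro: mult_right_mono)
            then show "\<nu> * E j t \<le> D j t"
              by (simp add: E_def)
          qed
        qed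
      qed (use E_int[OF j T] D_int[OF j T] in auto)
      then have "1 / (T * L ^ 3) * (\<nu> * IE j T) \<le> 1 / (T * L ^ 3) * ID j T"
        using T L by (intro mult_left_mono) (auto simp: IE_def)
      then show ?thesis
        by simp
    qed
    from ensemble_avg_mono[OF this] show "\<nu> * e T \<le> a T"
      unfolding a_eq[OF T] e_eq[OF T] ensemble_avg_linear(2) .
  qed
  obtain A G where A: "viscous_avg L \<nu> \<nu>t J Du = ereal A" and G: "gradient_avg L J Du = ereal G"
    using finite_avgs by (metis abs_neq_infinity_cases)
  have G_pos: "G > 0"
  proof -
    have "ereal (U\<^sup>2 / L\<^sup>2) \<le> ereal G"
      unfolding G[symmetric] grad
      by (rule le_Limsup) (auto intro: eventually_mono[OF eventually_gt_at_top[of 0]] e_lower)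
    moreover have "U\<^sup>2 / L\<^sup>2 > 0"
      using U L by simp
    ultimately show ?thesis
      by simp
  qed
  have A_pos: "A > 0"
  proof -
    have "ereal (\<nu> * (U\<^sup>2 / L\<^sup>2)) \<le> ereal A"
      unfolding A[symmetric] visc
    proof (rule le_Limsup)
      show "\<forall>\<^sub>F T in at_top. ereal (\<nu> * (U\<^sup>2 / L\<^sup>2)) \<le> ereal (a T)"
        using eventually_gt_at_top[of 0]
      proof eventually_elim
        case (elim T)
        have "\<nu> * (U\<^sup>2 / L\<^sup>2) \<le> \<nu> * e T"
          using e_lower[OF elim] \<nu> by (intro mult_left_mono) auto
        also note a_lower[OF elim]
        finally show ?case by simp
      qed
    qed simp
    moreover have "\<nu> * (U\<^sup>2 / L\<^sup>2) > 0"
      using U L \<nu> by simp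
    ultimately show ?thesis
      by simp
  qed
  have \<nu>e: "\<nu>e = A / G" "\<nu>e > 0"
    using G_pos A_pos by (simp_all add: \<nu>e_def nu_eff_def A G)

  \<comment> \<open>This thickness of the wall layer makes the constant \<open>U * d\<close> of the convective term equal to \<open>\<nu>e / 8\<close>.\<close>
  define d where "d = \<beta> * L"
  define c where "c = U / d"
  have \<beta>_eq: "\<beta> = \<nu>e / (8 * U * L)"
    by (simp add: \<beta>_def Re_eff_def)
  \<comment> \<open>Positivity comes from \<open>\<nu>e\<close>, the upper bound from the position
    of the near wall region. Together they give \<open>0 < d\<close> and \<open>d \<le> L\<close>,
    so the ramp starts within the box.\<close>
  have \<beta>: "0 < \<beta>" "\<beta> \<le> 1"
    using near_wall_region_subset_imp[OF L near_wall] \<nu>e(2) U L by (simp_all add: \<beta>_eq)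
  have d: "0 < d" "d \<le> L" and d_eq: "d = \<nu>e / (8 * U)"
    using \<beta> L by (simp_all add: d_def) (simp add: \<beta>_eq)
  have c: "c > 0" "U = c * d"
    using U d by (simp_all add: c_def)
  define X where "X T = 1 / T * (LINT t:{0..T}|lebesgue. space_avg (near_wall_region L \<beta>) (\<lambda>x. \<nu>t t x / \<nu>e))" for T
  define N where "N t = (LINT x:?\<Omega>|lebesgue. if L - d < x $ 3 then \<nu>t t x else 0)" for t
  have X_eq: "X T = 1 / (T * (\<beta> * L ^ 3 * \<nu>e)) * (LINT t:{0<..<T}|lebesgue. N t)" for T
  proof -
    have "space_avg (near_wall_region L \<beta>) (\<lambda>x. \<nu>t t x / \<nu>e) = 1 / (\<beta> * L ^ 3 * \<nu>e) * N t" for t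
      using near_wall_region_integral[OF \<beta> L, of "\<nu>t t"]
      by (simp add: space_avg_def measure_near_wall_region[OF \<beta> L] N_def d_def)
    then show ?thesis
      by (simp add: X_def time_integral_open_interval)
  qed
  have N0: "0 \<le> N t" for t
    unfolding N_def set_lebesgue_integral_def using \<nu>t0 by (intro integral_nonneg_AE) auto
  have X0: "0 \<le> X T" if "T > 0" for T
    unfolding X_eq set_lebesgue_integral_def using that N0 \<beta> L \<nu>e(2)
    by (intro mult_nonneg_nonneg integral_nonneg_AE) auto

  define K where "K j = (LINT x:?\<Omega>|lebesgue. (norm (u0 j x))\<^sup>2)
    + (LINT x:?\<Omega>|lebesgue. (norm (shear_profile c (L - d) x))\<^sup>2)" for j
  \<comment> \<open>With \<open>c = U / d\<close> and \<open>d = \<nu>e / (8 * U)\<close>, the layer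
    term has coefficient \<open>c\<^sup>2 * d / (2 * L)\<close>, which is
    \<open>4 * U ^ 3 / (L * \<nu>e)\<close>; \<open>q\<close> is \<open>\<nu>e\<close> times
    this.\<close>
  define q where "q = 4 * U ^ 3 / L"
  have ineq: "1 / 2 * a T \<le> (ensemble_avg J K / L ^ 3) / T + \<nu>e / 8 * e T + q * (\<nu> / \<nu>e + X T)" if T: "T > 0" for T
  proof -
    let ?s = "1 / (T * L ^ 3)"
    let ?R = "c\<^sup>2 / 2 * (T * (d * L\<^sup>2 * \<nu>) + (LINT t:{0<..<T}|lebesgue. N t))"
    define R where "R = ?s * ?R"
    have "1 / 2 * (?s * ID j T) \<le> ?s * K j + \<nu>e / 8 * (?s * IE j T) + R" if j: "j \<in> {1..J}" for j
    proof -
      have "1 / 2 * ID j T \<le> K j + U * d * IE j T + ?R"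
        using energy_growth_time[OF L d c \<nu> _ \<nu>t0 \<nu>tm \<nu>ti solution[OF j] energy[OF j] T] initial[OF j]
        by (simp add: ID_def IE_def D_def E_def K_def N_def)
      then have "?s * (1 / 2 * ID j T) \<le> ?s * (K j + U * d * IE j T + ?R)"
        using T L by (intro mult_left_mono) auto
      moreover have "U * d = \<nu>e / 8"
        using U by (simp add: d_eq)
      ultimately show ?thesis
        by (simp add: R_def algebra_simps)
    qed
    then have "ensemble_avg J (\<lambda>j. 1 / 2 * (?s * ID j T))
        \<le> ensemble_avg J (\<lambda>j. ?s * K j + \<nu>e / 8 * (?s * IE j T) + R)"
      by (rule ensemble_avg_mono)
    then have "1 / 2 * a T \<le> ?s * ensemble_avg J K + \<nu>e / 8 * e T + R"
      unfolding ensemble_avg_linear(1,2) ensemble_avg_linear(3)[OF \<open>J \<ge> 1\<close>] a_eq[OF T] e_eq[OF T] .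
    moreover have "R = q * (\<nu> / \<nu>e + X T)"
    proof -
      \<comment> \<open>The volume \<open>\<beta> * L ^ 3\<close> of the near wall region is
        \<open>d * L\<^sup>2\<close>.\<close>
      have "(LINT t:{0<..<T}|lebesgue. N t) = T * (d * L\<^sup>2 * \<nu>e) * X T"
        using T L \<beta> \<nu>e(2) by (simp add: X_eq d_def power2_eq_square power3_eq_cube)
      then have "R = c\<^sup>2 * d / (2 * L) * (\<nu> + \<nu>e * X T)"
        using T L by (simp add: R_def field_simps power2_eq_square power3_eq_cube)
      also have "c\<^sup>2 * d / (2 * L) = q / \<nu>e"
        using U L \<nu>e(2) by (simp add: c_def d_eq q_def field_simps power2_eq_square power3_eq_cube)
      also have "q / \<nu>e * (\<nu> + \<nu>e * X T) = q * (\<nu> / \<nu>e + X T)"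
        using \<nu>e(2) by (simp add: field_simps)
      finally show ?thesis .
    qed
    ultimately show ?thesis
      by (simp add: mult.commute)
  qed

  \<comment> \<open>Passage to the limit superior\<close>
  let ?X = "Limsup at_top (\<lambda>T. ereal (X T))"
  have X_avg: "time_avg (\<lambda>t. space_avg (near_wall_region L \<beta>) (\<lambda>x. \<nu>t t x / \<nu>e)) = ?X"
    by (simp add: time_avg_def X_def)
  have X_nonneg: "0 \<le> ?X"
    by (rule le_Limsup) (auto intro: eventually_mono[OF eventually_gt_at_top[of 0]] X0)
  have UL: "0 < U ^ 3 / L"
    using U L by simp
  show ?thesis
  proof (cases ?X)
    case (real x)
    then have x: "x \<ge> 0"
      using X_nonneg by simp
    have s: "\<nu> / \<nu>e \<ge> 0"
      using \<nu> \<nu>e(2) by simp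
    have "A \<le> 8 / 3 * q * (\<nu> / \<nu>e + x)"
    \<comment> \<open>The absorption condition holds because \<open>\<nu>e * G = A\<close>, by the
      definition of the effective viscosity.\<close>
    proof (rule Limsup_absorption[OF visc[symmetric, unfolded A] grad[symmetric, unfolded G] real ineq])
      show "\<nu>e / 8 * G = A / 8"
        using G_pos by (simp add: \<nu>e(1))
    qed (use \<nu>e(2) U L in \<open>auto simp: q_def\<close>)
    also have "\<dots> = (32 / 3 * (\<nu> / \<nu>e) + 32 / 3 * x) * (U ^ 3 / L)"
      by (simp add: q_def algebra_simps add_divide_distrib)
    \<comment> \<open>Both coefficients 32/3 are below the stated 16 and 32, all terms being
      nonnegative.\<close>
    also have "\<dots> \<le> (5 / 2 + 16 * (\<nu> / \<nu>e) + 32 * x) * (U ^ 3 / L)"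
      using UL x s by (intro mult_right_mono) linarith+
    finally show ?thesis
      unfolding eps A X_avg real by simp
  next
    \<comment> \<open>The right-hand side is infinite, since \<open>U ^ 3 / L\<close> is
      positive.\<close>
    case PInf
    then show ?thesis
      using U L \<nu> \<nu>e(2) unfolding X_avg by simp
  next
    case MInf
    then show ?thesis
      using X_nonneg by simp
  qed
qed

end
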